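(* Let $\mathcal{M}\subset\mathcal{M}(\mathbb{C}P^N)$ be a $\mathbb{C}$-invariant closed subset, and let $$\mathcal{M}_+:=\overline{\{f\in\mathcal{M}: e(f)>0\}}$$ be the closure of the set of curves in $\mathcal{M}$ of positive mean energy (a $\mathbb{C}$-invariant closed subset of $\mathcal{M}$). Then $$\dim(\mathcal{M}:\mathbb{C})=\dim(\mathcal{M}_+:\mathbb{C}),$$ where $\dim(\mathcal{M}_+:\mathbb{C})=\dim(\emptyset:\mathbb{C}):=0$ if $\mathcal{M}_+$ is empty.
   Context: Fubini-Study form and norm: $\omega_{FS}$ is the 2-form on $\mathbb{C}P^N$ given on $\{[1:z_1:\cdots:z_N]\}$ by $\omega_{FS}=\frac{\sqrt{-1}}{2\pi}\partial\bar\partial\log(1+\sum_{i=1}^N|z_i|^2)$. For holomorphic $f:\mathbb{C}\to\mathbb{C}P^N$, with $z=x+y\sqrt{-1}$, define $|df|(z)\ge 0$ by $f^*\omega_{FS}=|df|^2\,dx\,dy$. Brody curves: $\mathcal{M}(\mathbb{C}P^N)$ is the set of holomorphic $f:\mathbb{C}\to\mathbb{C}P^N$ with $|df|(z)\le 1$ for all $z\in\mathbb{C}$, with the compact-open topology; it is compact and metrizable, and $\mathbb{C}$ acts continuously on it by $(a,f(z))\mapsto f(z+a)$. Mean energy: $T(r,f):=\int_1^r\frac{dt}{t}\int_{|z|\le t}|df|^2(z)\,dx\,dy$ for $r\ge1$ and $e(f):=\limsup_{r\to\infty}\frac{2}{\pi r^2}T(r,f)$. Mean dimension: for a compact metric space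 $(M,d)$ and $\varepsilon>0$, $\mathrm{Widim}_\varepsilon(M,d)$ is the minimal $n$ such that there are an $n$-dimensional finite polyhedron $P$ and a continuous map $g:M\to P$ with $\mathrm{Diam}(g^{-1}(p))\le\varepsilon$ for all $p\in P$. If $\mathbb{C}=\mathbb{R}^2$ acts continuously on $M$ and $\Omega\subset\mathbb{R}^2$ is bounded, put $d_\Omega(x,y):=\sup_{\gamma\in\Omega}d(\gamma.x,\gamma.y)$. Then $\mathrm{Widim}_\varepsilon(M:\mathbb{C}):=\lim_{n\to\infty}\frac1{n^2}\mathrm{Widim}_\varepsilon(M,d_{[0,n)^2})$ and $\dim(M:\mathbb{C}):=\lim_{\varepsilon\downarrow0}\mathrm{Widim}_\varepsilon(M:\mathbb{C})$; this does not depend on the choice of metric compatible with the topology of $M$. *)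

theory Defs
  imports "HOL-Analysis.Analysis"
begin

text \<open>Complex projective space with homogeneous coordinates indexed by a finite type \<open>'n\<close>;
  this is \<open>CP^N\<close> for \<open>N = CARD('n) - 1\<close>.\<close>

definition proportional :: "complex ^ 'n \<Rightarrow> complex ^ 'n \<Rightarrow> bool" where
  "proportional v w \<longleftrightarrow> v \<noteq> 0 \<and> w \<noteq> 0 \<and> (\<exists>c. c \<noteq> 0 \<and> w = c *s v)"

quotient_type (overloaded) 'n cproj = "complex ^ ('n::finite)" / partial: proportional
proof (rule part_equivpI)
  have "(1 :: complex ^ 'n) = 1 *s 1"
    by (rule vector_smult_lid [symmetric])
  then have "proportional (1 :: complex ^ 'n) 1"
    unfolding proportional_def by (intro conjI exI[of _ 1] one_neq_zero)
  then show "\<exists>v :: complex ^ 'n. proportional v v" by blast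
  show "symp (proportional :: complex ^ 'n \<Rightarrow> _)"
  proof (rule sympI)
    fix v w :: "complex ^ 'n"
    assume "proportional v w"
    then obtain c where c: "v \<noteq> 0" "w \<noteq> 0" "c \<noteq> 0" "w = c *s v"
      unfolding proportional_def by blast
    then have "v = inverse c *s w"
      by (simp add: vector_smult_assoc)
    then show "proportional w v"
      unfolding proportional_def using c by (intro conjI exI[of _ "inverse c"] nonzero_imp_inverse_nonzero)
  qed
  show "transp (proportional :: complex ^ 'n \<Rightarrow> _)"
  proof (rule transpI)
    fix u v w :: "complex ^ 'n"
    assume "proportional u v" "proportional v w"
    then obtain c e where c: "u \<noteq> 0" "w \<noteq> 0" "c \<noteq> 0" "v = c *s u" "e \<noteq> 0" "w = e *s v"
      unfolding proportional_def by blast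
    then have "w = (e * c) *s u"
      by (simp add: vector_smult_assoc)
    then show "proportional u w"
      unfolding proportional_def using c by (intro conjI exI[of _ "e * c"] no_zero_divisors)
  qed
qed

text \<open>The quotient topology from the punctured vector space.\<close>

instantiation cproj :: (finite) topological_space
begin

definition open_cproj :: "'a cproj set \<Rightarrow> bool" where
  "open_cproj U \<longleftrightarrow> open {v. v \<noteq> 0 \<and> abs_cproj v \<in> U}"

instance
proof
  have "{v :: complex ^ 'a. v \<noteq> 0 \<and> abs_cproj v \<in> UNIV} = - {0}" by blast
  moreover have "open (- {0 :: complex ^ 'a})" by (rule open_Compl) (rule closed_singleton)
  ultimately show "open (UNIV :: 'a cproj set)"
    by (simp only: open_cproj_def)
next
  fix S T :: "'a cproj set"
  assume "open S" "open T"
  then have "open ({v. v \<noteq> 0 \<and> abs_cproj v \<in> S} \<inter> {v. v \<noteq> 0 \<and> abs_cproj v \<in> T})"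
    unfolding open_cproj_def by (rule open_Int)
  moreover have "{v. v \<noteq> 0 \<and> abs_cproj v \<in> S} \<inter> {v. v \<noteq> 0 \<and> abs_cproj v \<in> T}
      = {v. v \<noteq> 0 \<and> abs_cproj v \<in> S \<inter> T}" by blast
  ultimately show "open (S \<inter> T)"
    by (simp only: open_cproj_def)
next
  fix K :: "'a cproj set set"
  assume "\<forall>S\<in>K. open S"
  then have "open (\<Union>S\<in>K. {v. v \<noteq> 0 \<and> abs_cproj v \<in> S})"
    unfolding open_cproj_def by (rule open_UN)
  moreover have "(\<Union>S\<in>K. {v. v \<noteq> 0 \<and> abs_cproj v \<in> S}) = {v. v \<noteq> 0 \<and> abs_cproj v \<in> \<Union>K}"
    by blast
  ultimately show "open (\<Union>K)"
    by (simp only: open_cproj_def)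
qed

end

text \<open>The affine chart \<open>{Z\<^sub>j \<noteq> 0}\<close>. The coordinates \<open>Z\<^sub>i / Z\<^sub>j\<close> are kept in a vector indexed by
  all of \<open>'n\<close>, so its \<open>j\<close>-th component is the constant 1.\<close>

lift_definition in_chart :: "'n::finite \<Rightarrow> 'n cproj \<Rightarrow> bool" is "\<lambda>j Z. Z $ j \<noteq> 0"
  unfolding proportional_def by (elim conjE exE) simp

lift_definition coord_ratio :: "'n::finite \<Rightarrow> 'n \<Rightarrow> 'n cproj \<Rightarrow> complex"
  is "\<lambda>i j Z. Z $ i / Z $ j"
  unfolding proportional_def by (elim conjE exE) simp

definition affine_coords :: "'n::finite \<Rightarrow> 'n cproj \<Rightarrow> complex ^ 'n" where
  "affine_coords j p = (\<chi> i. coord_ratio i j p)"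

definition holomorphic_curve :: "(complex \<Rightarrow> 'n::finite cproj) \<Rightarrow> bool" where
  "holomorphic_curve f \<longleftrightarrow> continuous_on UNIV f \<and>
     (\<forall>j i. (\<lambda>z. affine_coords j (f z) $ i) holomorphic_on {z. in_chart j (f z)})"


section \<open>The Fubini-Study form\<close>

definition dir_deriv :: "complex ^ 'n \<Rightarrow> (complex ^ 'n \<Rightarrow> complex) \<Rightarrow> complex ^ ('n::finite) \<Rightarrow> complex"
  where "dir_deriv v u w = vector_derivative (\<lambda>t::real. u (w + t *\<^sub>R v)) (at 0)"

definition d_z :: "'n \<Rightarrow> (complex ^ 'n \<Rightarrow> complex) \<Rightarrow> complex ^ ('n::finite) \<Rightarrow> complex" where
  "d_z k u w = (dir_deriv (axis k 1) u w - \<i> * dir_deriv (axis k \<i>) u w) / 2"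

definition d_zbar :: "'n \<Rightarrow> (complex ^ 'n \<Rightarrow> complex) \<Rightarrow> complex ^ ('n::finite) \<Rightarrow> complex" where
  "d_zbar k u w = (dir_deriv (axis k 1) u w + \<i> * dir_deriv (axis k \<i>) u w) / 2"

text \<open>The 2-form \<open>\<partial>\<partial>\<^sup>-u = \<Sum>\<^sub>k\<^sub>l (\<partial>\<^sup>2u / \<partial>z\<^sub>k \<partial>z\<^sup>-\<^sub>l) dz\<^sub>k \<and> dz\<^sup>-\<^sub>l\<close> at the point \<open>w\<close>, evaluated on
  the tangent vectors \<open>a\<close> and \<open>b\<close>.\<close>

definition ddbar :: "(complex ^ 'n \<Rightarrow> complex) \<Rightarrow> complex ^ 'n \<Rightarrow> complex ^ 'n \<Rightarrow> complex ^ ('n::finite)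
    \<Rightarrow> complex" where
  "ddbar u w a b =
     (\<Sum>k\<in>UNIV. \<Sum>l\<in>UNIV. d_z k (d_zbar l u) w * (a $ k * cnj (b $ l) - b $ k * cnj (a $ l)))"

text \<open>\<open>\<omega>\<^sub>F\<^sub>S\<close> in the chart \<open>{Z\<^sub>j \<noteq> 0}\<close>. It has the same expression in every standard chart, and the
  expressions agree on overlaps because their potentials differ by \<open>log |Z\<^sub>i / Z\<^sub>j|\<^sup>2\<close>.
  The potential does not depend on the dummy \<open>j\<close>-th coordinate.\<close>

definition fubini_study :: "'n \<Rightarrow> complex ^ 'n \<Rightarrow> complex ^ 'n \<Rightarrow> complex ^ ('n::finite) \<Rightarrow> complex" where
  "fubini_study j w a b = \<i> / (2 * of_real pi) *
     ddbar (\<lambda>w. of_real (ln (1 + (\<Sum>i\<in>UNIV - {j}. (cmod (w $ i))\<^sup>2)))) w a b"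

text \<open>The coefficient of \<open>dx dy\<close> in \<open>f\<^sup>*\<omega>\<^sub>F\<^sub>S\<close> is its value on \<open>(\<partial>/\<partial>x, \<partial>/\<partial>y)\<close>, whose images under the
  differential of \<open>f\<close> are \<open>f'\<close> and \<open>\<i> f'\<close>.\<close>

definition energy_density :: "(complex \<Rightarrow> 'n::finite cproj) \<Rightarrow> complex \<Rightarrow> real" where
  "energy_density f z =
     (let j = (SOME j. in_chart j (f z));
          f' = (\<chi> i. deriv (\<lambda>w. affine_coords j (f w) $ i) z)
      in Re (fubini_study j (affine_coords j (f z)) f' (\<i> *s f')))"

definition fs_norm :: "(complex \<Rightarrow> 'n::finite cproj) \<Rightarrow> complex \<Rightarrow> real" where
  "fs_norm f z = sqrt (energy_density f z)"


section \<open>Brody curves\<close>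

definition compact_open_topology :: "('a::topological_space \<Rightarrow> 'b::topological_space) topology" where
  "compact_open_topology =
     topology_generated_by {{f. continuous_on UNIV f \<and> f ` K \<subseteq> U} | K U. compact K \<and> open U}"

definition brody_space :: "(complex \<Rightarrow> 'n::finite cproj) topology" where
  "brody_space =
     subtopology compact_open_topology {f. holomorphic_curve f \<and> (\<forall>z. fs_norm f z \<le> 1)}"

definition translate :: "complex \<Rightarrow> (complex \<Rightarrow> 'b) \<Rightarrow> complex \<Rightarrow> 'b" where
  "translate a f = (\<lambda>z. f (z + a))"

definition characteristic :: "real \<Rightarrow> (complex \<Rightarrow> 'n::finite cproj) \<Rightarrow> real" where
  "characteristic r f =
     integral {1..r} (\<lambda>t. 1 / t * integral (cball 0 t) (\<lambda>z. (fs_norm f z)\<^sup>2))"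

definition mean_energy :: "(complex \<Rightarrow> 'n::finite cproj) \<Rightarrow> ereal" where
  "mean_energy f = Limsup at_top (\<lambda>r::real. ereal (2 / (pi * r\<^sup>2) * characteristic r f))"

definition positive_part :: "(complex \<Rightarrow> 'n::finite cproj) set \<Rightarrow> (complex \<Rightarrow> 'n cproj) set" where
  "positive_part M = brody_space closure_of {f \<in> M. mean_energy f > 0}"


section \<open>Mean dimension\<close>

text \<open>Finite polyhedra are geometric realizations of finite abstract simplicial complexes; up to
  isomorphism the vertices may be taken to be natural numbers. A point of the realization is given
  by its barycentric coordinates.\<close>

definition finite_abstract_complex :: "nat set set \<Rightarrow> bool" where
  "finite_abstract_complex K \<longleftrightarrow> finite K \<and> (\<forall>s\<in>K. finite s \<and> s \<noteq> {}) \<and>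
     (\<forall>s\<in>K. \<forall>t. t \<subseteq> s \<and> t \<noteq> {} \<longrightarrow> t \<in> K)"

definition has_complex_dim :: "nat set set \<Rightarrow> nat \<Rightarrow> bool" where
  "has_complex_dim K n \<longleftrightarrow> K \<noteq> {} \<and> Max (card ` K) = n + 1"

definition realization :: "nat set set \<Rightarrow> (nat \<Rightarrow> real) topology" where
  "realization K = subtopology (powertop_real UNIV)
     {x. {i. x i \<noteq> 0} \<in> K \<and> (\<forall>i. 0 \<le> x i) \<and> (\<Sum>i | x i \<noteq> 0. x i) = 1}"

definition mdiam :: "('a \<Rightarrow> 'a \<Rightarrow> real) \<Rightarrow> 'a set \<Rightarrow> ereal" where
  "mdiam d A = (SUP x\<in>A. SUP y\<in>A. ereal (d x y))"

definition Widim :: "real \<Rightarrow> 'a set \<Rightarrow> ('a \<Rightarrow> 'a \<Rightarrow> real) \<Rightarrow> ereal" where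
  "Widim \<epsilon> M d = Inf {ereal (real n) | n. \<exists>K g.
     finite_abstract_complex K \<and> has_complex_dim K n \<and>
     continuous_map (Metric_space.mtopology M d) (realization K) g \<and>
     (\<forall>p \<in> topspace (realization K). mdiam d {x \<in> M. g x = p} \<le> ereal \<epsilon>)}"

text \<open>The metric \<open>d\<^sub>\<Omega>\<close> on \<open>M\<close>. Outside \<open>M\<close>, where the supremum may fail to be bounded, it is set
  to 0, since the locale \<^locale>\<open>Metric_space\<close> demands nonnegativity on the whole type.\<close>

definition orbit_metric ::
    "'a set \<Rightarrow> (complex \<Rightarrow> 'a \<Rightarrow> 'a) \<Rightarrow> ('a \<Rightarrow> 'a \<Rightarrow> real) \<Rightarrow> complex set \<Rightarrow> 'a \<Rightarrow> 'a \<Rightarrow> real" where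
  "orbit_metric M act d \<Omega> x y =
     (if x \<in> M \<and> y \<in> M then SUP \<gamma>\<in>\<Omega>. d (act \<gamma> x) (act \<gamma> y) else 0)"

definition Widim_action ::
    "real \<Rightarrow> 'a set \<Rightarrow> ('a \<Rightarrow> 'a \<Rightarrow> real) \<Rightarrow> (complex \<Rightarrow> 'a \<Rightarrow> 'a) \<Rightarrow> ereal" where
  "Widim_action \<epsilon> M d act = lim (\<lambda>n::nat. ereal (1 / (real n)\<^sup>2) *
     Widim \<epsilon> M (orbit_metric M act d {a. Re a \<in> {0..<real n} \<and> Im a \<in> {0..<real n}}))"

definition mean_dim_wrt ::
    "'a set \<Rightarrow> ('a \<Rightarrow> 'a \<Rightarrow> real) \<Rightarrow> (complex \<Rightarrow> 'a \<Rightarrow> 'a) \<Rightarrow> ereal" where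
  "mean_dim_wrt M d act = Lim (at_right 0) (\<lambda>\<epsilon>::real. Widim_action \<epsilon> M d act)"

text \<open>For a compact metrizable space with a continuous action the value is independent of the
  chosen compatible metric. The mean dimension of the empty space is 0 by convention.\<close>

definition mean_dim :: "'a topology \<Rightarrow> (complex \<Rightarrow> 'a \<Rightarrow> 'a) \<Rightarrow> ereal" where
  "mean_dim X act = (if topspace X = {} then 0 else
     mean_dim_wrt (topspace X)
       (SOME d. Metric_space (topspace X) d \<and> Metric_space.mtopology (topspace X) d = X) act)"

end

theory Submission
  imports Defs "HOL-Complex_Analysis.Great_Picard"
begin

text \<open>A curve of mean energy 0 is almost constant on most of the plane. Hence, uniformly over \<open>M\<close>, the
  orbit of a curve spends almost all of its time near the positive part \<open>M\<^sub>+\<close> or near the set of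
  constant curves. The rare exceptional times contribute arbitrarily little to the width per unit
  area, and so do the constant curves, on which the action is trivial. Therefore \<open>M\<close> has no larger
  mean dimension than \<open>M\<^sub>+\<close>.\<close>

text \<open>The obstacle is uniformity: vanishing mean energy of a single curve comes without a
  rate, while the dimension count on a large square must hold for all curves at once. The
  exceptional curves form a closed, hence compact, set \<open>K\<close> off both \<open>M_+\<close>
  and the constants. Compactness bounds the radius at which a point of \<open>K\<close> shows a
  definite amount of energy and the radius at which its average energy is small; both can hold only
  if orbits meet \<open>K\<close> rarely. The constants have to be split off because they have no
  energy to count. The order of limits matters: the tolerance and the tile side \<open>L\<close> fix
  \<open>K\<close> and the price of an exceptional tile; then the number of tiles grows, then the
  frequency of exceptional tiles tends to 0, and only then \<open>L\<close> tends to infinity. Since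
  \<open>mean_dim\<close> picks an arbitrary compatible metric, invariance under change of metric is
  proved first, and the explicit metric \<open>curve_dist\<close> can then be used.\<close>

section \<open>Widths of compact metric spaces\<close>

text \<open>A family of \<open>k\<close> coordinates with at most \<open>m\<close> nonzero ones at each point is a map to the cone over
  an \<open>(m - 1)\<close>-dimensional complex. Working with cones changes Widim by at most 1, which is
  invisible per unit area, and makes products trivial: families are concatenated, and no
  product of complexes has to be triangulated. The bound \<open>N\<close> may depend on the point, so coordinates
  that are rarely active cost little.\<close>

definition separating :: "'a topology \<Rightarrow> ('a \<Rightarrow> 'a \<Rightarrow> bool) \<Rightarrow> ('a \<Rightarrow> nat) \<Rightarrow> bool" where
  "separating T R N \<longleftrightarrow> (\<exists>(k::nat) u. (\<forall>i<k. continuous_map T euclideanreal (u i)) \<and>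
     (\<forall>i<k. \<forall>x\<in>topspace T. 0 \<le> u i x) \<and>
     (\<forall>x\<in>topspace T. card {i. i < k \<and> u i x \<noteq> 0} \<le> N x) \<and>
     (\<forall>x\<in>topspace T. \<forall>y\<in>topspace T. (\<forall>i<k. u i x = u i y) \<longrightarrow> R x y))"

section \<open>Operations on separating families\<close>

lemma separatingI:
  fixes k :: nat
  assumes "\<And>i. i < k \<Longrightarrow> continuous_map T euclideanreal (u i)"
    and "\<And>i x. \<lbrakk>i < k; x \<in> topspace T\<rbrakk> \<Longrightarrow> 0 \<le> u i x"
    and "\<And>x. x \<in> topspace T \<Longrightarrow> card {i. i < k \<and> u i x \<noteq> 0} \<le> N x"
    and "\<And>x y. \<lbrakk>x \<in> topspace T; y \<in> topspace T; \<forall>i<k. u i x = u i y\<rbrakk> \<Longrightarrow> R x y"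
  shows "separating T R N"
  unfolding separating_def by (rule exI[of _ k], rule exI[of _ u]) (use assms in simp)

text \<open>Serves the three constructions that prepend one coordinate at index 0 to a family, a
  cutoff function or the apex of a cone: the price is one more active coordinate.\<close>

lemma card_support_Suc:
  assumes "\<And>i. v (Suc i) \<noteq> (0::real) \<Longrightarrow> i < k \<Longrightarrow> u i \<noteq> (0::real)"
  shows "card {i. i < Suc k \<and> v i \<noteq> 0} \<le> Suc (card {i. i < k \<and> u i \<noteq> 0})"
proof -
  have "{i. i < Suc k \<and> v i \<noteq> 0} \<subseteq> insert 0 (Suc ` {i. i < k \<and> u i \<noteq> 0})"
  proof
    fix i assume "i \<in> {i. i < Suc k \<and> v i \<noteq> 0}"
    then show "i \<in> insert 0 (Suc ` {i. i < k \<and> u i \<noteq> 0})" using assms by (cases i) auto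
  qed
  then have "card {i. i < Suc k \<and> v i \<noteq> 0} \<le> card (insert 0 (Suc ` {i. i < k \<and> u i \<noteq> 0}))"
    by (intro card_mono) auto
  also have "\<dots> = Suc (card {i. i < k \<and> u i \<noteq> 0})"
    by (subst card_insert_disjoint) (auto simp: card_image)
  finally show ?thesis .
qed

lemma separating_mono:
  assumes "separating T R N"
    and "\<And>x y. \<lbrakk>x \<in> topspace T; y \<in> topspace T; R x y\<rbrakk> \<Longrightarrow> R' x y"
    and "\<And>x. x \<in> topspace T \<Longrightarrow> N x \<le> N' x"
  shows "separating T R' N'"
  using assms(1) unfolding separating_def
  by (elim exE conjE) (intro exI conjI; assumption | use assms(2,3) order_trans in blast)

lemma separating_trivial: "separating T (\<lambda>x y. True) (\<lambda>x. 0)"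
  unfolding separating_def by (rule exI[of _ 0]) simp

lemma separating_pullback:
  assumes "continuous_map T T' h" "separating T' R N"
  shows "separating T (\<lambda>x y. R (h x) (h y)) (\<lambda>x. N (h x))"
proof -
  obtain k u where u: "\<forall>i<(k::nat). continuous_map T' euclideanreal (u i)"
     "\<forall>i<k. \<forall>x\<in>topspace T'. 0 \<le> u i x"
     "\<forall>x\<in>topspace T'. card {i. i < k \<and> u i x \<noteq> 0} \<le> N x"
     "\<forall>x\<in>topspace T'. \<forall>y\<in>topspace T'. (\<forall>i<k. u i x = u i y) \<longrightarrow> R x y"
    using assms(2) unfolding separating_def by blast
  have h: "h x \<in> topspace T'" if "x \<in> topspace T" for x
    using assms(1) that continuous_map_image_subset_topspace by blast
  have "\<forall>i<k. continuous_map T euclideanreal (\<lambda>x. u i (h x))"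
    using u(1) continuous_map_compose[OF assms(1)] by (fastforce simp: o_def)
  then show ?thesis
    unfolding separating_def using u(2-) h
    by (intro exI[of _ k] exI[of _ "\<lambda>i x. u i (h x)"]) blast
qed

lemma separating_conj:
  assumes "separating T R N" "separating T R' N'"
  shows "separating T (\<lambda>x y. R x y \<and> R' x y) (\<lambda>x. N x + N' x)"
proof -
  obtain k u where u: "\<forall>i<(k::nat). continuous_map T euclideanreal (u i)"
     "\<forall>i<k. \<forall>x\<in>topspace T. 0 \<le> u i x"
     "\<forall>x\<in>topspace T. card {i. i < k \<and> u i x \<noteq> 0} \<le> N x"
     "\<forall>x\<in>topspace T. \<forall>y\<in>topspace T. (\<forall>i<k. u i x = u i y) \<longrightarrow> R x y"
    using assms(1) unfolding separating_def by blast
  obtain l v where v: "\<forall>i<(l::nat). continuous_map T euclideanreal (v i)"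
     "\<forall>i<l. \<forall>x\<in>topspace T. 0 \<le> v i x"
     "\<forall>x\<in>topspace T. card {i. i < l \<and> v i x \<noteq> 0} \<le> N' x"
     "\<forall>x\<in>topspace T. \<forall>y\<in>topspace T. (\<forall>i<l. v i x = v i y) \<longrightarrow> R' x y"
    using assms(2) unfolding separating_def by blast
  define w where "w i = (if i < k then u i else v (i - k))" for i
  have split: "i < k \<or> (\<exists>j<l. i = k + j)" if "i < k + l" for i
    using that by presburger
  have wk: "w (k + j) = v j" and wu: "i < k \<Longrightarrow> w i = u i" for i j
    by (simp_all add: w_def)
  have all: "(\<forall>i<k+l. P i) \<longleftrightarrow> (\<forall>i<k. P i) \<and> (\<forall>j<l. P (k + j))" for P
    using split by auto
  have card: "card {i. i < k + l \<and> w i x \<noteq> 0} \<le> N x + N' x" if "x \<in> topspace T" for x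
  proof -
    have "{i. i < k + l \<and> w i x \<noteq> 0} \<subseteq>
        {i. i < k \<and> u i x \<noteq> 0} \<union> (+) k ` {j. j < l \<and> v j x \<noteq> 0}"
      using split wk wu by force
    then have "card {i. i < k + l \<and> w i x \<noteq> 0} \<le>
        card ({i. i < k \<and> u i x \<noteq> 0} \<union> (+) k ` {j. j < l \<and> v j x \<noteq> 0})"
      by (intro card_mono) auto
    also have "\<dots> \<le> card {i. i < k \<and> u i x \<noteq> 0} + card ((+) k ` {j. j < l \<and> v j x \<noteq> 0})"
      by (rule card_Un_le)
    also have "\<dots> \<le> N x + N' x"
      using u(3) v(3) that by (intro add_mono) (auto simp: card_image)
    finally show ?thesis .
  qed
  show ?thesis
    unfolding separating_def
  proof (intro exI[of _ "k + l"] exI[of _ w] conjI)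
    show "\<forall>x\<in>topspace T. \<forall>y\<in>topspace T. (\<forall>i<k + l. w i x = w i y) \<longrightarrow> R x y \<and> R' x y"
      unfolding all using u(4) v(4) by (simp add: wk wu)
  qed (use u v card in \<open>simp_all add: all wk wu\<close>)
qed

lemma separating_Ball:
  assumes "finite A" "\<And>a. a \<in> A \<Longrightarrow> separating T (R a) (N a)"
  shows "separating T (\<lambda>x y. \<forall>a\<in>A. R a x y) (\<lambda>x. \<Sum>a\<in>A. N a x)"
  using assms
proof (induction A rule: finite_induct)
  case empty
  show ?case by (rule separating_mono[OF separating_trivial]) auto
next
  case (insert a A)
  then have "separating T (\<lambda>x y. R a x y \<and> (\<forall>a\<in>A. R a x y)) (\<lambda>x. N a x + (\<Sum>a\<in>A. N a x))"
    by (intro separating_conj) auto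
  then show ?case
    by (rule separating_mono) (use insert in auto)
qed

text \<open>The coordinates are distance bumps over a finite net of mesh \<epsilon>/2. A bump that
  is positive at \<open>x\<close> has the same positive value at \<open>y\<close>, so both points
  lie in one ball of the net.\<close>

lemma separating_compact_metric:
  assumes "Metric_space M d" "compact_space (Metric_space.mtopology M d)" "\<epsilon> > 0"
  shows "\<exists>n. separating (Metric_space.mtopology M d) (\<lambda>x y. d x y \<le> \<epsilon>) (\<lambda>x. n)"
proof -
  interpret Metric_space M d by fact
  have "mtotally_bounded M"
    using assms(2) compactin_imp_mtotally_bounded unfolding compact_space_def by simp
  then obtain F where F: "finite F" "F \<subseteq> M" "M \<subseteq> (\<Union>x\<in>F. mball x (\<epsilon>/2))"
    unfolding mtotally_bounded_def using assms(3) by (meson half_gt_zero)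
  obtain p where p: "bij_betw p {..<card F} F"
    using F(1) ex_bij_betw_nat_finite by (metis atLeast0LessThan)
  define u where "u i x = max 0 (\<epsilon>/2 - d (p i) x)" for i x
  have pM: "p i \<in> M" if "i < card F" for i
    using p F(2) that by (metis bij_betwE lessThan_iff subsetD)
  have "continuous_map mtopology euclideanreal (u i)" if "i < card F" for i
    unfolding u_def using pM[OF that] continuous_map_mdist[of mtopology Self "\<lambda>_. p i" "\<lambda>x. x"]
    by (intro continuous_map_real_max continuous_map_diff continuous_map_const[THEN iffD2])
      (simp_all add: mtopology_of_def)
  moreover have "d x y \<le> \<epsilon>" if "x \<in> M" "y \<in> M" "\<forall>i<card F. u i x = u i y" for x y
  proof -
    obtain z where "z \<in> F" "x \<in> mball z (\<epsilon>/2)" using F(3) \<open>x \<in> M\<close> by blast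
    then obtain i where i: "i < card F" "d (p i) x < \<epsilon>/2"
      using p by (metis bij_betw_iff_bijections in_mball lessThan_iff)
    then have "u i x > 0" by (simp add: u_def)
    then have "d (p i) y < \<epsilon>/2" using that i by (force simp: u_def)
    then show ?thesis
      using triangle''[OF \<open>x \<in> M\<close> pM[OF i(1)] \<open>y \<in> M\<close>] i commute[of x "p i"] by linarith
  qed
  moreover have "card {i. i < card F \<and> u i x \<noteq> 0} \<le> card F" for x
    by (rule order_trans[OF card_mono[of "{..<card F}"]]) auto
  ultimately show ?thesis
    unfolding separating_def
    by (intro exI[of _ "card F"] exI[of _ u]) (auto simp: u_def)
qed

text \<open>The coordinates are extended by Tietze's theorem and lowered by a small \<open>\<eta>\<close>, so that near \<open>Z\<close> no new
  coordinate becomes nonzero. Multiplying by a cutoff \<open>\<rho>\<close> kills them away from \<open>Z\<close>; \<open>\<rho>\<close> itself is kept as an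
  additional coordinate, so that points of \<open>V\<close> are recognised by \<open>\<rho> \<noteq> 0\<close>.\<close>

lemma separating_extend:
  assumes "Metric_space M d" "compact_space (Metric_space.mtopology M d)"
    and Z: "closedin (Metric_space.mtopology M d) Z"
    and sep: "separating (subtopology (Metric_space.mtopology M d) Z) (\<lambda>x y. d x y \<le> \<epsilon>) (\<lambda>x. n)"
    and less: "\<epsilon> < \<epsilon>'"
  obtains V where "openin (Metric_space.mtopology M d) V" "Z \<subseteq> V"
    "separating (Metric_space.mtopology M d) (\<lambda>x y. x \<in> V \<longrightarrow> d x y \<le> \<epsilon>') (\<lambda>x. n + 1)"
proof -
  interpret Metric_space M d by fact
  have normal: "normal_space mtopology"
    by (simp add: metrizable_imp_normal_space metrizable_space_mtopology)
  have ZM: "Z \<subseteq> M" using closedin_subset[OF Z] by simp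
  have top: "topspace (subtopology mtopology Z) = Z" using ZM by auto
  obtain k u where u: "\<forall>i<(k::nat). continuous_map (subtopology mtopology Z) euclideanreal (u i)"
     "\<forall>i<k. \<forall>x\<in>Z. 0 \<le> u i x" "\<forall>x\<in>Z. card {i. i < k \<and> u i x \<noteq> 0} \<le> n"
     "\<forall>x\<in>Z. \<forall>y\<in>Z. (\<forall>i<k. u i x = u i y) \<longrightarrow> d x y \<le> \<epsilon>"
    using sep unfolding separating_def top by blast
  have "\<exists>g. continuous_map mtopology euclideanreal g \<and> g ` M \<subseteq> {0..} \<and> (\<forall>x\<in>Z. g x = u i x)"
    if "i < k" for i
  proof -
    have "u i ` Z \<subseteq> {0..}" using u(2) that by auto
    with Tietze_extension_realinterval[OF normal Z, of "{0..}" "u i"] u(1) that show ?thesis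
      by (simp add: is_interval_ci) metis
  qed
  then obtain G where G: "\<And>i. i < k \<Longrightarrow> continuous_map mtopology euclideanreal (G i)"
     "\<And>i x. i < k \<Longrightarrow> x \<in> M \<Longrightarrow> 0 \<le> G i x" "\<And>i x. i < k \<Longrightarrow> x \<in> Z \<Longrightarrow> G i x = u i x"
    by (metis image_subset_iff atLeast_iff)
  have Gseq: "(\<lambda>m. G i (x m)) \<longlonglongrightarrow> G i l" if "i < k" "limitin mtopology x l sequentially" for i x l
    using continuous_map_limit[OF G(1)[OF that(1)] that(2)] by (simp add: o_def)
  have Zseq: "\<exists>l r. l \<in> Z \<and> strict_mono (r::nat\<Rightarrow>nat) \<and> limitin mtopology (z \<circ> r) l sequentially"
    if "\<And>m. z m \<in> Z" for z
    using closedin_compact_space[OF assms(2) Z] that unfolding compactin_sequentially by blast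
  \<comment> \<open>Three shares of the slack: moving \<open>x\<close> to \<open>Z\<close>, moving
    \<open>y\<close> to \<open>Z\<close>, and the error of comparing coordinates on \<open>Z\<close>
    only approximately.\<close>
  define s where "s = (\<epsilon>' - \<epsilon>) / 3"
  have s: "s > 0" "\<epsilon> + 3 * s = \<epsilon>'" using less by (auto simp: s_def field_simps)
  \<comment> \<open>On the compact set \<open>Z\<close>, separation by equal coordinates persists
    for nearly equal ones; otherwise limits of a sequence of bad pairs would have equal coordinates
    and distance above \<epsilon>. The factor 3 pays for the steps from \<open>z\<close> to
    \<open>x\<close>, \<open>x\<close> to \<open>y\<close> and \<open>y\<close> to
    \<open>z'\<close>.\<close>
  have "\<exists>\<eta>>0. \<forall>z\<in>Z. \<forall>z'\<in>Z. (\<forall>i<k. \<bar>G i z - G i z'\<bar> \<le> 3 * \<eta>) \<longrightarrow> d z z' < \<epsilon> + s"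
  proof (rule ccontr)
    assume "\<not> ?thesis"
    then have "\<exists>z\<in>Z. \<exists>z'\<in>Z. (\<forall>i<k. \<bar>G i z - G i z'\<bar> \<le> 3 * inverse (Suc m)) \<and> \<epsilon> + s \<le> d z z'" for m
      by (metis inverse_Suc not_le)
    then obtain z z' where c: "\<And>m. z m \<in> Z" "\<And>m. z' m \<in> Z"
        "\<And>m i. i < k \<Longrightarrow> \<bar>G i (z m) - G i (z' m)\<bar> \<le> 3 * inverse (Suc m)" "\<And>m. \<epsilon> + s \<le> d (z m) (z' m)"
      by metis
    obtain l r where l: "l \<in> Z" "strict_mono r" "limitin mtopology (z \<circ> r) l sequentially"
      using Zseq c(1) by metis
    obtain l' r' where l': "l' \<in> Z" "strict_mono r'"
        "limitin mtopology (\<lambda>m. z' (r (r' m))) l' sequentially"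
      using Zseq[of "z' \<circ> r"] c(2) unfolding o_def by metis
    define t where "t m = r (r' m)" for m
    have t: "strict_mono t" using l(2) l'(2) unfolding t_def strict_mono_def by blast
    have inv: "(\<lambda>m. 3 * inverse (real (Suc (t m)))) \<longlonglongrightarrow> 0"
      using tendsto_mult_right_zero[OF LIMSEQ_subseq_LIMSEQ[OF LIMSEQ_inverse_real_of_nat t]] by (simp add: o_def)
    have zl: "limitin mtopology (\<lambda>m. z (t m)) l sequentially"
      using limitin_subsequence[OF l'(2) l(3)] by (simp add: o_def t_def)
    have z'l: "limitin mtopology (\<lambda>m. z' (t m)) l' sequentially"
      using l'(3) by (simp add: t_def)
    have "G i l = G i l'" if "i < k" for i
    proof -
      have "(\<lambda>m. G i (z (t m)) - G i (z' (t m))) \<longlonglongrightarrow> G i l - G i l'"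
        by (intro tendsto_diff Gseq that zl z'l)
      moreover have "(\<lambda>m. G i (z (t m)) - G i (z' (t m))) \<longlonglongrightarrow> 0"
        by (rule tendsto_rabs_zero_cancel, rule tendsto_sandwich[OF _ _ tendsto_const inv])
          (use c(3)[OF that] in auto)
      ultimately show ?thesis using LIMSEQ_unique by fastforce
    qed
    then have "d l l' \<le> \<epsilon>" using u(4) l(1) l'(1) G(3) by metis
    moreover have "\<epsilon> + s \<le> d l l'"
    proof -
      have dl: "(\<lambda>m. d (z (t m)) l) \<longlonglongrightarrow> 0" "(\<lambda>m. d (z' (t m)) l') \<longlonglongrightarrow> 0"
        using zl z'l by (auto simp: limitin_metric_dist_null)
      have "\<epsilon> + s \<le> d (z (t m)) l + d l l' + d (z' (t m)) l'" for m
        using triangle[of "z (t m)" l "z' (t m)"] triangle[of l l' "z' (t m)"] c(1,2,4)[of "t m"] l(1) l'(1) ZM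
          commute[of l' "z' (t m)"]
        by (smt (verit) subsetD)
      then have "\<epsilon> + s \<le> 0 + d l l' + 0"
        by (intro tendsto_lowerbound[OF tendsto_add[OF tendsto_add[OF dl(1) tendsto_const] dl(2)]]) auto
      then show ?thesis by simp
    qed
    ultimately show False using s(1) by linarith
  qed
  then obtain \<eta> where \<eta>: "\<eta> > 0" and close: "\<And>z z'. \<lbrakk>z \<in> Z; z' \<in> Z;
      \<And>i. i < k \<Longrightarrow> \<bar>G i z - G i z'\<bar> \<le> 3 * \<eta>\<rbrakk> \<Longrightarrow> d z z' < \<epsilon> + s"
    by blast
  \<comment> \<open>A point of \<open>W\<close> shares one witness \<open>z\<close> for its position
    and for all its coordinates, so each coordinate that exceeds \<eta> at the point is nonzero at
    \<open>z\<close>.\<close>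
  define W where "W = (\<Union>z\<in>Z. mball z s \<inter> (\<Inter>i\<in>{..<k}. {x \<in> topspace mtopology. G i x \<in> {G i z - \<eta><..<G i z + \<eta>}}) \<inter> M)"
  have "openin mtopology W"
    unfolding W_def
  proof (intro openin_Union ballI, elim imageE, hypsubst)
    fix z assume "z \<in> Z"
    have "openin mtopology {x \<in> topspace mtopology. G i x \<in> {G i z - \<eta><..<G i z + \<eta>}}" if "i < k" for i
      using openin_continuous_map_preimage[OF G(1)[OF that], of "{G i z - \<eta><..<G i z + \<eta>}"] by simp
    then show "openin mtopology (mball z s \<inter> (\<Inter>i\<in>{..<k}. {x \<in> topspace mtopology. G i x \<in> {G i z - \<eta><..<G i z + \<eta>}}) \<inter> M)"
      by (cases "k = 0") (auto intro!: openin_Int openin_INT simp del: topspace_mtopology)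
  qed
  moreover have "Z \<subseteq> W" using ZM \<eta> s(1) by (auto simp: W_def)
  ultimately have "\<exists>\<rho>. continuous_map mtopology (top_of_set {0..1::real}) \<rho> \<and> \<rho> ` Z \<subseteq> {1} \<and> \<rho> ` (M - W) \<subseteq> {0}"
    using Urysohn_lemma[OF normal _ Z, of "M - W" 0 1]
    by (metis Diff_disjoint closedin_topspace disjnt_def disjnt_subset2 closedin_diff inf_commute topspace_mtopology zero_le_one)
  then obtain \<rho> where \<rho>: "continuous_map mtopology euclideanreal \<rho>" "\<And>x. x \<in> M \<Longrightarrow> 0 \<le> \<rho> x"
      "\<And>x. x \<in> Z \<Longrightarrow> \<rho> x = 1" "\<And>x. x \<in> M - W \<Longrightarrow> \<rho> x = 0"
    by (force simp: continuous_map_in_subtopology Pi_iff image_subset_iff)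
  define V where "V = {x \<in> topspace mtopology. \<rho> x \<in> {0<..}}"
  define v where "v i x = (if i = 0 then \<rho> x else \<rho> x * max 0 (G (i-1) x - \<eta>))" for i x
  show ?thesis
  proof
    show "openin mtopology V"
      unfolding V_def by (rule openin_continuous_map_preimage[OF \<rho>(1)]) simp
    show "Z \<subseteq> V" using \<rho>(3) ZM by (auto simp: V_def)
    have cont: "continuous_map mtopology euclideanreal (v i)" if "i < Suc k" for i
      unfolding v_def using that G(1)[of "i-1"] \<rho>(1)
      by (cases "i = 0") (auto intro!: continuous_map_real_mult continuous_map_real_max continuous_map_diff)
    have card: "card {i. i < Suc k \<and> v i x \<noteq> 0} \<le> n + 1" if "x \<in> M" for x
    proof (cases "x \<in> W")
      case True
      then obtain z where z: "z \<in> Z" "\<And>i. i < k \<Longrightarrow> G i x < G i z + \<eta>"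
        by (auto simp: W_def)
      have "card {i. i < Suc k \<and> v i x \<noteq> 0} \<le> Suc (card {i. i < k \<and> u i z \<noteq> 0})"
      proof (rule card_support_Suc)
        fix i assume "v (Suc i) x \<noteq> 0" "i < k"
        then have "G i x > \<eta>" by (auto simp: v_def max_def split: if_splits)
        then show "u i z \<noteq> 0" using z G(3)[of i z] \<open>i < k\<close> by force
      qed
      also have "\<dots> \<le> n + 1" using u(3) z(1) by simp
      finally show ?thesis .
    next
      case False
      then have "\<rho> x = 0" using \<rho>(4) that by blast
      then have "{i. i < Suc k \<and> v i x \<noteq> 0} = {}" by (auto simp: v_def)
      then show ?thesis by (simp only: card.empty le0)
    qed
    have sep: "d x y \<le> \<epsilon>'" if "x \<in> M" "y \<in> M" "x \<in> V" and eq: "\<forall>i<Suc k. v i x = v i y" for x y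
    proof -
      have \<rho>eq: "\<rho> x = \<rho> y" "\<rho> x > 0" using eq \<open>x \<in> V\<close> by (auto simp: v_def V_def)
      then have "x \<in> W" "y \<in> W" using \<rho>(4) that by force+
      then obtain z z' where z: "z \<in> Z" "z' \<in> Z" "d x z < s" "d z' y < s"
          "\<And>i. i < k \<Longrightarrow> \<bar>G i x - G i z\<bar> < \<eta>" "\<And>i. i < k \<Longrightarrow> \<bar>G i y - G i z'\<bar> < \<eta>"
        unfolding W_def by (force simp: commute abs_less_iff)
      have "d z z' < \<epsilon> + s"
      proof (rule close[OF z(1,2)])
        fix i assume i: "i < k"
        have "max 0 (G i x - \<eta>) = max 0 (G i y - \<eta>)"
          using eq[rule_format, of "Suc i"] i \<rho>eq by (simp add: v_def)
        \<comment> \<open>Lowering by \<eta> merges all values in [0, \<eta>], so equality of the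
          new coordinates gives the old ones only up to \<eta>.\<close>
        then have "\<bar>G i x - G i y\<bar> \<le> \<eta>" using G(2)[OF i] \<open>x \<in> M\<close> \<open>y \<in> M\<close> \<eta>
          by (smt (verit, best))
        then show "\<bar>G i z - G i z'\<bar> \<le> 3 * \<eta>" using z(5,6)[OF i] by linarith
      qed
      then show ?thesis
        using triangle[of x z y] triangle[of z z' y] z(1-4) ZM that(1,2) s(2) by (smt (verit) subsetD)
    qed
    show "separating mtopology (\<lambda>x y. x \<in> V \<longrightarrow> d x y \<le> \<epsilon>') (\<lambda>x. n + 1)"
      unfolding separating_def
      by (intro exI[of _ "Suc k"] exI[of _ v])
        (use cont card sep G(2) \<rho>(2) in \<open>auto simp: v_def\<close>)
  qed
qed

text \<open>Vertex 0 of the complex is the apex of the cone: its barycentric coordinate \<open>1 / (1 + S)\<close> is never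
  zero and recovers the sum \<open>S\<close> of the unnormalised coordinates.\<close>

lemma Widim_witness:
  assumes "Metric_space M d"
    and sep: "separating (Metric_space.mtopology M d) (\<lambda>x y. d x y \<le> \<epsilon>) (\<lambda>x. n)"
  shows "\<exists>m\<le>n. \<exists>K g. finite_abstract_complex K \<and> has_complex_dim K m \<and>
     continuous_map (Metric_space.mtopology M d) (realization K) g \<and>
     (\<forall>p \<in> topspace (realization K). mdiam d {x \<in> M. g x = p} \<le> ereal \<epsilon>)"
proof -
  interpret Metric_space M d by fact
  obtain k u where u: "\<forall>i<(k::nat). continuous_map mtopology euclideanreal (u i)"
     "\<forall>i<k. \<forall>x\<in>M. 0 \<le> u i x" "\<forall>x\<in>M. card {i. i < k \<and> u i x \<noteq> 0} \<le> n"
     "\<forall>x\<in>M. \<forall>y\<in>M. (\<forall>i<k. u i x = u i y) \<longrightarrow> d x y \<le> \<epsilon>"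
    using sep unfolding separating_def topspace_mtopology by blast
  define S where "S x = (\<Sum>i<k. u i x)" for x
  \<comment> \<open>The \<open>n\<close>-skeleton of the simplex on \<open>k + 1\<close> vertices.
    Its dimension is \<open>min n k\<close>, hence the existential bound \<open>m \<le> n\<close> in
    the conclusion.\<close>
  define K where "K = {s. s \<subseteq> {..k} \<and> s \<noteq> {} \<and> card s \<le> n + 1}"
  define g where "g x i = (if i = 0 then 1 / (1 + S x) else if i \<le> k then u (i - 1) x / (1 + S x) else 0)"
    for x i
  have S: "0 \<le> S x" if "x \<in> M" for x
    unfolding S_def using u(2) that by (intro sum_nonneg) auto
  have contS: "continuous_map mtopology euclideanreal S"
    unfolding S_def using u(1) by (intro continuous_map_sum) auto
  have cont: "continuous_map mtopology euclideanreal (\<lambda>x. g x i)" for i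
  proof -
    have "1 + S x \<noteq> 0" if "x \<in> M" for x using S[OF that] by linarith
    moreover have "i \<noteq> 0 \<Longrightarrow> i \<le> k \<Longrightarrow> continuous_map mtopology euclideanreal (u (i - 1))"
      using u(1) by simp
    ultimately show ?thesis
      unfolding g_def using contS
      by (cases "i = 0"; cases "i \<le> k")
        (auto intro!: continuous_map_real_divide continuous_map_add)
  qed
  have supp: "{i. g x i \<noteq> 0} \<subseteq> {..k}" for x
    by (auto simp: g_def)
  have "finite_abstract_complex K"
    unfolding finite_abstract_complex_def K_def
  proof (intro conjI ballI allI impI)
    show "finite {s. s \<subseteq> {..k} \<and> s \<noteq> {} \<and> card s \<le> n + 1}"
      by (rule finite_subset[of _ "Pow {..k}"]) auto
  next
    fix s t assume "s \<in> {s. s \<subseteq> {..k} \<and> s \<noteq> {} \<and> card s \<le> n + 1}" "t \<subseteq> s \<and> t \<noteq> {}"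
    then show "t \<in> {s. s \<subseteq> {..k} \<and> s \<noteq> {} \<and> card s \<le> n + 1}"
      using card_mono[of s t] finite_subset[of s "{..k}"] by auto
  qed (auto intro: finite_subset)
  moreover have "has_complex_dim K (min n k)"
    unfolding has_complex_dim_def
  proof
    have wit: "{..min n k} \<in> K" by (auto simp: K_def)
    then show "K \<noteq> {}" by blast
    have "finite K" unfolding K_def by (rule finite_subset[of _ "Pow {..k}"]) auto
    then show "Max (card ` K) = min n k + 1"
    proof (intro Max_eqI)
      fix c assume "c \<in> card ` K"
      then obtain s where "s \<in> K" "c = card s" by blast
      moreover from \<open>s \<in> K\<close> have "card s \<le> card {..k}" by (intro card_mono) (auto simp: K_def)
      ultimately show "c \<le> min n k + 1" by (auto simp: K_def)
    next
      show "min n k + 1 \<in> card ` K" using imageI[OF wit, of card] by simp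
    qed simp
  qed
  moreover have "continuous_map mtopology (realization K) g"
    unfolding realization_def continuous_map_in_subtopology
  proof
    show "continuous_map mtopology (powertop_real UNIV) g"
      using cont by (simp add: continuous_map_componentwise_UNIV)
    have "{i. g x i \<noteq> 0} \<in> K \<and> (\<forall>i. 0 \<le> g x i) \<and> (\<Sum>i | g x i \<noteq> 0. g x i) = 1" if x: "x \<in> M" for x
    proof (intro conjI allI)
      have pos: "1 + S x > 0" using S[OF x] by linarith
      have "{i. g x i \<noteq> 0} = {i. i < Suc k \<and> g x i \<noteq> 0}" using supp[of x] by auto
      then have "card {i. g x i \<noteq> 0} = card {i. i < Suc k \<and> g x i \<noteq> 0}" by (rule arg_cong)
      also have "\<dots> \<le> Suc (card {i. i < k \<and> u i x \<noteq> 0})"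
        by (rule card_support_Suc) (auto simp: g_def split: if_splits)
      also have "\<dots> \<le> n + 1" using u(3) x by simp
      finally show "{i. g x i \<noteq> 0} \<in> K"
        using supp[of x] pos by (auto simp: K_def g_def)
      show "0 \<le> g x i" for i using pos u(2) x by (auto simp: g_def)
      have "(\<Sum>i | g x i \<noteq> 0. g x i) = (\<Sum>i\<le>k. g x i)"
        by (rule sum.mono_neutral_left) (use supp in auto)
      also have "\<dots> = 1 / (1 + S x) + (\<Sum>i<k. u i x / (1 + S x))"
        unfolding sum.atMost_shift by (simp add: g_def)
      also have "\<dots> = (1 + S x) / (1 + S x)"
        by (simp only: S_def add_divide_distrib sum_divide_distrib)
      finally show "(\<Sum>i | g x i \<noteq> 0. g x i) = 1" using pos by simp
    qed
    then show "g \<in> topspace mtopology \<rightarrow> {x. {i. x i \<noteq> 0} \<in> K \<and> (\<forall>i. 0 \<le> x i) \<and> (\<Sum>i | x i \<noteq> 0. x i) = 1}"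
      by auto
  qed
  moreover have "mdiam d {x \<in> M. g x = p} \<le> ereal \<epsilon>" for p
    unfolding mdiam_def
  proof (intro SUP_least, elim CollectE conjE)
    fix x y assume xy: "x \<in> M" "g x = p" "y \<in> M" "g y = p"
    have "S x = S y"
      using fun_cong[OF trans[OF xy(2) xy(4)[symmetric]], of 0] S[OF xy(1)] S[OF xy(3)]
      by (simp add: g_def field_simps)
    moreover have "g x (Suc i) = g y (Suc i)" for i using xy by simp
    ultimately have "u i x / (1 + S y) = u i y / (1 + S y)" if "i < k" for i
      using that unfolding g_def by (metis Suc_leI diff_Suc_1 nat.distinct(1))
    then have "\<forall>i<k. u i x = u i y"
      using S[OF xy(3)] by auto
    then show "ereal (d x y) \<le> ereal \<epsilon>" using u(4) xy by simp
  qed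
  ultimately show ?thesis by (intro exI[of _ "min n k"] conjI exI[of _ K] exI[of _ g]) auto
qed

text \<open>Barycentric coordinates form a separating family, and a simplex of dimension
  \<open>m\<close> has \<open>m + 1\<close> vertices. Together with the cone construction in the
  other direction this leaves a gap of 1 between the two notions.\<close>

lemma separating_of_complex:
  assumes "Metric_space M d" and K: "finite_abstract_complex K" "has_complex_dim K m"
    and g: "continuous_map (Metric_space.mtopology M d) (realization K) g"
    and diam: "\<forall>p \<in> topspace (realization K). mdiam d {x \<in> M. g x = p} \<le> ereal \<epsilon>"
  shows "separating (Metric_space.mtopology M d) (\<lambda>x y. d x y \<le> \<epsilon>) (\<lambda>x. m + 1)"
proof -
  interpret Metric_space M d by fact
  have fin: "finite (\<Union>K)" and finK: "finite K" using K(1) by (auto simp: finite_abstract_complex_def)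
  then obtain k where k: "\<Union>K \<subseteq> {..<k}" using finite_nat_iff_bounded by blast
  have g': "continuous_map mtopology (powertop_real UNIV) g"
    and gK: "\<And>x. x \<in> M \<Longrightarrow> {i. g x i \<noteq> 0} \<in> K \<and> (\<forall>i. 0 \<le> g x i)"
    using g by (auto simp: realization_def continuous_map_in_subtopology Pi_iff)
  show ?thesis
  proof (rule separatingI[where k = k and u = "\<lambda>i x. g x i"])
    fix i assume "i < k"
    show "continuous_map mtopology euclideanreal (\<lambda>x. g x i)"
      using g' by (simp add: continuous_map_componentwise_UNIV)
  next
    fix i x assume "x \<in> topspace mtopology"
    then show "0 \<le> g x i" using gK by simp
  next
    fix x assume "x \<in> topspace mtopology"
    then have x: "{i. g x i \<noteq> 0} \<in> K" using gK by simp
    then have "{i. i < k \<and> g x i \<noteq> 0} = {i. g x i \<noteq> 0}" using k by auto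
    moreover have "card {i. g x i \<noteq> 0} \<le> Max (card ` K)"
      using x finK by (intro Max_ge) auto
    ultimately show "card {i. i < k \<and> g x i \<noteq> 0} \<le> m + 1"
      using K(2) by (simp add: has_complex_dim_def)
  next
    fix x y assume xy: "x \<in> topspace mtopology" "y \<in> topspace mtopology" "\<forall>i<k. g x i = g y i"
    have "g x i = g y i" for i
    proof (cases "i < k")
      case False
      have "{i. g x i \<noteq> 0} \<in> K" "{i. g y i \<noteq> 0} \<in> K" using gK xy by auto
      then have "g x i = 0 \<and> g y i = 0" using k False by blast
      then show ?thesis by simp
    qed (use xy in auto)
    then have eq: "g x = g y" by blast
    have "g y \<in> topspace (realization K)"
      using g xy(2) continuous_map_image_subset_topspace by blast
    then have "mdiam d {z \<in> M. g z = g y} \<le> ereal \<epsilon>" using diam by blast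
    moreover have "ereal (d x y) \<le> mdiam d {z \<in> M. g z = g y}"
      unfolding mdiam_def using xy eq by (intro SUP_upper2[of x] SUP_upper2[of y]) auto
    ultimately have "ereal (d x y) \<le> ereal \<epsilon>" by (rule order_trans[rotated])
    then show "d x y \<le> \<epsilon>" by simp
  qed
qed

text \<open>An infimum of natural numbers is attained once some complex exists. For the least
  possible \<open>n\<close> the result pins down \<open>m \<le> n \<le> m + 1\<close>.\<close>

lemma Widim_separating:
  assumes "Metric_space M d"
    and "separating (Metric_space.mtopology M d) (\<lambda>x y. d x y \<le> \<epsilon>) (\<lambda>x. n)"
  obtains m where "m \<le> n" "Widim \<epsilon> M d = ereal (real m)"
    "separating (Metric_space.mtopology M d) (\<lambda>x y. d x y \<le> \<epsilon>) (\<lambda>x. m + 1)"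
proof -
  define P where "P m \<longleftrightarrow> (\<exists>K g. finite_abstract_complex K \<and> has_complex_dim K m \<and>
     continuous_map (Metric_space.mtopology M d) (realization K) g \<and>
     (\<forall>p \<in> topspace (realization K). mdiam d {x \<in> M. g x = p} \<le> ereal \<epsilon>))" for m
  obtain m' where m': "m' \<le> n" "P m'" using Widim_witness[OF assms] unfolding P_def by blast
  define m where "m = (LEAST m. P m)"
  have m: "P m" "m \<le> m'" unfolding m_def using m'(2) by (auto intro: LeastI Least_le)
  have "Widim \<epsilon> M d = Inf {ereal (real m) |m. P m}" by (simp add: Widim_def P_def)
  also have "\<dots> = ereal (real m)"
    by (rule cInf_eq_minimum) (use m(1) Least_le[of P] in \<open>auto simp: m_def\<close>)
  finally show ?thesis
    using that[of m] m m'(1) separating_of_complex[OF assms(1)] unfolding P_def by fastforce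
qed

section \<open>Mean dimension as a limit of widths\<close>

definition square :: "nat \<Rightarrow> complex set" where
  "square n = {a. Re a \<in> {0..<real n} \<and> Im a \<in> {0..<real n}}"

lemma norm_square_le: "\<gamma> \<in> square n \<Longrightarrow> cmod \<gamma> \<le> 2 * real n"
  using cmod_le[of \<gamma>] by (auto simp: square_def)

lemma zero_in_square: "n \<ge> 1 \<Longrightarrow> 0 \<in> square n"
  by (simp add: square_def)

text \<open>The corners of the tiles are kept inside the square of side \<open>n\<close>, so that
  tiles whose corner lies in a set \<open>K\<close> are counted by the lattice times in
  \<open>visits n\<close>.\<close>

lemma square_tiling:
  assumes "\<gamma> \<in> square n" "L \<ge> 1"
  obtains i j \<gamma>' where "i < n div L + 1" "j < n div L + 1" "\<gamma>' \<in> square L"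
    "\<gamma> = \<gamma>' + Complex (real (i * L)) (real (j * L))" "i * L < n" "j * L < n"
proof -
  have *: "\<exists>i r. i < n div L + 1 \<and> i * L < n \<and> r \<in> {0..<real L} \<and> t = r + real (i * L)"
    if "t \<in> {0..<real n}" for t
  proof (intro exI conjI)
    define i where "i = nat \<lfloor>t / L\<rfloor>"
    have t: "0 \<le> t" "t < n" and L: "real L > 0" using that assms(2) by auto
    have i: "real i \<le> t / L" "t / L < real i + 1"
      using t L by (auto simp: i_def of_nat_nat)
    then have i': "real i * L \<le> t" "t < (real i + 1) * L"
      using L by (auto simp: field_simps)
    then have "real (i * L) < real n" using t by simp
    then show "i * L < n" by linarith
    then have "i \<le> n div L" using assms(2) by (simp add: less_eq_div_iff_mult_less_eq)
    then show "i < n div L + 1" by simp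
    show "t - real (i * L) \<in> {0..<real L}" using i' by (simp add: algebra_simps)
    show "t = t - real (i * L) + real (i * L)" by simp
  qed
  have "Re \<gamma> \<in> {0..<real n}" "Im \<gamma> \<in> {0..<real n}" using assms(1) by (auto simp: square_def)
  note * = *[OF this(1)] *[OF this(2)]
  obtain i r where ir: "i < n div L + 1" "i * L < n" "r \<in> {0..<real L}" "Re \<gamma> = r + real (i * L)"
    using *(1) by blast
  obtain j s where js: "j < n div L + 1" "j * L < n" "s \<in> {0..<real L}" "Im \<gamma> = s + real (j * L)"
    using *(2) by blast
  show ?thesis
    by (rule that[of i j "Complex r s"]) (use ir js in \<open>auto simp: square_def complex_eq_iff\<close>)
qed

text \<open>Equicontinuity over bounded sets of times is the form in which continuity of the action
  is used: it makes the metrics over squares compatible with the topology. For translations of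
  curves it comes from an explicit Lipschitz bound.\<close>

locale compact_action = Metric_space M d for M d +
  fixes act :: "complex \<Rightarrow> 'a \<Rightarrow> 'a"
  assumes compact: "compact_space mtopology"
    and act_closed: "x \<in> M \<Longrightarrow> act a x \<in> M"
    and act_zero: "x \<in> M \<Longrightarrow> act 0 x = x"
    and act_add: "x \<in> M \<Longrightarrow> act a (act b x) = act (a + b) x"
    and act_equicontinuous: "e > 0 \<Longrightarrow> \<exists>\<delta>>0. \<forall>x\<in>M. \<forall>y\<in>M. \<forall>a. cmod a \<le> R \<and> d x y < \<delta> \<longrightarrow>
      d (act a x) (act a y) < e"
begin

abbreviation visits :: "nat \<Rightarrow> 'a \<Rightarrow> 'a set \<Rightarrow> nat" where
  "visits n x K \<equiv> card {(i, j). i < n \<and> j < n \<and> act (Complex (real i) (real j)) x \<in> K}"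

abbreviation orbit_dist :: "nat \<Rightarrow> 'a \<Rightarrow> 'a \<Rightarrow> real" where
  "orbit_dist n \<equiv> orbit_metric M act d (square n)"

section \<open>Orbit metrics and widths over squares\<close>

lemma continuous_act: "continuous_map mtopology mtopology (act a)"
  unfolding metric_continuous_map[OF Metric_space_axioms]
proof (intro conjI ballI allI impI)
  show "act a ` M \<subseteq> M" using act_closed by blast
  fix x and e :: real assume "x \<in> M" "0 < e"
  then show "\<exists>\<delta>>0. \<forall>y. y \<in> M \<and> d x y < \<delta> \<longrightarrow> d (act a x) (act a y) < e"
    using act_equicontinuous[of e "cmod a"] by blast
qed

lemma bounded_dist: "\<exists>B. \<forall>x\<in>M. \<forall>y\<in>M. d x y \<le> B"
proof -
  have "mbounded M" using compact compactin_imp_mbounded unfolding compact_space_def by simp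
  then show ?thesis by (auto simp: mbounded_alt)
qed

lemma orbit_dist_le_iff:
  assumes "n \<ge> 1" "x \<in> M" "y \<in> M"
  shows "orbit_dist n x y \<le> e \<longleftrightarrow> (\<forall>\<gamma>\<in>square n. d (act \<gamma> x) (act \<gamma> y) \<le> e)"
proof -
  obtain B where "\<forall>x\<in>M. \<forall>y\<in>M. d x y \<le> B" using bounded_dist by blast
  then have "bdd_above ((\<lambda>\<gamma>. d (act \<gamma> x) (act \<gamma> y)) ` square n)"
    using assms act_closed by (intro bdd_aboveI2[of _ _ B]) blast
  then show ?thesis
    using assms zero_in_square[OF assms(1)] unfolding orbit_metric_def
    by (simp, subst cSUP_le_iff) auto
qed

lemma dist_le_orbit_dist: "\<lbrakk>n \<ge> 1; x \<in> M; y \<in> M; \<gamma> \<in> square n\<rbrakk> \<Longrightarrow> d (act \<gamma> x) (act \<gamma> y) \<le> orbit_dist n x y"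
  using orbit_dist_le_iff[of n x y "orbit_dist n x y"] by blast

lemma dist_le_orbit_dist_0: "\<lbrakk>n \<ge> 1; x \<in> M; y \<in> M\<rbrakk> \<Longrightarrow> d x y \<le> orbit_dist n x y"
  using dist_le_orbit_dist[of n x y 0] zero_in_square act_zero by simp

lemma Metric_space_orbit:
  assumes n: "n \<ge> 1"
  shows "Metric_space M (orbit_dist n)"
proof
  show "0 \<le> orbit_dist n x y" for x y
  proof (cases "x \<in> M \<and> y \<in> M")
    case True
    then show ?thesis using dist_le_orbit_dist_0[OF n] nonneg order_trans by blast
  qed (auto simp: orbit_metric_def)
  show "orbit_dist n x y = orbit_dist n y x" for x y
    by (auto simp: orbit_metric_def commute)
  show "(orbit_dist n x y = 0) = (x = y)" if "x \<in> M" "y \<in> M" for x y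
  proof
    assume "orbit_dist n x y = 0"
    then have "d x y \<le> 0" using dist_le_orbit_dist_0[OF n that] by simp
    then show "x = y" using that nonneg[of x y] by simp
  next
    assume "x = y"
    then have "orbit_dist n x y \<le> 0"
      using that act_closed by (subst orbit_dist_le_iff[OF n]) auto
    moreover have "0 \<le> orbit_dist n x y"
      using dist_le_orbit_dist_0[OF n that] nonneg[of x y] by linarith
    ultimately show "orbit_dist n x y = 0" by simp
  qed
  show "orbit_dist n x z \<le> orbit_dist n x y + orbit_dist n y z" if "x \<in> M" "y \<in> M" "z \<in> M" for x y z
    unfolding orbit_dist_le_iff[OF n that(1) that(3)]
  proof
    fix \<gamma> assume \<gamma>: "\<gamma> \<in> square n"
    show "d (act \<gamma> x) (act \<gamma> z) \<le> orbit_dist n x y + orbit_dist n y z"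
      using triangle[of "act \<gamma> x" "act \<gamma> y" "act \<gamma> z"] act_closed that
        dist_le_orbit_dist[OF n that(1,2) \<gamma>] dist_le_orbit_dist[OF n that(2,3) \<gamma>]
      by fastforce
  qed
qed

text \<open>Time 0 lies in the square, so orbit balls are contained in balls; equicontinuity over
  the bounded square gives the converse comparison.\<close>

lemma mtopology_orbit:
  assumes n: "n \<ge> 1"
  shows "Metric_space.mtopology M (orbit_dist n) = mtopology"
proof -
  interpret O: Metric_space M "orbit_dist n" by (rule Metric_space_orbit[OF n])
  have 1: "\<exists>r>0. O.mball x r \<subseteq> mball x e" if "x \<in> M" "e > 0" for x e
    using dist_le_orbit_dist_0[OF n that(1)] that(2)
    by (intro exI[of _ e]) (force simp: mball_def O.mball_def)
  have 2: "\<exists>r>0. mball x r \<subseteq> O.mball x e" if "x \<in> M" "e > 0" for x e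
  proof -
    obtain \<delta> where \<delta>: "\<delta> > 0" "\<And>x y a. \<lbrakk>x \<in> M; y \<in> M; cmod a \<le> 2 * real n; d x y < \<delta>\<rbrakk> \<Longrightarrow>
      d (act a x) (act a y) < e / 2"
      using act_equicontinuous[of "e/2" "2 * real n"] \<open>e > 0\<close> by (meson half_gt_zero)
    have "orbit_dist n x y < e" if "y \<in> M" "d x y < \<delta>" for y
    proof -
      have "orbit_dist n x y \<le> e / 2"
        unfolding orbit_dist_le_iff[OF n \<open>x \<in> M\<close> that(1)]
        using \<delta>(2)[OF \<open>x \<in> M\<close> that(1) norm_square_le that(2)] by (auto intro: less_imp_le)
      then show ?thesis using \<open>e > 0\<close> by linarith
    qed
    then show ?thesis using \<delta>(1) that(1) by (intro exI[of _ \<delta>]) (auto simp: mball_def O.mball_def)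
  qed
  show ?thesis
    unfolding topology_eq openin_mtopology O.openin_mtopology
    using 1 2 by (meson order_trans subsetD)
qed

lemma separating_square_exists:
  assumes "\<epsilon> > 0"
  shows "\<exists>k. separating mtopology (\<lambda>x y. \<forall>\<gamma>\<in>square n. d (act \<gamma> x) (act \<gamma> y) \<le> \<epsilon>) (\<lambda>x. k)"
proof (cases "n \<ge> 1")
  case True
  obtain k where "separating mtopology (\<lambda>x y. orbit_dist n x y \<le> \<epsilon>) (\<lambda>x. k)"
    using separating_compact_metric[OF Metric_space_orbit[OF True] _ assms] mtopology_orbit[OF True] compact
    by auto
  then have "separating mtopology (\<lambda>x y. \<forall>\<gamma>\<in>square n. d (act \<gamma> x) (act \<gamma> y) \<le> \<epsilon>) (\<lambda>x. k)"
    by (rule separating_mono) (use orbit_dist_le_iff[OF True] in auto)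
  then show ?thesis ..
next
  case False
  then have "square n = {}" by (auto simp: square_def)
  then have "separating mtopology (\<lambda>x y. \<forall>\<gamma>\<in>square n. d (act \<gamma> x) (act \<gamma> y) \<le> \<epsilon>) (\<lambda>x. 0)"
    using separating_trivial by simp
  then show ?thesis ..
qed

text \<open>A substitute for \<open>Widim\<close> of the orbit metric that differs from it by at
  most 1 and is subadditive over tiles without any correction term.\<close>

definition width :: "real \<Rightarrow> nat \<Rightarrow> nat" where
  "width \<epsilon> n = (LEAST k. separating mtopology (\<lambda>x y. \<forall>\<gamma>\<in>square n. d (act \<gamma> x) (act \<gamma> y) \<le> \<epsilon>) (\<lambda>x. k))"

lemma separating_width:
  assumes "\<epsilon> > 0"
  shows "separating mtopology (\<lambda>x y. \<forall>\<gamma>\<in>square n. d (act \<gamma> x) (act \<gamma> y) \<le> \<epsilon>) (\<lambda>x. width \<epsilon> n)"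
  unfolding width_def by (rule LeastI_ex) (rule separating_square_exists[OF assms])

lemma width_le:
  assumes "separating mtopology (\<lambda>x y. \<forall>\<gamma>\<in>square n. d (act \<gamma> x) (act \<gamma> y) \<le> \<epsilon>) (\<lambda>x. k)"
  shows "width \<epsilon> n \<le> k"
  unfolding width_def by (rule Least_le) (rule assms)

lemma separating_translates:
  assumes "finite A" "\<And>a. a \<in> A \<Longrightarrow> separating mtopology R (N a)"
  shows "separating mtopology (\<lambda>x y. \<forall>a\<in>A. R (act (p a) x) (act (p a) y)) (\<lambda>x. \<Sum>a\<in>A. N a (act (p a) x))"
  using assms by (intro separating_Ball separating_pullback[OF continuous_act])

lemma separating_tiles:
  assumes "L \<ge> 1" and sep: "separating mtopology (\<lambda>x y. \<forall>\<gamma>\<in>square L. d (act \<gamma> x) (act \<gamma> y) \<le> \<epsilon>) N"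
  shows "separating mtopology (\<lambda>x y. \<forall>\<gamma>\<in>square n. d (act \<gamma> x) (act \<gamma> y) \<le> \<epsilon>)
    (\<lambda>x. \<Sum>(i, j) | i < n div L + 1 \<and> j < n div L + 1 \<and> i * L < n \<and> j * L < n.
       N (act (Complex (real (i * L)) (real (j * L))) x))"
proof -
  let ?A = "{(i, j). i < n div L + 1 \<and> j < n div L + 1 \<and> i * L < n \<and> j * L < n}"
  let ?p = "\<lambda>(i, j). Complex (real (i * L)) (real (j * L))"
  have "finite ?A" by (rule finite_subset[of _ "{..<n div L + 1} \<times> {..<n div L + 1}"]) auto
  then have "separating mtopology
     (\<lambda>x y. \<forall>a\<in>?A. \<forall>\<gamma>\<in>square L. d (act \<gamma> (act (?p a) x)) (act \<gamma> (act (?p a) y)) \<le> \<epsilon>)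
     (\<lambda>x. \<Sum>a\<in>?A. N (act (?p a) x))"
    by (rule separating_translates) (rule sep)
  then show ?thesis
  proof (rule separating_mono)
    fix x y assume xy: "x \<in> topspace mtopology" "y \<in> topspace mtopology"
      and h: "\<forall>a\<in>?A. \<forall>\<gamma>\<in>square L. d (act \<gamma> (act (?p a) x)) (act \<gamma> (act (?p a) y)) \<le> \<epsilon>"
    show "\<forall>\<gamma>\<in>square n. d (act \<gamma> x) (act \<gamma> y) \<le> \<epsilon>"
    proof
      fix \<gamma> assume "\<gamma> \<in> square n"
      then obtain i j \<gamma>' where "i < n div L + 1" "j < n div L + 1" "\<gamma>' \<in> square L"
        "\<gamma> = \<gamma>' + Complex (real (i * L)) (real (j * L))" "i * L < n" "j * L < n"
        using square_tiling[OF _ assms(1)] by metis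
      then show "d (act \<gamma> x) (act \<gamma> y) \<le> \<epsilon>"
        using h[rule_format, of "(i, j)" \<gamma>'] act_add xy by simp
    qed
  qed (simp add: split_beta)
qed

lemma width_tiles:
  assumes "L \<ge> 1" "\<epsilon> > 0"
  shows "width \<epsilon> n \<le> (n div L + 1)\<^sup>2 * width \<epsilon> L"
proof (rule width_le, rule separating_mono[OF separating_tiles[OF assms(1) separating_width[OF assms(2)]]])
  fix x
  let ?A = "{(i, j). i < n div L + 1 \<and> j < n div L + 1 \<and> i * L < n \<and> j * L < n}"
  have "card ?A \<le> card ({..<n div L + 1} \<times> {..<n div L + 1})"
    by (intro card_mono) auto
  then have "card ?A * width \<epsilon> L \<le> (n div L + 1)\<^sup>2 * width \<epsilon> L"
    by (intro mult_le_mono1) (simp add: power2_eq_square)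
  then show "(\<Sum>(i, j) \<in> ?A. width \<epsilon> L) \<le> (n div L + 1)\<^sup>2 * width \<epsilon> L"
    by (simp only: case_prod_const sum_constant) simp
qed simp

definition width_rate :: "real \<Rightarrow> real" where
  "width_rate \<epsilon> = (INF L\<in>{1..}. real (width \<epsilon> L) / (real L)\<^sup>2)"

lemma width_rate_le: "L \<ge> 1 \<Longrightarrow> width_rate \<epsilon> \<le> real (width \<epsilon> L) / (real L)\<^sup>2"
  unfolding width_rate_def by (intro cINF_lower bdd_belowI2[of _ 0]) auto

lemma tile_count_tendsto:
  assumes "L \<ge> 1"
  shows "(\<lambda>n. (real (n div L + 1))\<^sup>2 / (real n)\<^sup>2) \<longlonglongrightarrow> 1 / (real L)\<^sup>2"
proof -
  have "(\<lambda>n. real (n div L + 1) / real n) \<longlonglongrightarrow> 1 / real L"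
  proof (rule tendsto_sandwich)
    have *: "real (n div L) \<le> real n / L" "real n / L < real (n div L) + 1" for n
    proof -
      have "real (n div L * L) \<le> real n" "real n < real (L + n div L * L)"
        using assms dividend_less_div_times[of L n] by (simp_all only: of_nat_le_iff of_nat_less_iff) auto
      then show "real (n div L) \<le> real n / L" "real n / L < real (n div L) + 1"
        using assms by (auto simp: field_simps)
    qed
    show "\<forall>\<^sub>F n in sequentially. 1 / real L \<le> real (n div L + 1) / real n"
      using eventually_gt_at_top[of 0]
      by eventually_elim (use assms * in \<open>auto simp: field_simps intro: less_imp_le\<close>)
    show "\<forall>\<^sub>F n in sequentially. real (n div L + 1) / real n \<le> 1 / L + 1 / real n"
      using eventually_gt_at_top[of 0]
      by eventually_elim (use assms * in \<open>auto simp: field_simps\<close>)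
    show "(\<lambda>n. 1 / real L + 1 / real n) \<longlonglongrightarrow> 1 / real L"
      using tendsto_add[OF tendsto_const lim_1_over_n, of "1 / real L"] by simp
  qed simp
  from tendsto_power[OF this, of 2] show ?thesis by (simp add: power_divide)
qed

text \<open>Fekete's argument in dimension two. A square of side \<open>n\<close> needs at most
  \<open>(n div L + 1)^2\<close> tiles, and the excess caused by incomplete tiles at the boundary
  disappears in the limit, so every \<open>L\<close> bounds the limit superior.\<close>

lemma width_tendsto:
  assumes "\<epsilon> > 0"
  shows "(\<lambda>n. real (width \<epsilon> n) / (real n)\<^sup>2) \<longlonglongrightarrow> width_rate \<epsilon>"
proof (rule order_tendstoI)
  fix a assume a: "a < width_rate \<epsilon>"
  show "\<forall>\<^sub>F n in sequentially. a < real (width \<epsilon> n) / (real n)\<^sup>2"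
    using eventually_ge_at_top[of 1]
    by (rule eventually_mono) (rule less_le_trans[OF a width_rate_le])
next
  fix a assume "width_rate \<epsilon> < a"
  then obtain L where L: "L \<ge> 1" "real (width \<epsilon> L) / (real L)\<^sup>2 < a"
    unfolding width_rate_def by (subst (asm) cINF_less_iff) (auto intro: bdd_belowI2[of _ 0])
  have "(\<lambda>n. (real (n div L + 1))\<^sup>2 / (real n)\<^sup>2 * real (width \<epsilon> L)) \<longlonglongrightarrow> 1 / (real L)\<^sup>2 * real (width \<epsilon> L)"
    by (intro tendsto_mult tile_count_tendsto L tendsto_const)
  then have "\<forall>\<^sub>F n in sequentially. (real (n div L + 1))\<^sup>2 / (real n)\<^sup>2 * real (width \<epsilon> L) < a"
    by (rule order_tendstoD) (use L in simp)
  then show "\<forall>\<^sub>F n in sequentially. real (width \<epsilon> n) / (real n)\<^sup>2 < a"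
  proof eventually_elim
    case (elim n)
    have "real (width \<epsilon> n) \<le> real ((n div L + 1)\<^sup>2 * width \<epsilon> L)"
      using width_tiles[OF L(1) assms] of_nat_mono by blast
    then have "real (width \<epsilon> n) / (real n)\<^sup>2 \<le> (real (n div L + 1))\<^sup>2 * real (width \<epsilon> L) / (real n)\<^sup>2"
      by (intro divide_right_mono) (simp_all only: of_nat_mult of_nat_power zero_le_power2)
    then show ?case using elim by simp
  qed
qed

lemma width_antimono:
  assumes "0 < \<delta>" "\<delta> \<le> \<epsilon>"
  shows "width \<epsilon> n \<le> width \<delta> n"
  by (rule width_le, rule separating_mono[OF separating_width[OF assms(1)]]) (use assms in force)+

lemma width_rate_antimono:
  assumes "0 < \<delta>" "\<delta> \<le> \<epsilon>"
  shows "width_rate \<epsilon> \<le> width_rate \<delta>"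
  by (rule LIMSEQ_le[OF width_tendsto width_tendsto])
    (use assms width_antimono in \<open>auto intro!: divide_right_mono\<close>)

lemma Widim_width:
  assumes "\<epsilon> > 0" "n \<ge> 1"
  obtains m where "Widim \<epsilon> M (orbit_dist n) = ereal (real m)" "m \<le> width \<epsilon> n" "width \<epsilon> n \<le> m + 1"
proof -
  have sep: "separating (Metric_space.mtopology M (orbit_dist n)) (\<lambda>x y. orbit_dist n x y \<le> \<epsilon>) (\<lambda>x. width \<epsilon> n)"
    unfolding mtopology_orbit[OF assms(2)]
    by (rule separating_mono[OF separating_width[OF assms(1)]]) (use orbit_dist_le_iff[OF assms(2)] in auto)
  obtain m where m: "m \<le> width \<epsilon> n" "Widim \<epsilon> M (orbit_dist n) = ereal (real m)"
    "separating (Metric_space.mtopology M (orbit_dist n)) (\<lambda>x y. orbit_dist n x y \<le> \<epsilon>) (\<lambda>x. m + 1)"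
    by (rule Widim_separating[OF Metric_space_orbit[OF assms(2)] sep])
  have "separating mtopology (\<lambda>x y. \<forall>\<gamma>\<in>square n. d (act \<gamma> x) (act \<gamma> y) \<le> \<epsilon>) (\<lambda>x. m + 1)"
    by (rule separating_mono[OF m(3)[unfolded mtopology_orbit[OF assms(2)]]])
      (use orbit_dist_le_iff[OF assms(2)] in auto)
  from width_le[OF this] that m show ?thesis by blast
qed

text \<open>The \<open>lim\<close> in the definition is meaningful only if the sequence converges.
  \<open>Widim\<close> lies between \<open>width - 1\<close> and \<open>width\<close>, and the
  difference of 1 vanishes after division by the area.\<close>

lemma Widim_action_eq:
  assumes "\<epsilon> > 0"
  shows "Widim_action \<epsilon> M d act = ereal (width_rate \<epsilon>)"
proof -
  define m where "m n = (SOME m. Widim \<epsilon> M (orbit_dist n) = ereal (real m) \<and> m \<le> width \<epsilon> n \<and> width \<epsilon> n \<le> m + 1)" for n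
  have m: "Widim \<epsilon> M (orbit_dist n) = ereal (real (m n)) \<and> m n \<le> width \<epsilon> n \<and> width \<epsilon> n \<le> m n + 1" if "n \<ge> 1" for n
    unfolding m_def by (rule someI_ex) (use Widim_width[OF assms that] in metis)
  have "(\<lambda>n. real (m n) / (real n)\<^sup>2) \<longlonglongrightarrow> width_rate \<epsilon>"
  proof (rule tendsto_sandwich[OF _ _ _ width_tendsto[OF assms]])
    have "(\<lambda>n. 1 / real n * (1 / real n)) \<longlonglongrightarrow> 0 * 0"
      by (intro tendsto_mult lim_1_over_n)
    from tendsto_diff[OF width_tendsto[OF assms] this]
    show "(\<lambda>n. real (width \<epsilon> n) / (real n)\<^sup>2 - 1 / (real n)\<^sup>2) \<longlonglongrightarrow> width_rate \<epsilon>"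
      by (simp add: power2_eq_square)
    show "\<forall>\<^sub>F n in sequentially. real (width \<epsilon> n) / (real n)\<^sup>2 - 1 / (real n)\<^sup>2 \<le> real (m n) / (real n)\<^sup>2"
      using eventually_ge_at_top[of 1]
    proof eventually_elim
      case (elim n)
      then have "real (width \<epsilon> n) - 1 \<le> real (m n)" using m[OF elim] by linarith
      then show ?case by (simp only: diff_divide_distrib[symmetric] divide_right_mono zero_le_power2)
    qed
    show "\<forall>\<^sub>F n in sequentially. real (m n) / (real n)\<^sup>2 \<le> real (width \<epsilon> n) / (real n)\<^sup>2"
      using eventually_ge_at_top[of 1]
    proof eventually_elim
      case (elim n)
      then show ?case using m[OF elim] by (intro divide_right_mono) simp_all
    qed
  qed
  then have "(\<lambda>n. ereal (real (m n) / (real n)\<^sup>2)) \<longlonglongrightarrow> ereal (width_rate \<epsilon>)" by simp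
  moreover have "\<forall>\<^sub>F n in sequentially. ereal (real (m n) / (real n)\<^sup>2) = ereal (1 / (real n)\<^sup>2) * Widim \<epsilon> M (orbit_dist n)"
    using eventually_ge_at_top[of 1]
  proof eventually_elim
    case (elim n)
    then have "Widim \<epsilon> M (orbit_dist n) = ereal (real (m n))" using m by blast
    then show ?case by simp
  qed
  ultimately have "(\<lambda>n. ereal (1 / (real n)\<^sup>2) * Widim \<epsilon> M (orbit_dist n)) \<longlonglongrightarrow> ereal (width_rate \<epsilon>)"
    by (rule Lim_transform_eventually)
  then show ?thesis
    unfolding Widim_action_def square_def[symmetric] by (rule limI)
qed

text \<open>The rate grows as the tolerance decreases, so the limit at 0 exists and is a
  supremum.\<close>

lemma mean_dim_wrt_eq: "mean_dim_wrt M d act = (SUP \<epsilon>\<in>{0<..}. ereal (width_rate \<epsilon>))"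
  unfolding mean_dim_wrt_def
proof (rule tendsto_Lim[OF trivial_limit_at_right_real])
  show "((\<lambda>\<epsilon>. Widim_action \<epsilon> M d act) \<longlongrightarrow> (SUP \<epsilon>\<in>{0<..}. ereal (width_rate \<epsilon>))) (at_right 0)"
  proof (rule order_tendstoI)
    fix a assume "a < (SUP \<epsilon>\<in>{0<..}. ereal (width_rate \<epsilon>))"
    then obtain e where e: "e > 0" "a < ereal (width_rate e)" by (auto simp: less_SUP_iff)
    have "\<forall>\<^sub>F \<epsilon> in at_right 0. \<epsilon> < e \<and> 0 < \<epsilon>"
      using e(1) by (intro eventually_conj eventually_at_right_less)
        (auto simp: eventually_at_right_field)
    then show "\<forall>\<^sub>F \<epsilon> in at_right 0. a < Widim_action \<epsilon> M d act"
    proof eventually_elim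
      case (elim \<epsilon>)
      then have "ereal (width_rate e) \<le> ereal (width_rate \<epsilon>)"
        using width_rate_antimono[of \<epsilon> e] by simp
      with elim e(2) show ?case by (simp only: Widim_action_eq less_le_trans)
    qed
  next
    fix a assume a: "(SUP \<epsilon>\<in>{0<..}. ereal (width_rate \<epsilon>)) < a"
    have "\<forall>\<^sub>F \<epsilon> in at_right (0::real). 0 < \<epsilon>" by (rule eventually_at_right_less)
    then show "\<forall>\<^sub>F \<epsilon> in at_right 0. Widim_action \<epsilon> M d act < a"
    proof eventually_elim
      case (elim \<epsilon>)
      then have "ereal (width_rate \<epsilon>) \<le> (SUP \<epsilon>\<in>{0<..}. ereal (width_rate \<epsilon>))"
        by (intro SUP_upper) simp
      with elim a show ?case by (simp only: Widim_action_eq le_less_trans)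
    qed
  qed
qed

end

section \<open>Independence of the metric\<close>

lemma compact_metrics_uniform:
  assumes "Metric_space M d" "Metric_space M d'" "Metric_space.mtopology M d = Metric_space.mtopology M d'"
    "compact_space (Metric_space.mtopology M d)" "e > 0"
  shows "\<exists>\<delta>>0. \<forall>x\<in>M. \<forall>y\<in>M. d x y < \<delta> \<longrightarrow> d' x y < e"
proof -
  interpret A: Metric_space M d by fact
  interpret B: Metric_space M d' by fact
  have "continuous_map (mtopology_of A.Self) (mtopology_of B.Self) id"
    using assms(3) by (simp add: mtopology_of_def)
  then have "uniformly_continuous_map A.Self B.Self id"
    using continuous_imp_uniformly_continuous_map[of A.Self B.Self id] assms(4)
    by (simp add: mtopology_of_def)
  then show ?thesis
    using assms(5) unfolding uniformly_continuous_map_def by simp blast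
qed

context compact_action
begin

lemma compact_action_other_metric:
  assumes "Metric_space M d'" "Metric_space.mtopology M d' = mtopology"
  shows "compact_action M d' act"
proof -
  interpret B: Metric_space M d' by fact
  show ?thesis
  proof
    fix e R :: real assume "e > 0"
    obtain e' where e': "e' > 0" "\<And>x y. \<lbrakk>x \<in> M; y \<in> M; d x y < e'\<rbrakk> \<Longrightarrow> d' x y < e"
      using compact_metrics_uniform[OF Metric_space_axioms assms(1) assms(2)[symmetric] compact \<open>e > 0\<close>] by blast
    obtain \<delta>' where \<delta>': "\<delta>' > 0" "\<And>x y a. \<lbrakk>x \<in> M; y \<in> M; cmod a \<le> R; d x y < \<delta>'\<rbrakk> \<Longrightarrow> d (act a x) (act a y) < e'"
      using act_equicontinuous[OF e'(1), of R] by blast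
    obtain \<delta> where \<delta>: "\<delta> > 0" "\<And>x y. \<lbrakk>x \<in> M; y \<in> M; d' x y < \<delta>\<rbrakk> \<Longrightarrow> d x y < \<delta>'"
      using compact_metrics_uniform[OF assms(1) Metric_space_axioms assms(2) _ \<delta>'(1)] compact assms(2) by auto
    show "\<exists>\<delta>>0. \<forall>x\<in>M. \<forall>y\<in>M. \<forall>a. cmod a \<le> R \<and> d' x y < \<delta> \<longrightarrow> d' (act a x) (act a y) < e"
      using \<delta> \<delta>' e' act_closed by (intro exI[of _ \<delta>]) blast
  qed (use compact assms(2) act_closed act_zero act_add in auto)
qed

text \<open>The identity between two compatible metrics on a compact space is uniformly continuous,
  so one tolerance can be traded for another at all times of the orbit simultaneously. Only the
  supremum over tolerances is therefore invariant.\<close>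

lemma width_rate_other_metric:
  assumes B: "compact_action M d' act" "Metric_space.mtopology M d' = mtopology" "\<epsilon> > 0"
  shows "\<exists>\<delta>>0. width_rate \<epsilon> \<le> compact_action.width_rate M d' act \<delta>"
proof -
  interpret B: compact_action M d' act by fact
  obtain \<delta> where \<delta>: "\<delta> > 0" "\<And>x y. \<lbrakk>x \<in> M; y \<in> M; d' x y < \<delta>\<rbrakk> \<Longrightarrow> d x y < \<epsilon>"
    using compact_metrics_uniform[OF B.Metric_space_axioms Metric_space_axioms B(2) B.compact B(3)] by blast
  have "width \<epsilon> n \<le> B.width (\<delta>/2) n" for n
  proof (rule width_le, rule separating_mono)
    show "separating mtopology (\<lambda>x y. \<forall>\<gamma>\<in>square n. d' (act \<gamma> x) (act \<gamma> y) \<le> \<delta>/2) (\<lambda>x. B.width (\<delta>/2) n)"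
      using B.separating_width[of "\<delta>/2" n] \<delta>(1) B(2) by simp
    fix x y assume "x \<in> topspace mtopology" "y \<in> topspace mtopology"
      and h: "\<forall>\<gamma>\<in>square n. d' (act \<gamma> x) (act \<gamma> y) \<le> \<delta>/2"
    then show "\<forall>\<gamma>\<in>square n. d (act \<gamma> x) (act \<gamma> y) \<le> \<epsilon>"
      using \<delta> act_closed by (force intro: less_imp_le)
  qed simp
  then have "width_rate \<epsilon> \<le> B.width_rate (\<delta>/2)"
    using \<delta>(1) by (intro LIMSEQ_le[OF width_tendsto[OF B(3)] B.width_tendsto])
      (auto intro!: exI[of _ 0] divide_right_mono)
  then show ?thesis using \<delta>(1) by (intro exI[of _ "\<delta>/2"]) auto
qed

lemma mean_dim_eq: "mean_dim mtopology act = (SUP \<epsilon>\<in>{0<..}. ereal (width_rate \<epsilon>))"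
proof (cases "M = {}")
  case True
  have "width \<epsilon> n \<le> 0" for \<epsilon> n
  proof (rule width_le, rule separating_mono[OF separating_trivial])
    fix x y assume "x \<in> topspace mtopology"
    then have "x \<in> M" by simp
    then show "\<forall>\<gamma>\<in>square n. d (act \<gamma> x) (act \<gamma> y) \<le> \<epsilon>" unfolding True by simp
  qed simp
  then have "width_rate \<epsilon> = 0" for \<epsilon> by (simp add: width_rate_def)
  then have "(SUP \<epsilon>\<in>{0<..}. ereal (width_rate \<epsilon>)) = 0" by (simp add: zero_ereal_def)
  moreover have "mean_dim mtopology act = 0"
    unfolding mean_dim_def topspace_mtopology by (rule if_P[OF True])
  ultimately show ?thesis by simp
next
  case False
  define d' where "d' = (SOME d'. Metric_space M d' \<and> Metric_space.mtopology M d' = mtopology)"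
  have d': "Metric_space M d'" "Metric_space.mtopology M d' = mtopology"
    unfolding atomize_conj d'_def by (rule someI[of _ d]) (simp add: Metric_space_axioms)
  interpret B: compact_action M d' act by (rule compact_action_other_metric[OF d'])
  have "mean_dim mtopology act = mean_dim_wrt M d' act"
    using False by (simp add: mean_dim_def d'_def)
  also have "\<dots> = (SUP \<epsilon>\<in>{0<..}. ereal (B.width_rate \<epsilon>))" by (rule B.mean_dim_wrt_eq)
  also have "\<dots> = (SUP \<epsilon>\<in>{0<..}. ereal (width_rate \<epsilon>))"
  proof (rule antisym; rule SUP_mono)
    fix \<epsilon> :: real assume "\<epsilon> \<in> {0<..}"
    then show "\<exists>\<delta>\<in>{0<..}. ereal (B.width_rate \<epsilon>) \<le> ereal (width_rate \<delta>)"
      using B.width_rate_other_metric[OF compact_action_axioms d'(2)[symmetric]] by auto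
  next
    fix \<epsilon> :: real assume "\<epsilon> \<in> {0<..}"
    then show "\<exists>\<delta>\<in>{0<..}. ereal (width_rate \<epsilon>) \<le> ereal (B.width_rate \<delta>)"
      using width_rate_other_metric[OF B.compact_action_axioms d'(2)] by auto
  qed
  finally show ?thesis .
qed

end

section \<open>Removing a part that orbits rarely visit\<close>

text \<open>Multiplication by \<rho> silences the family where \<rho> vanishes, and \<rho> itself is
  kept as a coordinate so that equal coordinates force equal cutoffs, by which one can divide. The
  price is paid only where \<rho> is nonzero.\<close>

lemma separating_cutoff:
  assumes \<rho>: "continuous_map T euclideanreal \<rho>" "\<And>x. x \<in> topspace T \<Longrightarrow> 0 \<le> \<rho> x"
    and sep: "separating T R (\<lambda>x. q)"
  shows "separating T (\<lambda>x y. \<rho> x \<noteq> 0 \<longrightarrow> R x y) (\<lambda>x. if \<rho> x = 0 then 0 else q + 1)"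
proof -
  obtain k u where u: "\<forall>i<(k::nat). continuous_map T euclideanreal (u i)"
     "\<forall>i<k. \<forall>x\<in>topspace T. 0 \<le> u i x"
     "\<forall>x\<in>topspace T. card {i. i < k \<and> u i x \<noteq> 0} \<le> q"
     "\<forall>x\<in>topspace T. \<forall>y\<in>topspace T. (\<forall>i<k. u i x = u i y) \<longrightarrow> R x y"
    using sep unfolding separating_def by blast
  define v where "v i x = (if i = 0 then \<rho> x else \<rho> x * u (i - 1) x)" for i x
  show ?thesis
  proof (rule separatingI[where k = "Suc k" and u = v])
    fix i assume "i < Suc k"
    then show "continuous_map T euclideanreal (v i)"
      unfolding v_def using \<rho>(1) u(1) by (cases i) (auto intro: continuous_map_real_mult)
  next
    fix i x assume "i < Suc k" "x \<in> topspace T"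
    then show "0 \<le> v i x" using \<rho>(2) u(2) by (cases i) (auto simp: v_def)
  next
    fix x assume x: "x \<in> topspace T"
    have "card {i. i < Suc k \<and> v i x \<noteq> 0} \<le> Suc (card {i. i < k \<and> u i x \<noteq> 0})"
      by (rule card_support_Suc) (simp add: v_def)
    also have "\<dots> \<le> q + 1" using u(3) x by simp
    finally have "card {i. i < Suc k \<and> v i x \<noteq> 0} \<le> q + 1" .
    moreover have "card {i. i < Suc k \<and> v i x \<noteq> 0} = 0" if "\<rho> x = 0"
    proof -
      have "{i. i < Suc k \<and> v i x \<noteq> 0} = {}" using that by (auto simp: v_def)
      then show ?thesis by (simp only: card.empty)
    qed
    ultimately show "card {i. i < Suc k \<and> v i x \<noteq> 0} \<le> (if \<rho> x = 0 then 0 else q + 1)"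
      by (cases "\<rho> x = 0") simp_all
  next
    fix x y assume xy: "x \<in> topspace T" "y \<in> topspace T" "\<forall>i<Suc k. v i x = v i y"
    show "\<rho> x \<noteq> 0 \<longrightarrow> R x y"
    proof
      assume "\<rho> x \<noteq> 0"
      moreover have "\<rho> x = \<rho> y" using xy(3)[rule_format, of 0] by (simp add: v_def)
      ultimately have "u i x = u i y" if "i < k" for i
        using xy(3)[rule_format, of "Suc i"] that by (simp add: v_def)
      then show "R x y" using u(4) xy by blast
    qed
  qed
qed

lemma (in Metric_space) mtopology_subset:
  assumes "Z \<subseteq> M"
  shows "Metric_space Z d" "Metric_space.mtopology Z d = subtopology mtopology Z"
proof -
  interpret Submetric M d Z by unfold_locales (rule assms)
  show "Metric_space Z d" by (rule sub.Metric_space_axioms)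
  show "Metric_space.mtopology Z d = subtopology mtopology Z" by (rule mtopology_submetric)
qed

context compact_action
begin

lemma compact_action_subset:
  assumes "closedin mtopology Z" "\<And>a x. x \<in> Z \<Longrightarrow> act a x \<in> Z"
  shows "compact_action Z d act"
proof -
  have sub: "Z \<subseteq> M" using closedin_subset[OF assms(1)] by simp
  interpret Z: Metric_space Z d by (rule mtopology_subset[OF sub])
  show ?thesis
  proof
    show "compact_space Z.mtopology"
      unfolding mtopology_subset(2)[OF sub]
      using closedin_compact_space[OF compact assms(1)] compact_space_subtopology by blast
    fix e R :: real assume "e > 0"
    then show "\<exists>\<delta>>0. \<forall>x\<in>Z. \<forall>y\<in>Z. \<forall>a. cmod a \<le> R \<and> d x y < \<delta> \<longrightarrow> d (act a x) (act a y) < e"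
      using act_equicontinuous[of e R] sub by blast
  qed (use assms sub act_zero act_add in auto)
qed

lemma width_rate_subset:
  assumes Z: "closedin mtopology Z" "\<And>a x. x \<in> Z \<Longrightarrow> act a x \<in> Z" and "\<epsilon> > 0"
  shows "compact_action.width_rate Z d act \<epsilon> \<le> width_rate \<epsilon>"
proof -
  interpret Z: compact_action Z d act by (rule compact_action_subset[OF Z])
  have sub: "Z \<subseteq> M" using closedin_subset[OF Z(1)] by simp
  have "Z.width \<epsilon> n \<le> width \<epsilon> n" for n
  proof (rule Z.width_le)
    have "continuous_map Z.mtopology mtopology (\<lambda>x. x)"
      unfolding mtopology_subset(2)[OF sub] by (simp add: continuous_map_from_subtopology)
    then show "separating Z.mtopology (\<lambda>x y. \<forall>\<gamma>\<in>square n. d (act \<gamma> x) (act \<gamma> y) \<le> \<epsilon>) (\<lambda>x. width \<epsilon> n)"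
      using separating_pullback separating_width[OF assms(3)] by fastforce
  qed
  then show ?thesis
    by (intro LIMSEQ_le[OF Z.width_tendsto[OF assms(3)] width_tendsto[OF assms(3)]])
      (auto intro!: exI[of _ 0] divide_right_mono)
qed

text \<open>On a tile of side \<open>L\<close> three local families are used: one near \<open>Y\<close>, with about \<open>L\<^sup>2\<close> times the
  width rate of \<open>Y\<close> active coordinates; one near \<open>C\<close>, whose size does not depend on \<open>L\<close> because the action
  is trivial there; and one that is active only on a closed set \<open>K\<close> off \<open>Y \<union> C\<close>, which is expensive but
  occurs on a small proportion of the tiles.\<close>

lemma width_rate_sparse_complement:
  assumes Y: "closedin mtopology Y" "\<And>a x. x \<in> Y \<Longrightarrow> act a x \<in> Y"
    and C: "closedin mtopology C" "\<And>a x. x \<in> C \<Longrightarrow> act a x = x"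
    and sparse: "\<And>K \<delta>. \<lbrakk>closedin mtopology K; K \<inter> (Y \<union> C) = {}; \<delta> > 0\<rbrakk> \<Longrightarrow>
      \<exists>n0. \<forall>n\<ge>n0. \<forall>x\<in>M. real (visits n x K)
        \<le> \<delta> * (real n)\<^sup>2"
    and \<epsilon>: "0 < \<epsilon>" "\<epsilon> < \<epsilon>'"
  shows "width_rate \<epsilon>' \<le> compact_action.width_rate Y d act \<epsilon>"
proof -
  interpret Y: compact_action Y d act by (rule compact_action_subset[OF Y])
  have YM: "Y \<subseteq> M" and CM: "C \<subseteq> M" using closedin_subset[OF Y(1)] closedin_subset[OF C(1)] by auto
  interpret C: compact_action C d act using compact_action_subset C by metis
  obtain c where c: "separating (subtopology mtopology C) (\<lambda>x y. d x y \<le> \<epsilon>) (\<lambda>x. c)"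
    using separating_compact_metric[OF C.Metric_space_axioms C.compact \<epsilon>(1)] mtopology_subset(2)[OF CM]
    by auto
  have bound: "width_rate \<epsilon>' \<le> (real (Y.width \<epsilon> L) + (real c + 2)) / (real L)\<^sup>2" if L: "L \<ge> 1" for L
  proof -
    have sepY: "separating (subtopology (Metric_space.mtopology M (orbit_dist L)) Y)
        (\<lambda>x y. orbit_dist L x y \<le> \<epsilon>) (\<lambda>x. Y.width \<epsilon> L)"
      using Y.separating_width[OF \<epsilon>(1), of L] unfolding mtopology_orbit[OF L] mtopology_subset(2)[OF YM]
      by (rule separating_mono) (use orbit_dist_le_iff[OF L] YM in auto)
    have sepC: "separating (subtopology (Metric_space.mtopology M (orbit_dist L)) C)
        (\<lambda>x y. orbit_dist L x y \<le> \<epsilon>) (\<lambda>x. c)"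
      using c unfolding mtopology_orbit[OF L]
    proof (rule separating_mono)
      fix x y assume "x \<in> topspace (subtopology mtopology C)" "y \<in> topspace (subtopology mtopology C)" "d x y \<le> \<epsilon>"
      then show "orbit_dist L x y \<le> \<epsilon>" using C(2) orbit_dist_le_iff[OF L, of x y \<epsilon>] by simp
    qed simp
    have comp: "compact_space (Metric_space.mtopology M (orbit_dist L))"
      using compact mtopology_orbit[OF L] by simp
    obtain V1 where V1: "openin mtopology V1" "Y \<subseteq> V1"
      "separating mtopology (\<lambda>x y. x \<in> V1 \<longrightarrow> orbit_dist L x y \<le> \<epsilon>') (\<lambda>x. Y.width \<epsilon> L + 1)"
      using separating_extend[OF Metric_space_orbit[OF L] comp _ sepY \<epsilon>(2)] Y(1)
      unfolding mtopology_orbit[OF L] by blast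
    obtain V2 where V2: "openin mtopology V2" "C \<subseteq> V2"
      "separating mtopology (\<lambda>x y. x \<in> V2 \<longrightarrow> orbit_dist L x y \<le> \<epsilon>') (\<lambda>x. c + 1)"
      using separating_extend[OF Metric_space_orbit[OF L] comp _ sepC \<epsilon>(2)] C(1)
      unfolding mtopology_orbit[OF L] by blast
    have closedV: "closedin mtopology (M - (V1 \<union> V2))"
      using V1(1) V2(1) by (metis closedin_def closedin_topspace closedin_diff openin_Un topspace_mtopology)
    have closedYC: "closedin mtopology (Y \<union> C)" using Y(1) C(1) by (rule closedin_Un)
    have "disjnt (Y \<union> C) (M - (V1 \<union> V2))" using V1(2) V2(2) by (auto simp: disjnt_def)
    moreover have "normal_space mtopology"
      by (simp add: metrizable_imp_normal_space metrizable_space_mtopology)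
    ultimately obtain \<sigma> where \<sigma>: "continuous_map mtopology (top_of_set {0..1::real}) \<sigma>"
        "\<sigma> ` (Y \<union> C) \<subseteq> {0}" "\<sigma> ` (M - (V1 \<union> V2)) \<subseteq> {1}"
      using Urysohn_lemma[OF _ closedYC closedV, of 0 1] by (metis zero_le_one)
    have cont\<sigma>: "continuous_map mtopology euclideanreal \<sigma>"
      using \<sigma>(1) by (simp add: continuous_map_in_subtopology)
    \<comment> \<open>The level 1/2 leaves a gap on both sides: \<rho> is 1/2 where neither
      \<open>V1\<close> nor \<open>V2\<close> applies, and its support lies in the closed set
      \<open>K\<close>, which avoids \<open>Y \<union> C\<close> because \<sigma> is 0
      there.\<close>
    define \<rho> where "\<rho> x = max 0 (\<sigma> x - 1/2)" for x
    define K where "K = {x \<in> topspace mtopology. \<sigma> x \<in> {1/2..}}"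
    have closedK: "closedin mtopology K"
      unfolding K_def by (rule closedin_continuous_map_preimage[OF cont\<sigma>]) simp
    have disjK: "K \<inter> (Y \<union> C) = {}" using \<sigma>(2) by (force simp: K_def)
    define q where "q = width \<epsilon>' L"
    have "continuous_map mtopology euclideanreal \<rho>"
      unfolding \<rho>_def by (intro continuous_map_real_max continuous_map_diff cont\<sigma>) auto
    then have sepK: "separating mtopology (\<lambda>x y. \<rho> x \<noteq> 0 \<longrightarrow> (\<forall>\<gamma>\<in>square L. d (act \<gamma> x) (act \<gamma> y) \<le> \<epsilon>'))
        (\<lambda>x. if \<rho> x = 0 then 0 else q + 1)"
      unfolding q_def by (rule separating_cutoff) (use separating_width \<epsilon> in \<open>auto simp: \<rho>_def\<close>)
    \<comment> \<open>The summand 2 counts the cutoff coordinates added by the extensions from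
      \<open>Y\<close> and from \<open>C\<close>.\<close>
    define w where "w = Y.width \<epsilon> L + c + 2"
    have sepL: "separating mtopology (\<lambda>x y. \<forall>\<gamma>\<in>square L. d (act \<gamma> x) (act \<gamma> y) \<le> \<epsilon>')
        (\<lambda>x. w + (if x \<in> K then q + 1 else 0))"
    proof (rule separating_mono[OF separating_conj[OF separating_conj[OF V1(3) V2(3)] sepK]])
      fix x y assume xy: "x \<in> topspace mtopology" "y \<in> topspace mtopology" and
        h: "((x \<in> V1 \<longrightarrow> orbit_dist L x y \<le> \<epsilon>') \<and> (x \<in> V2 \<longrightarrow> orbit_dist L x y \<le> \<epsilon>')) \<and>
          (\<rho> x \<noteq> 0 \<longrightarrow> (\<forall>\<gamma>\<in>square L. d (act \<gamma> x) (act \<gamma> y) \<le> \<epsilon>'))"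
      show "\<forall>\<gamma>\<in>square L. d (act \<gamma> x) (act \<gamma> y) \<le> \<epsilon>'"
      proof (cases "x \<in> V1 \<union> V2")
        case True
        then show ?thesis using h orbit_dist_le_iff[OF L, of x y \<epsilon>'] xy by auto
      next
        case False
        then have "\<sigma> x = 1" using \<sigma>(3) xy by force
        then show ?thesis using h by (simp add: \<rho>_def)
      qed
    next
      fix x assume "x \<in> topspace mtopology"
      then show "Y.width \<epsilon> L + 1 + (c + 1) + (if \<rho> x = 0 then 0 else q + 1) \<le> w + (if x \<in> K then q + 1 else 0)"
        by (auto simp: w_def K_def \<rho>_def)
    qed
    \<comment> \<open>Exceptional tiles are bounded crudely by all lattice visits to
      \<open>K\<close>, although the tile corners are only some of these lattice points. This
      suffices because \<open>q\<close> and \<open>K\<close> depend on \<open>L\<close> but not on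
      \<delta>, which tends to 0 while \<open>L\<close> is fixed.\<close>
    have est: "width_rate \<epsilon>' \<le> real w / (real L)\<^sup>2 + (real q + 1) * \<delta>" if "\<delta> > 0" for \<delta>
    proof -
      obtain n0 where n0: "\<And>n x. \<lbrakk>n \<ge> n0; x \<in> M\<rbrakk> \<Longrightarrow>
          real (visits n x K) \<le> \<delta> * (real n)\<^sup>2"
        using sparse[OF closedK disjK \<open>\<delta> > 0\<close>] by blast
      have le: "real (width \<epsilon>' n) \<le> (real (n div L + 1))\<^sup>2 * real w + (real q + 1) * (\<delta> * (real n)\<^sup>2)"
        if "n \<ge> n0" for n
      proof -
        let ?A = "{(i, j). i < n div L + 1 \<and> j < n div L + 1 \<and> i * L < n \<and> j * L < n}"
        let ?B = "\<lambda>x. {(i, j). i < n \<and> j < n \<and> act (Complex (real i) (real j)) x \<in> K}"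
        have finA: "finite ?A" by (rule finite_subset[of _ "{..<n div L + 1} \<times> {..<n div L + 1}"]) auto
        have finB: "finite (?B x)" for x by (rule finite_subset[of _ "{..<n} \<times> {..<n}"]) auto
        have "card ?A \<le> card ({..<n div L + 1} \<times> {..<n div L + 1})"
          by (intro card_mono) auto
        then have cardA: "card ?A * w \<le> (n div L + 1)\<^sup>2 * w"
          by (intro mult_le_mono1) (simp add: power2_eq_square)
        have "width \<epsilon>' n \<le> (n div L + 1)\<^sup>2 * w + (q + 1) * nat \<lfloor>\<delta> * (real n)\<^sup>2\<rfloor>"
        proof (rule width_le, rule separating_mono[OF separating_tiles[OF L sepL]])
          fix x assume "x \<in> topspace mtopology"
          then have "card (?B x) \<le> nat \<lfloor>\<delta> * (real n)\<^sup>2\<rfloor>"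
            using n0[OF that, of x] by (simp add: le_nat_floor)
          have "card {a \<in> ?A. act (Complex (real (fst a * L)) (real (snd a * L))) x \<in> K}
              = card ((\<lambda>a. (fst a * L, snd a * L)) ` {a \<in> ?A. act (Complex (real (fst a * L)) (real (snd a * L))) x \<in> K})"
            by (rule card_image[symmetric]) (use L in \<open>auto simp: inj_on_def\<close>)
          also have "\<dots> \<le> card (?B x)" by (rule card_mono[OF finB]) auto
          also have "\<dots> \<le> nat \<lfloor>\<delta> * (real n)\<^sup>2\<rfloor>" by fact
          finally have cardK: "card {a \<in> ?A. act (Complex (real (fst a * L)) (real (snd a * L))) x \<in> K} \<le> nat \<lfloor>\<delta> * (real n)\<^sup>2\<rfloor>" .
          have "(\<Sum>(i, j) \<in> ?A. w + (if act (Complex (real (i * L)) (real (j * L))) x \<in> K then q + 1 else 0))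
             = (\<Sum>a\<in>?A. w + (if act (Complex (real (fst a * L)) (real (snd a * L))) x \<in> K then q + 1 else 0))"
            by (rule sum.cong[OF refl]) (simp add: split_beta)
          also have "\<dots> = card ?A * w + (\<Sum>a\<in>?A. if act (Complex (real (fst a * L)) (real (snd a * L))) x \<in> K then q + 1 else 0)"
            by (simp only: sum.distrib sum_constant) simp
          also have "(\<Sum>a\<in>?A. if act (Complex (real (fst a * L)) (real (snd a * L))) x \<in> K then q + 1 else 0)
             = card {a \<in> ?A. act (Complex (real (fst a * L)) (real (snd a * L))) x \<in> K} * (q + 1)"
            unfolding sum.inter_filter[OF finA, symmetric] by (simp only: sum_constant) simp
          also have "card ?A * w + \<dots> \<le> (n div L + 1)\<^sup>2 * w + nat \<lfloor>\<delta> * (real n)\<^sup>2\<rfloor> * (q + 1)"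
            by (rule add_mono[OF cardA mult_le_mono1[OF cardK]])
          finally show "(\<Sum>(i, j) \<in> ?A. w + (if act (Complex (real (i * L)) (real (j * L))) x \<in> K then q + 1 else 0))
             \<le> (n div L + 1)\<^sup>2 * w + (q + 1) * nat \<lfloor>\<delta> * (real n)\<^sup>2\<rfloor>" by (simp only: mult.commute)
        qed simp
        then have "real (width \<epsilon>' n) \<le> real ((n div L + 1)\<^sup>2 * w + (q + 1) * nat \<lfloor>\<delta> * (real n)\<^sup>2\<rfloor>)"
          by (rule of_nat_mono)
        also have "\<dots> = (real (n div L + 1))\<^sup>2 * real w + (real q + 1) * real (nat \<lfloor>\<delta> * (real n)\<^sup>2\<rfloor>)"
          by (simp only: of_nat_add of_nat_mult of_nat_power of_nat_1)
        also have "\<dots> \<le> (real (n div L + 1))\<^sup>2 * real w + (real q + 1) * (\<delta> * (real n)\<^sup>2)"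
          using \<open>\<delta> > 0\<close> by (intro add_left_mono mult_left_mono) (simp_all add: of_nat_nat)
        finally show ?thesis .
      qed
      have lim: "(\<lambda>n. (real (n div L + 1))\<^sup>2 / (real n)\<^sup>2 * real w + (real q + 1) * \<delta>) \<longlonglongrightarrow>
          1 / (real L)\<^sup>2 * real w + (real q + 1) * \<delta>"
        by (intro tendsto_add tendsto_mult tile_count_tendsto L tendsto_const)
      have "width_rate \<epsilon>' \<le> 1 / (real L)\<^sup>2 * real w + (real q + 1) * \<delta>"
      proof (rule LIMSEQ_le[OF width_tendsto lim], use \<epsilon> in simp, intro exI[of _ "max n0 1"] allI impI)
        fix n assume n: "max n0 1 \<le> n"
        then have "real (width \<epsilon>' n) / (real n)\<^sup>2 \<le>
            ((real (n div L + 1))\<^sup>2 * real w + (real q + 1) * (\<delta> * (real n)\<^sup>2)) / (real n)\<^sup>2"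
          by (intro divide_right_mono le) auto
        also have "\<dots> = (real (n div L + 1))\<^sup>2 / (real n)\<^sup>2 * real w + (real q + 1) * \<delta>"
          using n by (simp add: add_divide_distrib)
        finally show "real (width \<epsilon>' n) / (real n)\<^sup>2 \<le>
          (real (n div L + 1))\<^sup>2 / (real n)\<^sup>2 * real w + (real q + 1) * \<delta>" .
      qed
      then show ?thesis by simp
    qed
    have "width_rate \<epsilon>' \<le> real w / (real L)\<^sup>2"
    proof (rule field_le_epsilon)
      fix e :: real assume "e > 0"
      moreover have pos: "real q + 1 > 0" by linarith
      ultimately have "(real q + 1) * (e / (real q + 1)) = e" "e / (real q + 1) > 0" by auto
      then show "width_rate \<epsilon>' \<le> real w / (real L)\<^sup>2 + e"
        using est[of "e / (real q + 1)"] by simp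
    qed
    then show ?thesis by (simp add: w_def add_ac)
  qed
  have "(\<lambda>L. 1 / real L * (1 / real L)) \<longlonglongrightarrow> 0 * 0"
    by (intro tendsto_mult lim_1_over_n)
  then have "(\<lambda>L. real (Y.width \<epsilon> L) / (real L)\<^sup>2 + (real c + 2) * (1 / real L * (1 / real L))) \<longlonglongrightarrow>
      Y.width_rate \<epsilon> + (real c + 2) * (0 * 0)"
    by (intro tendsto_add Y.width_tendsto \<epsilon> tendsto_mult[OF tendsto_const])
  then have "(\<lambda>L. (real (Y.width \<epsilon> L) + (real c + 2)) / (real L)\<^sup>2) \<longlonglongrightarrow> Y.width_rate \<epsilon>"
    by (simp add: add_divide_distrib power2_eq_square)
  then show ?thesis
    by (rule LIMSEQ_le_const) (intro exI[of _ 1] allI impI bound)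
qed

theorem mean_dim_sparse_complement:
  assumes Y: "closedin mtopology Y" "\<And>a x. x \<in> Y \<Longrightarrow> act a x \<in> Y"
    and C: "closedin mtopology C" "\<And>a x. x \<in> C \<Longrightarrow> act a x = x"
    and sparse: "\<And>K \<delta>. \<lbrakk>closedin mtopology K; K \<inter> (Y \<union> C) = {}; \<delta> > 0\<rbrakk> \<Longrightarrow>
      \<exists>n0. \<forall>n\<ge>n0. \<forall>x\<in>M. real (visits n x K)
        \<le> \<delta> * (real n)\<^sup>2"
  shows "mean_dim mtopology act = mean_dim (subtopology mtopology Y) act"
proof -
  have eq: "(SUP \<epsilon>\<in>{0<..}. ereal (compact_action.width_rate Y d act \<epsilon>)) = (SUP \<epsilon>\<in>{0<..}. ereal (width_rate \<epsilon>))"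
  proof (rule antisym; rule SUP_mono)
    fix \<epsilon> :: real assume \<epsilon>: "\<epsilon> \<in> {0<..}"
    then have "compact_action.width_rate Y d act \<epsilon> \<le> width_rate \<epsilon>"
      by (intro width_rate_subset[OF Y]) simp_all
    then show "\<exists>\<delta>\<in>{0<..}. ereal (compact_action.width_rate Y d act \<epsilon>) \<le> ereal (width_rate \<delta>)"
      by (intro bexI[OF _ \<epsilon>]) simp
  next
    fix \<epsilon> :: real assume "\<epsilon> \<in> {0<..}"
    then have \<epsilon>: "0 < \<epsilon> / 2" "\<epsilon> / 2 < \<epsilon>" "\<epsilon> / 2 \<in> {0<..}" by simp_all
    have "width_rate \<epsilon> \<le> compact_action.width_rate Y d act (\<epsilon> / 2)"
      by (rule width_rate_sparse_complement[OF Y C sparse \<epsilon>(1,2)])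
    then show "\<exists>\<delta>\<in>{0<..}. ereal (width_rate \<epsilon>) \<le> ereal (compact_action.width_rate Y d act \<delta>)"
      by (intro bexI[OF _ \<epsilon>(3)]) simp
  qed
  have YM: "Y \<subseteq> M" using closedin_subset[OF Y(1)] by simp
  have "mean_dim (subtopology mtopology Y) act = (SUP \<epsilon>\<in>{0<..}. ereal (compact_action.width_rate Y d act \<epsilon>))"
    using compact_action.mean_dim_eq[OF compact_action_subset[OF Y]] unfolding mtopology_subset(2)[OF YM] .
  then show ?thesis unfolding mean_dim_eq eq by (rule sym)
qed

end

section \<open>Actions with an energy density\<close>

lemma integrable_on_compact:
  fixes g :: "'a::euclidean_space \<Rightarrow> real"
  assumes "continuous_on S g" "compact S"
  shows "g integrable_on S"
  using borel_integrable_compact[OF assms(2,1)] set_borel_integral_eq_integral(1)[of S g]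
  by (simp add: set_integrable_def)

lemma integral_cball_const: "r \<ge> 0 \<Longrightarrow> integral (cball c r) (\<lambda>_. k) = k * (pi * r\<^sup>2)" for c :: complex and k :: real
proof -
  assume r: "r \<ge> 0"
  have "integral (cball c r) (\<lambda>_. k) = k * integral (cball c r) (\<lambda>_. 1)"
    using integral_mult_right[of "cball c r" k "\<lambda>_. 1"] by simp
  also have "integral (cball c r) (\<lambda>_. 1) = measure lborel (cball c r)"
    by (subst lmeasure_integral[symmetric]) auto
  finally show ?thesis using r by (simp add: content_cball unit_ball_vol_2)
qed

lemma integral_cball_shift:
  fixes g :: "complex \<Rightarrow> real"
  shows "integral (cball 0 r) (\<lambda>b. g (b + a)) = integral (cball a r) g"
proof -
  define F where "F z = (if z \<in> cball a r then g z else 0)" for z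
  obtain s where s: "cball 0 r \<subseteq> cbox (-s) (s::complex)"
    using bounded_subset_cbox_symmetric[OF bounded_cball] by blast
  have "cball a r \<subseteq> cbox (-s + a) (s + a)"
  proof
    fix z assume "z \<in> cball a r"
    then have "z - a \<in> cbox (-s) s" using s by (auto simp: dist_norm norm_minus_commute)
    then show "z \<in> cbox (-s + a) (s + a)" by (auto simp: in_cbox_complex_iff)
  qed
  then have "integral (cball a r) g = integral (cbox (-s + a) (s + a)) F"
    unfolding F_def by (simp only: integral_restrict_Int Int_absorb2)
  also have "\<dots> = integral (cbox (-s) s) (F \<circ> (+) a)"
    by (rule integral_shift_cbox_plus[symmetric])
  also have "F \<circ> (+) a = (\<lambda>b. if b \<in> cball 0 r then g (b + a) else 0)"
    by (auto simp: F_def fun_eq_iff dist_norm add.commute)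
  also have "integral (cbox (-s) s) \<dots> = integral (cball 0 r) (\<lambda>b. g (b + a))"
    using s by (simp only: integral_restrict_Int Int_absorb2)
  finally show ?thesis by simp
qed

lemma card_nat_near: "finite {i::nat. \<bar>real i - t\<bar> \<le> real \<rho>}" "card {i::nat. \<bar>real i - t\<bar> \<le> real \<rho>} \<le> 2 * \<rho> + 1"
proof -
  let ?I = "{i::nat. \<bar>real i - t\<bar> \<le> real \<rho>}"
  have "?I \<subseteq> {..nat \<lceil>t + real \<rho>\<rceil>}"
    by (auto simp: abs_le_iff; linarith)
  then show fin: "finite ?I" by (rule finite_subset) simp
  show "card ?I \<le> 2 * \<rho> + 1"
  proof (cases "?I = {}")
    case True
    show ?thesis unfolding True card.empty by simp
  next
    case False
    have "Min ?I \<in> ?I" using Min_in[OF fin False] .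
    then have "?I \<subseteq> {Min ?I..Min ?I + 2 * \<rho>}"
      using Min_le[OF fin] by (auto simp: abs_le_iff; linarith)
    then have "card ?I \<le> card {Min ?I..Min ?I + 2 * \<rho>}" by (intro card_mono) simp_all
    then show ?thesis by simp
  qed
qed

lemma card_lattice_near:
  fixes z :: complex
  shows "card {(i, j). i < n \<and> j < n \<and> dist (Complex (real i) (real j)) z \<le> real \<rho>} \<le> (2 * \<rho> + 1)\<^sup>2"
proof -
  let ?I = "{i::nat. \<bar>real i - Re z\<bar> \<le> real \<rho>}" and ?J = "{j::nat. \<bar>real j - Im z\<bar> \<le> real \<rho>}"
  have "{(i, j). i < n \<and> j < n \<and> dist (Complex (real i) (real j)) z \<le> real \<rho>} \<subseteq> ?I \<times> ?J"
  proof clarify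
    fix i j assume le: "dist (Complex (real i) (real j)) z \<le> real \<rho>"
    have "\<bar>Re (Complex (real i) (real j) - z)\<bar> \<le> real \<rho>" "\<bar>Im (Complex (real i) (real j) - z)\<bar> \<le> real \<rho>"
      using order_trans[OF abs_Re_le_cmod le[unfolded dist_norm]] order_trans[OF abs_Im_le_cmod le[unfolded dist_norm]] .
    then show "i \<in> ?I \<and> j \<in> ?J" by simp
  qed
  then have "card {(i, j). i < n \<and> j < n \<and> dist (Complex (real i) (real j)) z \<le> real \<rho>} \<le> card (?I \<times> ?J)"
    by (rule card_mono[rotated]) (intro finite_cartesian_product card_nat_near)
  also have "\<dots> \<le> (2 * \<rho> + 1)\<^sup>2"
    unfolding card_cartesian_product power2_eq_square by (intro mult_le_mono card_nat_near)
  finally show ?thesis .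
qed

text \<open>A point of the plane lies in at most \<open>(2 * \<rho> + 1)^2\<close> discs of radius
  \<rho> around lattice points, which bounds the overlap of the summands.\<close>

lemma sum_integral_lattice_le:
  fixes g :: "complex \<Rightarrow> real"
  assumes g: "continuous_on UNIV g" "\<And>z. 0 \<le> g z"
    and B: "B \<subseteq> {..<n} \<times> {..<n}"
    and sub: "\<And>i j. (i, j) \<in> B \<Longrightarrow> cball (Complex (real i) (real j)) (real \<rho>) \<subseteq> cball c s"
  shows "(\<Sum>(i, j)\<in>B. integral (cball (Complex (real i) (real j)) (real \<rho>)) g)
    \<le> real ((2 * \<rho> + 1)\<^sup>2) * integral (cball c s) g"
proof -
  let ?p = "\<lambda>b. Complex (real (fst b)) (real (snd b))"
  have finB: "finite B" using B by (rule finite_subset) simp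
  have gi: "g integrable_on cball a r" for a r
    by (rule integrable_on_compact) (auto intro: continuous_on_subset[OF g(1)])
  define h where "h b z = (if z \<in> cball (?p b) (real \<rho>) then g z else 0)" for b z
  have hi: "h b integrable_on cball c s"
    and h_integral: "integral (cball c s) (h b) = integral (cball (?p b) (real \<rho>)) g" if "b \<in> B" for b
  proof -
    have "cball (?p b) (real \<rho>) \<inter> cball c s = cball (?p b) (real \<rho>)"
      using sub[of "fst b" "snd b"] that by (intro Int_absorb2) simp
    then show "h b integrable_on cball c s" "integral (cball c s) (h b) = integral (cball (?p b) (real \<rho>)) g"
      using gi unfolding h_def by (simp_all only: integrable_restrict_Int integral_restrict_Int)
  qed
  have "(\<Sum>(i, j)\<in>B. integral (cball (Complex (real i) (real j)) (real \<rho>)) g) = (\<Sum>b\<in>B. integral (cball c s) (h b))"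
    by (rule sum.cong[OF refl]) (simp only: h_integral split_beta)
  also have "\<dots> = integral (cball c s) (\<lambda>z. \<Sum>b\<in>B. h b z)"
    by (rule integral_sum[OF finB hi, symmetric])
  also have "\<dots> \<le> integral (cball c s) (\<lambda>z. real ((2 * \<rho> + 1)\<^sup>2) * g z)"
  proof (rule integral_le)
    show "(\<lambda>z. \<Sum>b\<in>B. h b z) integrable_on cball c s"
      by (rule integrable_sum[OF finB hi])
    show "(\<lambda>z. real ((2 * \<rho> + 1)\<^sup>2) * g z) integrable_on cball c s"
      by (rule integrable_on_mult_right[OF gi])
    fix z
    have "(\<Sum>b\<in>B. h b z) = real (card {b\<in>B. z \<in> cball (?p b) (real \<rho>)}) * g z"
      unfolding h_def sum.inter_filter[OF finB, symmetric] by (rule sum_constant)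
    also have "\<dots> \<le> real ((2 * \<rho> + 1)\<^sup>2) * g z"
    proof (intro mult_right_mono of_nat_mono g(2))
      have "card {b\<in>B. z \<in> cball (?p b) (real \<rho>)} \<le> card {(i, j). i < n \<and> j < n \<and> dist (Complex (real i) (real j)) z \<le> real \<rho>}"
      proof (rule card_mono)
        show "finite {(i, j). i < n \<and> j < n \<and> dist (Complex (real i) (real j)) z \<le> real \<rho>}"
          by (rule finite_subset[of _ "{..<n} \<times> {..<n}"]) auto
      qed (use B in auto)
      then show "card {b\<in>B. z \<in> cball (?p b) (real \<rho>)} \<le> (2 * \<rho> + 1)\<^sup>2"
        using card_lattice_near by (rule order_trans)
    qed
    finally show "(\<Sum>b\<in>B. h b z) \<le> real ((2 * \<rho> + 1)\<^sup>2) * g z" .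
  qed
  also have "\<dots> = real ((2 * \<rho> + 1)\<^sup>2) * integral (cball c s) g"
    by (rule integral_mult_right)
  finally show ?thesis .
qed

text \<open>All the discs lie in the square enlarged by \<open>R\<close> on each side, and
  disjointness makes their areas add up.\<close>

lemma disjoint_cballs_area:
  fixes p :: "'b \<Rightarrow> complex"
  assumes "finite C" "pairwise (\<lambda>i j. disjnt (cball (p i) (r i)) (cball (p j) (r j))) C"
    and r: "\<And>i. i \<in> C \<Longrightarrow> 0 < r i \<and> r i \<le> R"
    and p: "\<And>i. i \<in> C \<Longrightarrow> 0 \<le> Re (p i) \<and> Re (p i) \<le> l \<and> 0 \<le> Im (p i) \<and> Im (p i) \<le> l"
    and l: "0 \<le> l" "0 \<le> R"
  shows "(\<Sum>i\<in>C. pi * (r i)\<^sup>2) \<le> (l + 2 * R)\<^sup>2"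
proof -
  have "(\<Sum>i\<in>C. pi * (r i)\<^sup>2) = (\<Sum>i\<in>C. measure lborel (cball (p i) (r i)))"
    using r by (intro sum.cong refl) (auto simp: content_cball unit_ball_vol_2 less_imp_le)
  also have "\<dots> = measure lborel (\<Union>i\<in>C. cball (p i) (r i))"
  proof (rule measure_finite_Union[symmetric])
    show "disjoint_family_on (\<lambda>i. cball (p i) (r i)) C"
      using assms(2) by (auto simp: disjoint_family_on_def pairwise_def disjnt_def)
    show "emeasure lborel (cball (p i) (r i)) \<noteq> \<infinity>" for i
      using emeasure_bounded_finite[OF bounded_cball, of "p i" "r i"] by simp
  qed (use assms(1) in auto)
  also have "\<dots> \<le> measure lborel (cbox (Complex (-R) (-R)) (Complex (l + R) (l + R)))"
  proof (rule measure_mono_fmeasurable)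
    show "(\<Union>i\<in>C. cball (p i) (r i)) \<subseteq> cbox (Complex (-R) (-R)) (Complex (l + R) (l + R))"
    proof
      fix z assume "z \<in> (\<Union>i\<in>C. cball (p i) (r i))"
      then obtain i where i: "i \<in> C" "cmod (p i - z) \<le> r i" by (auto simp: dist_norm)
      then have "\<bar>Re (p i) - Re z\<bar> \<le> R" "\<bar>Im (p i) - Im z\<bar> \<le> R"
        using abs_Re_le_cmod[of "p i - z"] abs_Im_le_cmod[of "p i - z"] r[OF i(1)] by auto
      then show "z \<in> cbox (Complex (-R) (-R)) (Complex (l + R) (l + R))"
        using p[OF i(1)] by (auto simp: in_cbox_complex_iff)
    qed
  qed (use assms(1) in auto)
  also have "\<dots> = (l + 2 * R)\<^sup>2"
    using l by (subst content_cbox) (auto simp: Basis_complex_def power2_eq_square algebra_simps)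
  finally show ?thesis .
qed

text \<open>\<open>E\<close> stands for the energy density of a curve at the origin, so that
  \<open>E (act a x)\<close> is its density at \<open>a\<close>. The bound by 1 is the Brody
  condition.\<close>

locale energy_action = compact_action +
  fixes E :: "'a \<Rightarrow> real"
  assumes continuous_energy: "continuous_map mtopology euclideanreal E"
    and energy_nonneg: "x \<in> M \<Longrightarrow> 0 \<le> E x"
    and energy_le_1: "x \<in> M \<Longrightarrow> E x \<le> 1"
    and continuous_energy_orbit: "x \<in> M \<Longrightarrow> continuous_on UNIV (\<lambda>a. E (act a x))"
begin

section \<open>Energy in discs and mean energy\<close>

definition disc_energy :: "real \<Rightarrow> 'a \<Rightarrow> real" where
  "disc_energy r x = integral (cball 0 r) (\<lambda>a. E (act a x))"

definition orbit_mean_energy :: "'a \<Rightarrow> ereal" where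
  "orbit_mean_energy x = Limsup at_top (\<lambda>r::real. ereal (2 / (pi * r\<^sup>2) * integral {1..r} (\<lambda>t. 1 / t * disc_energy t x)))"

lemma orbit_integrable: "x \<in> M \<Longrightarrow> (\<lambda>a. E (act a x)) integrable_on cball c r"
  by (rule integrable_on_compact) (auto intro: continuous_on_subset[OF continuous_energy_orbit])

lemma orbit_energy: "x \<in> M \<Longrightarrow> 0 \<le> E (act a x)" "x \<in> M \<Longrightarrow> E (act a x) \<le> 1"
  using energy_nonneg energy_le_1 act_closed by auto

lemma disc_energy_act: "x \<in> M \<Longrightarrow> disc_energy r (act a x) = integral (cball a r) (\<lambda>z. E (act z x))"
  unfolding disc_energy_def by (subst integral_cball_shift[symmetric]) (simp add: act_add)

lemma disc_energy_nonneg: "x \<in> M \<Longrightarrow> 0 \<le> disc_energy r x"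
  unfolding disc_energy_def by (intro integral_nonneg orbit_integrable orbit_energy)

lemma disc_energy_mono: "\<lbrakk>x \<in> M; r \<le> s\<rbrakk> \<Longrightarrow> disc_energy r x \<le> disc_energy s x"
  unfolding disc_energy_def by (intro integral_subset_le orbit_integrable) (auto simp: orbit_energy)

lemma disc_energy_act_le: "x \<in> M \<Longrightarrow> disc_energy r (act a x) \<le> disc_energy (r + cmod a) x"
  unfolding disc_energy_act unfolding disc_energy_def
  by (intro integral_subset_le orbit_integrable) (auto simp: orbit_energy cball_subset_cball_iff)

text \<open>Since \<open>1 - E\<close> is nonnegative as well, the energy in an annulus is at most
  its area.\<close>

lemma disc_energy_lipschitz:
  assumes "x \<in> M" "0 \<le> r" "r \<le> s"
  shows "disc_energy s x - disc_energy r x \<le> pi * s\<^sup>2 - pi * r\<^sup>2"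
proof -
  have "integral (cball 0 r) (\<lambda>a. 1 - E (act a x)) \<le> integral (cball 0 s) (\<lambda>a. 1 - E (act a x))"
    using assms by (intro integral_subset_le integrable_diff orbit_integrable integrable_on_compact)
      (auto simp: orbit_energy)
  moreover have "integral (cball 0 t) (\<lambda>a. 1 - E (act a x)) = pi * t\<^sup>2 - disc_energy t x" if "t \<ge> 0" for t
    unfolding disc_energy_def using integral_cball_const[OF that, of 0 1]
    by (subst integral_diff) (auto intro: orbit_integrable assms integrable_on_compact)
  ultimately show ?thesis using assms by simp
qed

lemma continuous_disc_energy_radius:
  assumes "x \<in> M"
  shows "continuous_on {0..} (\<lambda>r. disc_energy r x)"
  unfolding continuous_on_def
proof
  fix r :: real assume "r \<in> {0..}"
  have le: "\<bar>disc_energy s x - disc_energy r x\<bar> \<le> \<bar>pi * s\<^sup>2 - pi * r\<^sup>2\<bar>" if "s \<ge> 0" for s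
    using disc_energy_lipschitz[OF assms, of r s] disc_energy_lipschitz[OF assms, of s r]
      disc_energy_mono[OF assms, of r s] disc_energy_mono[OF assms, of s r] that \<open>r \<in> {0..}\<close>
    by (cases "r \<le> s") auto
  have "((\<lambda>s. \<bar>pi * s\<^sup>2 - pi * r\<^sup>2\<bar>) \<longlongrightarrow> \<bar>pi * r\<^sup>2 - pi * r\<^sup>2\<bar>) (at r within {0..})"
    by (intro tendsto_intros)
  then have "((\<lambda>s. \<bar>pi * s\<^sup>2 - pi * r\<^sup>2\<bar>) \<longlongrightarrow> 0) (at r within {0..})" by simp
  then have "((\<lambda>s. disc_energy s x - disc_energy r x) \<longlongrightarrow> 0) (at r within {0..})"
  proof (rule Lim_null_comparison[where g = "\<lambda>s. \<bar>pi * s\<^sup>2 - pi * r\<^sup>2\<bar>", rotated])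
    have "\<forall>\<^sub>F s in at r within {0..}. s \<in> {0..}" by (simp add: eventually_at_filter)
    then show "\<forall>\<^sub>F s in at r within {0..}. norm (disc_energy s x - disc_energy r x) \<le> \<bar>pi * s\<^sup>2 - pi * r\<^sup>2\<bar>"
      by (rule eventually_mono) (use le in simp)
  qed
  then show "((\<lambda>s. disc_energy s x) \<longlongrightarrow> disc_energy r x) (at r within {0..})"
    by (rule LIM_zero_cancel)
qed

lemma log_integrable:
  assumes "x \<in> M" "1 \<le> a"
  shows "(\<lambda>t. 1 / t * disc_energy t x) integrable_on {a..b}"
  using assms continuous_on_subset[OF continuous_disc_energy_radius[OF assms(1)], of "{a..b}"]
  by (intro integrable_continuous_real continuous_intros) auto

text \<open>The logarithmic average in the mean energy and the plain average over discs vanish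
  together. In one direction the radii between \<open>r\<close> and \<open>2 * r\<close> alone
  contribute at least half of the energy in the disc of radius \<open>r\<close>; in the other,
  energy at most \<open>e * t^2\<close> for large \<open>t\<close> integrates against
  \<open>1 / t\<close> to a multiple of \<open>e * r^2\<close>.\<close>

lemma mean_energy_pos_iff:
  assumes x: "x \<in> M"
  shows "\<not> orbit_mean_energy x > 0 \<longleftrightarrow> ((\<lambda>r. disc_energy r x / r\<^sup>2) \<longlongrightarrow> 0) at_top"
proof
  assume "\<not> orbit_mean_energy x > 0"
  then have le: "orbit_mean_energy x \<le> 0" by simp
  have half: "disc_energy r x / 2 \<le> integral {1..2 * r} (\<lambda>t. 1 / t * disc_energy t x)" if "1 \<le> r" for r
  proof -
    have "disc_energy r x / 2 = integral {r..2 * r} (\<lambda>t. 1 / (2 * r) * disc_energy r x)"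
      using that by simp
    also have "\<dots> \<le> integral {r..2 * r} (\<lambda>t. 1 / t * disc_energy t x)"
      using that by (intro integral_le log_integrable x integrable_const_ivl mult_mono disc_energy_mono
        disc_energy_nonneg) (auto simp: field_simps)
    also have "\<dots> \<le> integral {1..2 * r} (\<lambda>t. 1 / t * disc_energy t x)"
      using that by (intro integral_subset_le log_integrable x) (auto simp: disc_energy_nonneg x)
    finally show ?thesis .
  qed
  show "((\<lambda>r. disc_energy r x / r\<^sup>2) \<longlongrightarrow> 0) at_top"
  proof (rule tendstoI)
    fix e :: real assume e: "e > 0"
    \<comment> \<open>At radius \<open>2 * r\<close> the factor \<open>2 / (pi * (2 * r)^2)\<close>
      times half the disc energy is the disc energy divided by \<open>4 * pi * r^2\<close>.\<close>
    have "orbit_mean_energy x < ereal (e / (4 * pi))" using le e by (auto intro: le_less_trans)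
    from Limsup_lessD[OF this[unfolded orbit_mean_energy_def]]
    have "\<forall>\<^sub>F r in at_top. 2 / (pi * r\<^sup>2) * integral {1..r} (\<lambda>t. 1 / t * disc_energy t x) < e / (4 * pi)"
      by simp
    moreover have "filterlim (\<lambda>r::real. 2 * r) at_top at_top"
      by (rule filterlim_tendsto_pos_mult_at_top[OF tendsto_const]) (auto intro: filterlim_ident)
    ultimately have "\<forall>\<^sub>F r in at_top. 2 / (pi * (2 * r)\<^sup>2) * integral {1..2 * r} (\<lambda>t. 1 / t * disc_energy t x) < e / (4 * pi)"
      by (rule eventually_compose_filterlim)
    then show "\<forall>\<^sub>F r in at_top. dist (disc_energy r x / r\<^sup>2) 0 < e"
      using eventually_ge_at_top[of 1]
    proof eventually_elim
      case (elim r)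
      have "disc_energy r x / 2 * (2 / (pi * (2 * r)\<^sup>2)) \<le> integral {1..2 * r} (\<lambda>t. 1 / t * disc_energy t x) * (2 / (pi * (2 * r)\<^sup>2))"
        by (intro mult_right_mono half elim) simp
      also have "\<dots> < e / (4 * pi)" using elim(1) by (simp only: mult.commute)
      finally have less: "disc_energy r x / r\<^sup>2 / (4 * pi) < e / (4 * pi)"
        by (simp add: power2_eq_square field_simps)
      have "disc_energy r x / r\<^sup>2 < e"
        using less[unfolded divide_less_cancel] by simp
      then show ?case using disc_energy_nonneg[OF x, of r] by simp
    qed
  qed
next
  assume lim: "((\<lambda>r. disc_energy r x / r\<^sup>2) \<longlongrightarrow> 0) at_top"
  have "orbit_mean_energy x \<le> 0"
    unfolding orbit_mean_energy_def Limsup_le_iff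
  proof (intro allI impI)
    fix y :: ereal assume "0 < y"
    then obtain e where e: "0 < e" "ereal e < y"
      by (metis ereal_dense2 less_ereal.simps(1) zero_ereal_def)
    have "\<forall>\<^sub>F r in at_top. disc_energy r x / r\<^sup>2 < e"
      using order_tendstoD(2)[OF lim e(1)] .
    then obtain r0 where r0: "\<And>r. r \<ge> r0 \<Longrightarrow> disc_energy r x / r\<^sup>2 < e"
      by (auto simp: eventually_at_top_linorder)
    define t0 where "t0 = max 1 r0"
    have t0: "1 \<le> t0" "r0 \<le> t0" by (auto simp: t0_def)
    \<comment> \<open>The early radii, where no smallness is known, contribute a constant that is
      divided by the growing area.\<close>
    define I where "I = integral {1..t0} (\<lambda>t. 1 / t * disc_energy t x)"
    have bound: "integral {1..r} (\<lambda>t. 1 / t * disc_energy t x) \<le> I + e * r\<^sup>2" if "r \<ge> t0" for r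
    proof -
      have "integral {t0..r} (\<lambda>t. 1 / t * disc_energy t x) \<le> integral {t0..r} (\<lambda>t. e * r)"
      proof (intro integral_le log_integrable x t0 integrable_const_ivl)
        fix t assume t: "t \<in> {t0..r}"
        then have "disc_energy t x < e * t\<^sup>2" using r0[of t] t0 by (simp add: field_simps)
        then have "1 / t * disc_energy t x \<le> e * t" using t t0 by (simp add: field_simps power2_eq_square)
        also have "\<dots> \<le> e * r" using t e by simp
        finally show "1 / t * disc_energy t x \<le> e * r" .
      qed
      also have "\<dots> = e * r * (r - t0)" using that by (simp add: algebra_simps)
      also have "\<dots> \<le> e * r * r" using e that t0 by (intro mult_left_mono) auto
      finally have "integral {t0..r} (\<lambda>t. 1 / t * disc_energy t x) \<le> e * r\<^sup>2"
        by (simp add: power2_eq_square mult.assoc)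
      moreover have "I + integral {t0..r} (\<lambda>t. 1 / t * disc_energy t x) = integral {1..r} (\<lambda>t. 1 / t * disc_energy t x)"
        unfolding I_def using that t0 by (intro Henstock_Kurzweil_Integration.integral_combine log_integrable x) auto
      ultimately show ?thesis by simp
    qed
    have "((\<lambda>r. 2 * I / pi * inverse (r\<^sup>2) + 2 * e / pi) \<longlongrightarrow> 2 * I / pi * 0 + 2 * e / pi) at_top"
      by (intro tendsto_intros tendsto_inverse_0_at_top filterlim_pow_at_top filterlim_ident) simp
    moreover have "2 * I / pi * 0 + 2 * e / pi < e" using e pi_gt3 by (simp add: field_simps)
    ultimately have "\<forall>\<^sub>F r in at_top. 2 * I / pi * inverse (r\<^sup>2) + 2 * e / pi < e"
      by (rule order_tendstoD)
    then show "\<forall>\<^sub>F r in at_top. ereal (2 / (pi * r\<^sup>2) * integral {1..r} (\<lambda>t. 1 / t * disc_energy t x)) < y"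
      using eventually_ge_at_top[of t0]
    proof eventually_elim
      case (elim r)
      have "2 / (pi * r\<^sup>2) * integral {1..r} (\<lambda>t. 1 / t * disc_energy t x) \<le> 2 / (pi * r\<^sup>2) * (I + e * r\<^sup>2)"
        by (intro mult_left_mono bound elim) auto
      also have "\<dots> = 2 * I / pi * inverse (r\<^sup>2) + 2 * e / pi"
        using elim t0 by (simp add: field_simps)
      finally show ?case using elim(1) e(2) by (meson ereal_less(2) le_less_trans less_ereal.simps(1) less_trans)
    qed
  qed
  then show "\<not> orbit_mean_energy x > 0" by simp
qed

text \<open>The disc of radius \<open>r\<close> about \<open>a\<close> lies in the disc of radius
  \<open>r + cmod a\<close> about 0, whose area is at most 4 times larger once \<open>r\<close> is
  at least \<open>cmod a\<close>. The reverse implication is the same statement for the inverse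
  time.\<close>

lemma mean_energy_act_pos:
  assumes x: "x \<in> M" and "orbit_mean_energy (act a x) > 0"
  shows "orbit_mean_energy x > 0"
proof (rule ccontr)
  assume "\<not> orbit_mean_energy x > 0"
  then have lim: "((\<lambda>r. disc_energy r x / r\<^sup>2) \<longlongrightarrow> 0) at_top"
    using mean_energy_pos_iff[OF x] by simp
  have "filterlim (\<lambda>r. r + cmod a) at_top at_top"
    by (subst add.commute) (rule filterlim_tendsto_add_at_top[OF tendsto_const filterlim_ident])
  from filterlim_compose[OF lim this]
  have "((\<lambda>r. disc_energy (r + cmod a) x / (r + cmod a)\<^sup>2 * 4) \<longlongrightarrow> 0 * 4) at_top"
    by (intro tendsto_mult tendsto_const)
  then have upper: "((\<lambda>r. disc_energy (r + cmod a) x / (r + cmod a)\<^sup>2 * 4) \<longlongrightarrow> 0) at_top"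
    unfolding mult_zero_left .
  have "((\<lambda>r. disc_energy r (act a x) / r\<^sup>2) \<longlongrightarrow> 0) at_top"
  proof (rule tendsto_sandwich[OF _ _ tendsto_const upper])
    show "\<forall>\<^sub>F r in at_top. 0 \<le> disc_energy r (act a x) / r\<^sup>2"
      using disc_energy_nonneg act_closed x by (intro always_eventually) simp
    show "\<forall>\<^sub>F r in at_top. disc_energy r (act a x) / r\<^sup>2 \<le> disc_energy (r + cmod a) x / (r + cmod a)\<^sup>2 * 4"
      using eventually_ge_at_top[of "max 1 (cmod a)"]
    proof eventually_elim
      case (elim r)
      have "(r + cmod a)\<^sup>2 \<le> (2 * r)\<^sup>2" using elim by (intro power_mono) auto
      moreover have "0 < (r + cmod a)\<^sup>2"
        using elim norm_ge_zero[of a] by (intro zero_less_power) linarith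
      ultimately have "inverse ((2 * r)\<^sup>2) \<le> inverse ((r + cmod a)\<^sup>2)"
        by (rule le_imp_inverse_le)
      have "disc_energy r (act a x) / r\<^sup>2 \<le> disc_energy (r + cmod a) x / r\<^sup>2"
        by (intro divide_right_mono disc_energy_act_le x) simp
      also have "\<dots> = disc_energy (r + cmod a) x * inverse ((2 * r)\<^sup>2) * 4"
        by (simp add: power_mult_distrib field_simps)
      also have "\<dots> \<le> disc_energy (r + cmod a) x * inverse ((r + cmod a)\<^sup>2) * 4"
        by (intro mult_right_mono mult_left_mono disc_energy_nonneg x) (fact | simp)+
      finally show ?case by (simp add: divide_inverse)
    qed
  qed
  then show False using mean_energy_pos_iff[OF act_closed[OF x]] assms(2) by blast
qed

text \<open>\<open>E\<close> is uniformly continuous by compactness and the times in the disc act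
  equicontinuously, so the integrands of nearby points are uniformly close.\<close>

lemma continuous_disc_energy:
  "continuous_map mtopology euclideanreal (disc_energy r)"
proof (cases "r \<ge> 0")
  case False
  then have "disc_energy r = (\<lambda>x. 0)" by (auto simp: disc_energy_def)
  then show ?thesis by simp
next
  case True
  have "uniformly_continuous_map Self euclidean_metric E"
    using continuous_imp_uniformly_continuous_map[of Self euclidean_metric E] continuous_energy compact
    by (simp add: mtopology_of_def)
  then have unif: "\<exists>\<delta>>0. \<forall>x\<in>M. \<forall>y\<in>M. d x y < \<delta> \<longrightarrow> \<bar>E x - E y\<bar> < e" if "e > 0" for e
    using that unfolding uniformly_continuous_map_def by (simp add: dist_real_def commute abs_minus_commute)
  have "\<exists>\<delta>>0. \<forall>y. y \<in> M \<and> d x y < \<delta> \<longrightarrow> \<bar>disc_energy r x - disc_energy r y\<bar> < e" if x: "x \<in> M" and e: "e > 0" for x e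
  proof -
    define e' where "e' = e / (pi * r\<^sup>2 + 1)"
    have den: "pi * r\<^sup>2 + 1 > 0" by (intro add_nonneg_pos) auto
    then have e': "e' > 0" using e by (simp add: e'_def)
    obtain \<eta> where \<eta>: "\<eta> > 0" "\<And>x y. \<lbrakk>x \<in> M; y \<in> M; d x y < \<eta>\<rbrakk> \<Longrightarrow> \<bar>E x - E y\<bar> < e'"
      using unif[OF e'] by blast
    obtain \<delta> where \<delta>: "\<delta> > 0" "\<And>x y a. \<lbrakk>x \<in> M; y \<in> M; cmod a \<le> r; d x y < \<delta>\<rbrakk> \<Longrightarrow> d (act a x) (act a y) < \<eta>"
      using act_equicontinuous[OF \<eta>(1), of r] by blast
    have "\<bar>disc_energy r x - disc_energy r y\<bar> < e" if y: "y \<in> M" "d x y < \<delta>" for y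
    proof -
      have "\<bar>disc_energy r x - disc_energy r y\<bar> = norm (integral (cball 0 r) (\<lambda>a. E (act a x) - E (act a y)))"
        unfolding disc_energy_def using x y by (subst integral_diff) (auto intro: orbit_integrable)
      also have "\<dots> \<le> integral (cball 0 r) (\<lambda>a::complex. e')"
        using \<eta>(2) \<delta>(2) x y act_closed
        by (intro integral_norm_bound_integral integrable_diff orbit_integrable integrable_on_compact)
          (auto intro!: less_imp_le)
      also have "\<dots> = e' * (pi * r\<^sup>2)" by (rule integral_cball_const[OF True])
      also have "\<dots> < e' * (pi * r\<^sup>2 + 1)" using e' by simp
      also have "\<dots> = e" using den by (simp add: e'_def)
      finally show ?thesis .
    qed
    then show ?thesis using \<delta>(1) by blast
  qed
  then have "continuous_map mtopology (mtopology_of euclidean_metric) (disc_energy r)"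
    unfolding mtopology_of_def mspace_euclidean_metric mdist_euclidean_metric
      metric_continuous_map[OF Met_TC.Metric_space_axioms] by (simp add: dist_real_def)
  then show ?thesis by simp
qed

text \<open>Every point of \<open>K\<close> has a definite amount of energy in the disc of some fixed radius \<open>\<rho>\<close>, but small
  average energy on some much larger disc of radius at most \<open>R\<close>; both by compactness. A Vitali selection
  of these larger discs shows that an orbit meets \<open>K\<close> at few lattice points. This replaces the
  ergodic theorem, and no invariant measure is needed.\<close>

lemma sparse_low_energy:
  assumes K: "closedin mtopology K" "\<And>x. x \<in> K \<Longrightarrow> \<not> orbit_mean_energy x > 0"
    "\<And>x. x \<in> K \<Longrightarrow> \<exists>a. E (act a x) \<noteq> 0" and \<delta>: "\<delta> > 0"
  shows "\<exists>n0. \<forall>n\<ge>n0. \<forall>x\<in>M. real (visits n x K)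
        \<le> \<delta> * (real n)\<^sup>2"
proof -
  have KM: "K \<subseteq> M" using closedin_subset[OF K(1)] by simp
  have cK: "compactin mtopology K" using closedin_compact_space[OF compact K(1)] .
  \<comment> \<open>The form in which compactness is used twice: an integer radius chosen for each
    point of \<open>K\<close> by an open condition can be bounded over all of
    \<open>K\<close>.\<close>
  have cover: "\<exists>R. \<forall>x\<in>K. \<exists>m\<le>R. x \<in> U m" if U: "\<And>m::nat. openin mtopology (U m)" and "K \<subseteq> (\<Union>m. U m)" for U
  proof -
    obtain F where F: "finite F" "F \<subseteq> range U" "K \<subseteq> \<Union>F"
      using compactinD[OF cK, of "range U"] U \<open>K \<subseteq> (\<Union>m. U m)\<close> by auto
    obtain I where I: "finite I" "F = U ` I" using finite_subset_image[OF F(1,2)] by blast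
    obtain R where "I \<subseteq> {..R}" using I(1) finite_nat_iff_bounded_le by blast
    then show ?thesis using F(3) I(2) by (intro exI[of _ R]) blast
  qed
  have opengt: "openin mtopology {x \<in> topspace mtopology. disc_energy r x \<in> {k<..}}" 
   and openlt: "openin mtopology {x \<in> topspace mtopology. disc_energy r x \<in> {..<k}}" for r k
    by (rule openin_continuous_map_preimage[OF continuous_disc_energy], simp)+
  \<comment> \<open>A single index serves as radius and, through its reciprocal, as energy
    threshold, so a countable cover is enough.\<close>
  have pos: "\<exists>m::nat. disc_energy (real m) x > 1 / (real m + 1)" if "x \<in> K" for x
  proof -
    have xM: "x \<in> M" using that KM by blast
    from K(3)[OF that] obtain a where a: "E (act a x) \<noteq> 0" by blast
    then have pos: "E (act a x) > 0" using orbit_energy(1)[OF xM, of a] by simp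
    define k where "k = E (act a x) / 2"
    have k: "0 < k" "k < E (act a x)" using pos by (auto simp: k_def)
    have "open ((\<lambda>z. E (act z x)) -` {k<..})"
      using continuous_energy_orbit[OF xM] by (rule open_vimage[rotated]) simp
    moreover have "a \<in> (\<lambda>z. E (act z x)) -` {k<..}" using k(2) by simp
    ultimately obtain e where e: "e > 0" "cball a e \<subseteq> (\<lambda>z. E (act z x)) -` {k<..}"
      unfolding open_contains_cball by blast
    define s where "s = e + cmod a"
    have s: "s > 0" using e(1) by (auto simp: s_def intro: add_pos_nonneg)
    have "0 < k * (pi * e\<^sup>2)" using k e by simp
    also have "\<dots> = integral (cball a e) (\<lambda>_. k)" using integral_cball_const e(1) by simp
    also have "\<dots> \<le> disc_energy e (act a x)"
      unfolding disc_energy_act[OF xM] using e(2)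
      by (intro integral_le orbit_integrable[OF xM] integrable_on_compact) (auto intro: less_imp_le)
    also have "\<dots> \<le> disc_energy s x"
      unfolding s_def by (rule disc_energy_act_le[OF xM])
    finally have dpos: "disc_energy s x > 0" .
    obtain m where m: "real m \<ge> s + 1 / disc_energy s x" using real_arch_simple by blast
    have "1 / disc_energy s x < real m + 1" using m s by linarith
    then have "1 / (real m + 1) < disc_energy s x" using dpos by (simp add: field_simps)
    also have "\<dots> \<le> disc_energy (real m) x" using m dpos by (intro disc_energy_mono xM) (smt (verit) divide_pos_pos)
    finally show ?thesis by blast
  qed
  have "K \<subseteq> (\<Union>m. {x \<in> topspace mtopology. disc_energy (real m) x \<in> {1 / (real m + 1)<..}})"
    using pos KM by auto
  from cover[OF opengt this] obtain R0 where
    "\<forall>x\<in>K. \<exists>m\<le>R0. x \<in> {x \<in> topspace mtopology. disc_energy (real m) x \<in> {1 / (real m + 1)<..}}"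
    by blast
  then have R0: "\<exists>m\<le>R0. disc_energy (real m) x > 1 / (real m + 1)" if "x \<in> K" for x
    using that by auto
  \<comment> \<open>The summand 1 makes \<rho>, and with it all radii in the Vitali selection,
    positive.\<close>
  define \<rho> where "\<rho> = R0 + 1"
  define c where "c = 1 / (real R0 + 1)"
  have c: "c > 0" "\<And>x. x \<in> K \<Longrightarrow> c \<le> disc_energy (real \<rho>) x"
  proof -
    fix x assume x: "x \<in> K"
    obtain m where m: "m \<le> R0" "disc_energy (real m) x > 1 / (real m + 1)" using R0[OF x] by blast
    have "c \<le> 1 / (real m + 1)" unfolding c_def using m(1) by (intro divide_left_mono) auto
    also have "\<dots> \<le> disc_energy (real m) x" using m by simp
    also have "\<dots> \<le> disc_energy (real \<rho>) x"
      using m(1) by (intro disc_energy_mono[OF subsetD[OF KM x]]) (simp add: \<rho>_def)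
    finally show "c \<le> disc_energy (real \<rho>) x" .
  qed (simp add: c_def)
  define N where "N = real ((2 * \<rho> + 1)\<^sup>2)"
  have N: "N > 0" by (simp add: N_def)
  \<comment> \<open>Chosen so that \<open>N * \<eta> / pi * (2 * real n)^2\<close> equals
    \<open>\<delta> * (real n)^2 * c\<close> at the end.\<close>
  define \<eta> where "\<eta> = \<delta> * c * pi / (4 * N)"
  have \<eta>: "\<eta> > 0" using \<delta> c N by (simp add: \<eta>_def)
  \<comment> \<open>The radius \<open>6 * m\<close> consists of \<open>5 * m\<close> from Vitali's
    lemma and at most \<open>m\<close> for the disc of radius \<rho> around a lattice point; the 36
    below is its square factor.\<close>
  have low: "\<exists>m::nat. m \<ge> \<rho> \<and> disc_energy (6 * real m) x < \<eta> * (real m)\<^sup>2" if "x \<in> K" for x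
  proof -
    have "((\<lambda>r. disc_energy r x / r\<^sup>2) \<longlongrightarrow> 0) at_top"
      using K(2)[OF that] mean_energy_pos_iff KM that by blast
    then have "\<forall>\<^sub>F r in at_top. disc_energy r x / r\<^sup>2 < \<eta> / 36"
      by (rule order_tendstoD) (use \<eta> in simp)
    then obtain r0 where r0: "\<And>r. r \<ge> r0 \<Longrightarrow> disc_energy r x / r\<^sup>2 < \<eta> / 36"
      by (auto simp: eventually_at_top_linorder)
    define m where "m = max \<rho> (nat \<lceil>r0\<rceil>)"
    have m: "m \<ge> \<rho>" "m > 0" "real m \<ge> r0" by (auto simp: m_def \<rho>_def) linarith
    then have "disc_energy (6 * real m) x / (6 * real m)\<^sup>2 < \<eta> / 36" by (intro r0) auto
    then show ?thesis using m by (intro exI[of _ m]) (auto simp: field_simps power2_eq_square)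
  qed
  define U where "U m = (if m \<ge> \<rho> then {x \<in> topspace mtopology. disc_energy (6 * real m) x \<in> {..<\<eta> * (real m)\<^sup>2}} else {})" for m
  have "openin mtopology (U m)" for m using openlt by (simp add: U_def)
  moreover have "K \<subseteq> (\<Union>m. U m)"
  proof
    fix x assume "x \<in> K"
    then obtain m where "m \<ge> \<rho>" "disc_energy (6 * real m) x < \<eta> * (real m)\<^sup>2" using low by blast
    then have "x \<in> U m" using KM \<open>x \<in> K\<close> by (auto simp: U_def)
    then show "x \<in> (\<Union>m. U m)" by blast
  qed
  ultimately obtain R where R: "\<And>x. x \<in> K \<Longrightarrow> \<exists>m\<le>R. x \<in> U m" using cover by meson
  have count: "real (visits n x K) * c
      \<le> N * \<eta> / pi * (real n + 2 * real R)\<^sup>2" if x: "x \<in> M" for x n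
  proof -
    let ?p = "\<lambda>b. Complex (real (fst b)) (real (snd b))"
    define A where "A = {(i, j). i < n \<and> j < n \<and> act (Complex (real i) (real j)) x \<in> K}"
    have A: "A \<subseteq> {..<n} \<times> {..<n}" "\<And>b. b \<in> A \<Longrightarrow> act (?p b) x \<in> K" by (auto simp: A_def)
    have finA: "finite A" using A(1) by (rule finite_subset) simp
    have "\<exists>m. \<rho> \<le> m \<and> m \<le> R \<and> disc_energy (6 * real m) (act (?p b) x) < \<eta> * (real m)\<^sup>2" if "b \<in> A" for b
      using R[OF A(2)[OF that]] by (auto simp: U_def split: if_splits)
    then obtain m where m: "\<And>b. b \<in> A \<Longrightarrow> \<rho> \<le> m b \<and> m b \<le> R \<and> disc_energy (6 * real (m b)) (act (?p b) x) < \<eta> * (real (m b))\<^sup>2"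
      by metis
    have "\<rho> \<ge> 1" by (simp add: \<rho>_def)
    then have mpos: "0 < real (m b) \<and> real (m b) \<le> real R" if "b \<in> A" for b
      using m[OF that] by auto
    have "\<exists>C\<subseteq>A. pairwise (\<lambda>i j. disjnt (cball (?p i) (real (m i))) (cball (?p j) (real (m j)))) C \<and>
        (\<forall>i\<in>A. \<exists>j\<in>C. cball (?p i) (real (m i)) \<subseteq> ball (?p j) (5 * real (m j)))"
    proof (rule Vitali_covering_lemma_cballs_balls[of A "\<lambda>b. real (m b)" "real R" ?p, OF mpos])
      fix C
      assume "C \<subseteq> A" "pairwise (\<lambda>i j. disjnt (cball (?p i) (real (m i))) (cball (?p j) (real (m j)))) C"
        and "\<And>i. i \<in> A \<Longrightarrow> \<exists>j. j \<in> C \<and> \<not> disjnt (cball (?p i) (real (m i))) (cball (?p j) (real (m j))) \<and>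
          cball (?p i) (real (m i)) \<subseteq> ball (?p j) (5 * real (m j))"
      then show ?thesis by (intro exI[of _ C] conjI ballI) (assumption | blast)+
    qed
    then obtain C where C: "C \<subseteq> A"
        "pairwise (\<lambda>i j. disjnt (cball (?p i) (real (m i))) (cball (?p j) (real (m j)))) C"
      and Cball: "\<And>i. i \<in> A \<Longrightarrow> \<exists>j\<in>C. cball (?p i) (real (m i)) \<subseteq> ball (?p j) (5 * real (m j))"
      by blast
    have finC: "finite C" using C(1) finA finite_subset by blast
    define B where "B j = {i\<in>A. ?p i \<in> ball (?p j) (5 * real (m j))}" for j
    have AB: "A \<subseteq> (\<Union>j\<in>C. B j)"
    proof
      fix i assume i: "i \<in> A"
      have c: "?p i \<in> cball (?p i) (real (m i))" by simp
      from Cball[OF i] obtain j where j: "j \<in> C" "cball (?p i) (real (m i)) \<subseteq> ball (?p j) (5 * real (m j))"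
        by blast
      have "i \<in> B j" unfolding B_def using i subsetD[OF j(2) c] by blast
      then show "i \<in> (\<Union>j\<in>C. B j)" using j(1) by blast
    qed
    have finB: "finite (B j)" for j using finA by (simp add: B_def)
    \<comment> \<open>Each lattice time in \<open>B j\<close> carries energy at least
      \<open>c\<close> in its own disc of radius \<rho>, while all these discs lie in one disc of
      small total energy.\<close>
    have part: "real (card (B j)) * c \<le> N * (\<eta> * (real (m j))\<^sup>2)" if j: "j \<in> C" for j
    proof -
      have jA: "j \<in> A" using j C(1) by blast
      have sub: "cball (Complex (real i) (real k)) (real \<rho>) \<subseteq> cball (?p j) (6 * real (m j))" if "(i, k) \<in> B j" for i k
        using that m[OF jA] by (auto simp: B_def cball_subset_cball_iff dist_commute)
      have "real (card (B j)) * c = (\<Sum>b\<in>B j. c)" by simp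
      also have "\<dots> \<le> (\<Sum>b\<in>B j. disc_energy (real \<rho>) (act (?p b) x))"
        using c(2) A(2) by (intro sum_mono) (auto simp: B_def)
      also have "\<dots> = (\<Sum>(i, k)\<in>B j. integral (cball (Complex (real i) (real k)) (real \<rho>)) (\<lambda>z. E (act z x)))"
        by (intro sum.cong refl) (simp add: disc_energy_act x split_beta)
      also have "\<dots> \<le> N * integral (cball (?p j) (6 * real (m j))) (\<lambda>z. E (act z x))"
        unfolding N_def using A(1) sub
        by (intro sum_integral_lattice_le[where n = n] continuous_energy_orbit x orbit_energy) (auto simp: B_def)
      also have "\<dots> \<le> N * (\<eta> * (real (m j))\<^sup>2)"
        using m[OF jA] N by (intro mult_left_mono) (auto simp: disc_energy_act x)
      finally show ?thesis .
    qed
    have "card A \<le> card (\<Union>j\<in>C. B j)" by (intro card_mono AB) (simp add: finC finB)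
    also have "\<dots> \<le> (\<Sum>j\<in>C. card (B j))" by (rule card_UN_le[OF finC])
    finally have "real (card A) * c \<le> (\<Sum>j\<in>C. real (card (B j))) * c"
      using c(1) by (intro mult_right_mono) (simp_all flip: of_nat_sum)
    also have "\<dots> = (\<Sum>j\<in>C. real (card (B j)) * c)" by (rule sum_distrib_right)
    also have "\<dots> \<le> (\<Sum>j\<in>C. N * (\<eta> * (real (m j))\<^sup>2))" by (intro sum_mono part)
    also have "\<dots> = N * \<eta> / pi * (\<Sum>j\<in>C. pi * (real (m j))\<^sup>2)"
      by (simp add: sum_distrib_left mult_ac)
    also have "\<dots> \<le> N * \<eta> / pi * (real n + 2 * real R)\<^sup>2"
    proof (intro mult_left_mono disjoint_cballs_area[where p = ?p])
      fix i assume "i \<in> C"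
      then have "i \<in> A" using C(1) by blast
      then show "0 < real (m i) \<and> real (m i) \<le> real R" by (rule mpos)
      show "0 \<le> Re (?p i) \<and> Re (?p i) \<le> real n \<and> 0 \<le> Im (?p i) \<and> Im (?p i) \<le> real n"
        using A(1) \<open>i \<in> A\<close> by (auto simp: less_imp_le)
    qed (use finC C(2) N \<eta> in auto)
    finally show ?thesis unfolding A_def .
  qed
  have "real (visits n x K) \<le> \<delta> * (real n)\<^sup>2"
    if n: "n \<ge> 2 * R" and x: "x \<in> M" for n x
  proof -
    \<comment> \<open>For such \<open>n\<close> the margin \<open>R\<close> around the square at
      most doubles its side.\<close>
    have "real n + 2 * real R \<le> 2 * real n" using n by linarith
    then have sq: "(real n + 2 * real R)\<^sup>2 \<le> (2 * real n)\<^sup>2" by (intro power_mono) auto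
    have "real (visits n x K) * c
      \<le> N * \<eta> / pi * (real n + 2 * real R)\<^sup>2" by (rule count[OF x])
    also have "\<dots> \<le> N * \<eta> / pi * (2 * real n)\<^sup>2" using sq N \<eta> by (intro mult_left_mono) auto
    also have "\<dots> = \<delta> * (real n)\<^sup>2 * c" using N by (simp add: \<eta>_def power_mult_distrib field_simps)
    finally show ?thesis using c(1) by simp
  qed
  then show ?thesis by blast
qed

text \<open>The fixed part consists of the points whose energy vanishes along the whole orbit. A
  point off this part and off the closure has mean energy 0 but nonzero energy somewhere, exactly
  the situation of \<open>sparse_low_energy\<close>.\<close>

theorem mean_dim_positive_energy:
  assumes const: "\<And>a x. x \<in> M \<Longrightarrow> (\<And>b. E (act b x) = 0) \<Longrightarrow> act a x = x"
  shows "mean_dim mtopology act =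
    mean_dim (subtopology mtopology (mtopology closure_of {x \<in> M. orbit_mean_energy x > 0})) act"
proof (rule mean_dim_sparse_complement)
  let ?P = "{x \<in> M. orbit_mean_energy x > 0}"
  show "closedin mtopology (mtopology closure_of ?P)" by (rule closedin_closure_of)
  show "act a x \<in> mtopology closure_of ?P" if "x \<in> mtopology closure_of ?P" for a x
  proof -
    have "act a x \<in> mtopology closure_of (act a ` ?P)"
      using continuous_map_image_closure_subset[OF continuous_act] that by blast
    moreover have "act a ` ?P \<subseteq> ?P"
    proof clarify
      fix y assume y: "y \<in> M" "orbit_mean_energy y > 0"
      then have "act (-a) (act a y) = y" by (simp add: act_add act_zero)
      then show "act a y \<in> M \<and> orbit_mean_energy (act a y) > 0"
        using mean_energy_act_pos[OF act_closed[OF y(1)], of "-a" a] y act_closed by simp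
    qed
    ultimately show ?thesis using closure_of_mono by blast
  qed
  let ?C = "\<Inter>b. {x \<in> topspace mtopology. E (act b x) \<in> {0}}"
  show "closedin mtopology ?C"
  proof (intro closedin_INT)
    fix b
    have "continuous_map mtopology euclideanreal (E \<circ> act b)"
      by (rule continuous_map_compose[OF continuous_act continuous_energy])
    then show "closedin mtopology {x \<in> topspace mtopology. E (act b x) \<in> {0}}"
      using closedin_continuous_map_preimage[of mtopology euclideanreal "E \<circ> act b" "{0}"] by simp
  qed simp
  show "act a x = x" if "x \<in> ?C" for a x using that const by auto
  fix K \<delta> assume K: "closedin mtopology K" "K \<inter> (mtopology closure_of ?P \<union> ?C) = {}" and "(\<delta>::real) > 0"
  have KM: "K \<subseteq> M" using closedin_subset[OF K(1)] by simp
  have "?P \<subseteq> mtopology closure_of ?P" by (rule closure_of_subset) auto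
  then show "\<exists>n0. \<forall>n\<ge>n0. \<forall>x\<in>M. real (visits n x K)
        \<le> \<delta> * (real n)\<^sup>2"
    using K KM \<open>\<delta> > 0\<close> by (intro sparse_low_energy) auto
qed

end

section \<open>The Fubini-Study geometry of projective space\<close>

text \<open>Twice the squared norm of \<open>v \<and> w\<close>.\<close>

definition minors :: "complex ^ 'n \<Rightarrow> complex ^ 'n \<Rightarrow> real" where
  "minors v w = (\<Sum>i\<in>UNIV. \<Sum>k\<in>UNIV. (cmod (v $ i * w $ k - v $ k * w $ i))\<^sup>2)"

definition hermitian :: "complex ^ 'n \<Rightarrow> complex ^ 'n \<Rightarrow> complex" where
  "hermitian v w = (\<Sum>i\<in>UNIV. v $ i * cnj (w $ i))"

lemma norm_vec_sq: "(norm v)\<^sup>2 = (\<Sum>i\<in>UNIV. (norm (v $ i))\<^sup>2)"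
  unfolding norm_vec_def L2_set_def by (simp add: sum_nonneg)

lemma hermitian_self: "hermitian v v = of_real ((norm v)\<^sup>2)"
  by (simp only: hermitian_def norm_vec_sq of_real_sum complex_norm_square)

lemma norm_vec_smult: "norm (c *s v) = cmod c * norm v" for v :: "complex ^ 'n"
proof -
  have "(norm (c *s v))\<^sup>2 = (cmod c * norm v)\<^sup>2"
    by (simp add: norm_vec_sq norm_mult power_mult_distrib sum_distrib_left)
  then show ?thesis by (simp add: power2_eq_iff_nonneg)
qed

lemma hermitian_mult: "(cmod (hermitian v w))\<^sup>2 = (\<Sum>i\<in>UNIV. \<Sum>k\<in>UNIV. Re (v $ i * cnj (v $ k) * cnj (w $ i) * w $ k))"
proof -
  have "of_real ((cmod (hermitian v w))\<^sup>2) = hermitian v w * cnj (hermitian v w)"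
    by (rule complex_norm_square)
  also have "\<dots> = (\<Sum>i\<in>UNIV. \<Sum>k\<in>UNIV. v $ i * cnj (v $ k) * cnj (w $ i) * w $ k)"
    by (simp add: hermitian_def sum_product mult_ac)
  finally have "Re (of_real ((cmod (hermitian v w))\<^sup>2)) = Re (\<Sum>i\<in>UNIV. \<Sum>k\<in>UNIV. v $ i * cnj (v $ k) * cnj (w $ i) * w $ k)"
    by (rule arg_cong)
  then show ?thesis by simp
qed

lemma cmod_diff_sq: "(cmod (x - y))\<^sup>2 = (cmod x)\<^sup>2 + (cmod y)\<^sup>2 - 2 * Re (x * cnj y)"
  unfolding cmod_power2 by (simp add: power2_eq_square algebra_simps)

lemma sum_sq_mult: "(\<Sum>i\<in>UNIV. \<Sum>k\<in>UNIV. (cmod (v $ i))\<^sup>2 * (cmod (w $ k))\<^sup>2) = (norm v)\<^sup>2 * (norm w)\<^sup>2"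
  by (simp add: norm_vec_sq sum_product)

text \<open>Lagrange's identity by expanding each squared minor; summing over ordered pairs of
  indices produces the factor 2.\<close>

lemma minors_lagrange: "minors v w = 2 * (norm v)\<^sup>2 * (norm w)\<^sup>2 - 2 * (cmod (hermitian v w))\<^sup>2"
proof -
  have "minors v w = (\<Sum>i\<in>UNIV. \<Sum>k\<in>UNIV. (cmod (v $ i))\<^sup>2 * (cmod (w $ k))\<^sup>2 + (cmod (w $ i))\<^sup>2 * (cmod (v $ k))\<^sup>2
      - 2 * Re (v $ i * cnj (v $ k) * cnj (w $ i) * w $ k))"
    unfolding minors_def by (intro sum.cong refl) (simp add: cmod_diff_sq norm_mult power_mult_distrib mult_ac)
  also have "\<dots> = (norm v)\<^sup>2 * (norm w)\<^sup>2 + (norm w)\<^sup>2 * (norm v)\<^sup>2 - 2 * (cmod (hermitian v w))\<^sup>2"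
    by (simp only: sum.distrib sum_subtractf sum_sq_mult hermitian_mult sum_distrib_left)
  finally show ?thesis by simp
qed

lemma minors_nonneg: "0 \<le> minors v w"
  unfolding minors_def by (intro sum_nonneg) simp

text \<open>The minors of \<open>v\<close> with itself vanish. In \<open>speed_limit\<close> this
  converts a distance between two points of a curve into a difference quotient.\<close>

lemma minors_diff: "minors v (w - v) = minors v w"
  by (simp add: minors_def algebra_simps)

lemma minors_smult: "minors v (c *s w) = (cmod c)\<^sup>2 * minors v w"
proof -
  have "v $ i * (c *s w) $ k - v $ k * (c *s w) $ i = c * (v $ i * w $ k - v $ k * w $ i)" for i k
    by (simp add: algebra_simps)
  then show ?thesis by (simp only: minors_def norm_mult power_mult_distrib sum_distrib_left)
qed

text \<open>A line is identified with the orthogonal projection onto it, which embeds projective space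
  isometrically into a space of matrices.\<close>

definition projector :: "complex ^ 'n \<Rightarrow> complex ^ 'n ^ 'n" where
  "projector v = (\<chi> i k. v $ i * cnj (v $ k) / of_real ((norm v)\<^sup>2))"

text \<open>Both sides equal 2 minus twice the squared modulus of the hermitian product of the
  normalised vectors.\<close>

lemma norm_projector_diff:
  assumes "v \<noteq> 0" "w \<noteq> 0"
  shows "(norm (projector v - projector w))\<^sup>2 = minors v w / ((norm v)\<^sup>2 * (norm w)\<^sup>2)"
proof -
  define A where "A = (norm v)\<^sup>2" 
  define B where "B = (norm w)\<^sup>2"
  have AB: "A > 0" "B > 0" using assms by (auto simp: A_def B_def)
  have "(norm (projector v - projector w))\<^sup>2 =
      (\<Sum>i\<in>UNIV. \<Sum>k\<in>UNIV. (cmod (v $ i * cnj (v $ k) / of_real A - w $ i * cnj (w $ k) / of_real B))\<^sup>2)"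
    by (simp add: norm_vec_sq projector_def A_def B_def)
  also have "\<dots> = (\<Sum>i\<in>UNIV. \<Sum>k\<in>UNIV. (cmod (v $ i))\<^sup>2 * (cmod (v $ k))\<^sup>2 * (1 / A\<^sup>2) + (cmod (w $ i))\<^sup>2 * (cmod (w $ k))\<^sup>2 * (1 / B\<^sup>2)
      - Re (v $ i * cnj (v $ k) * cnj (w $ i) * w $ k) * (2 / (A * B)))"
  proof (intro sum.cong refl)
    fix i k
    have "(v $ i * cnj (v $ k) / of_real A) * cnj (w $ i * cnj (w $ k) / of_real B)
        = (v $ i * cnj (v $ k) * cnj (w $ i) * w $ k) / of_real (A * B)" by simp
    then have "Re ((v $ i * cnj (v $ k) / of_real A) * cnj (w $ i * cnj (w $ k) / of_real B))
        = Re (v $ i * cnj (v $ k) * cnj (w $ i) * w $ k) / (A * B)" by (simp only: Re_divide_of_real)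
    then show "(cmod (v $ i * cnj (v $ k) / of_real A - w $ i * cnj (w $ k) / of_real B))\<^sup>2
      = (cmod (v $ i))\<^sup>2 * (cmod (v $ k))\<^sup>2 * (1 / A\<^sup>2) + (cmod (w $ i))\<^sup>2 * (cmod (w $ k))\<^sup>2 * (1 / B\<^sup>2)
      - Re (v $ i * cnj (v $ k) * cnj (w $ i) * w $ k) * (2 / (A * B))"
      using AB unfolding cmod_diff_sq by (simp add: norm_mult norm_divide power_mult_distrib power_divide)
  qed
  also have "\<dots> = A * A * (1 / A\<^sup>2) + B * B * (1 / B\<^sup>2) - (cmod (hermitian v w))\<^sup>2 * (2 / (A * B))"
    by (simp only: sum.distrib sum_subtractf sum_distrib_right[symmetric] sum_sq_mult hermitian_mult A_def B_def)
  also have "\<dots> = minors v w / (A * B)"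
    unfolding minors_lagrange A_def[symmetric] B_def[symmetric]
    using AB by (simp add: field_simps power2_eq_square)
  finally show ?thesis by (simp add: A_def B_def)
qed

lemma projector_smult:
  assumes "c \<noteq> 0"
  shows "projector (c *s v) = projector v"
proof -
  have c: "c * cnj c = of_real ((cmod c)\<^sup>2)" by (rule complex_norm_square[symmetric])
  have "(c *s v) $ i * cnj ((c *s v) $ k) = of_real ((cmod c)\<^sup>2) * (v $ i * cnj (v $ k))" for i k
    unfolding c[symmetric] by (simp add: mult_ac)
  then have "projector (c *s v) = (\<chi> i k. of_real ((cmod c)\<^sup>2) * (v $ i * cnj (v $ k)) /
      (of_real ((cmod c)\<^sup>2) * of_real ((norm v)\<^sup>2)))"
    by (simp only: projector_def norm_vec_smult power_mult_distrib of_real_mult)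
  also have "\<dots> = projector v"
    using assms by (simp add: projector_def vec_eq_iff)
  finally show ?thesis .
qed

lemma norm_projector: "v \<noteq> 0 \<Longrightarrow> norm (projector v) = 1"
proof -
  assume v: "v \<noteq> 0"
  have "(norm (projector v))\<^sup>2 = (\<Sum>i\<in>UNIV. \<Sum>k\<in>UNIV. (cmod (v $ i))\<^sup>2 * (cmod (v $ k))\<^sup>2 * (1 / ((norm v)\<^sup>2)\<^sup>2))"
    unfolding norm_vec_sq[of "projector v"] norm_vec_sq[of "projector v $ i" for i]
    by (intro sum.cong refl) (simp add: projector_def norm_mult norm_divide power_mult_distrib power_divide norm_power)
  also have "\<dots> = (norm v)\<^sup>2 * (norm v)\<^sup>2 * (1 / ((norm v)\<^sup>2)\<^sup>2)"
    by (simp only: sum_distrib_right[symmetric] sum_sq_mult)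
  also have "\<dots> = 1" using v by (simp add: power2_eq_square)
  finally show ?thesis using norm_ge_zero[of "projector v"] by (simp add: power2_eq_1_iff)
qed

lemma continuous_on_projector: "continuous_on (- {0}) (projector :: complex ^ 'n \<Rightarrow> _)"
  unfolding projector_def
  by (intro continuous_intros continuous_on_vec_lambda) auto

text \<open>Rotating \<open>w\<close> makes its product with \<open>v\<close> the nonnegative number
  \<open>cmod h\<close>. The squared distance of the vectors is then \<open>2 - 2 * cmod h\<close>,
  that of the projectors \<open>2 - 2 * (cmod h)^2\<close>, and \<open>cmod h\<close> is at most
  1.\<close>

lemma exists_phase:
  assumes "norm v = 1" "norm w = 1"
  shows "\<exists>c. cmod c = 1 \<and> norm (v - c *s w) \<le> norm (projector v - projector w)"
proof -
  define h where "h = hermitian v w"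
  define c where "c = (if h = 0 then 1 else h / of_real (cmod h))"
  have c: "cmod c = 1" by (simp add: c_def norm_divide)
  have ch: "cnj c * h = of_real (cmod h)"
    by (cases "h = 0") (simp_all add: c_def field_simps complex_norm_square[symmetric] power2_eq_square)
  have "hermitian v (c *s w) = cnj c * h"
    by (simp add: hermitian_def h_def sum_distrib_left mult_ac)
  then have herm: "Re (hermitian v (c *s w)) = cmod h" by (simp add: ch)
  have "(norm (v - c *s w))\<^sup>2 = (\<Sum>i\<in>UNIV. (cmod (v $ i))\<^sup>2 + (cmod ((c *s w) $ i))\<^sup>2 - 2 * Re (v $ i * cnj ((c *s w) $ i)))"
    unfolding norm_vec_sq by (intro sum.cong refl) (simp add: cmod_diff_sq)
  also have "\<dots> = (norm v)\<^sup>2 + (norm (c *s w))\<^sup>2 - 2 * Re (hermitian v (c *s w))"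
    by (simp add: norm_vec_sq[of v] norm_vec_sq[of "c *s w"] hermitian_def sum.distrib sum_subtractf sum_distrib_left)
  also have "\<dots> = 2 - 2 * cmod h" using assms herm by (simp add: norm_vec_smult c)
  finally have eq: "(norm (v - c *s w))\<^sup>2 = 2 - 2 * cmod h" .
  then have "cmod h \<le> 1" using zero_le_power2[of "norm (v - c *s w)"] by linarith
  then have "(cmod h)\<^sup>2 \<le> cmod h" by (simp add: power2_eq_square mult_left_le)
  moreover have "(norm (projector v - projector w))\<^sup>2 = 2 - 2 * (cmod h)\<^sup>2"
    using assms by (subst norm_projector_diff) (auto simp: minors_lagrange h_def)
  ultimately have "(norm (v - c *s w))\<^sup>2 \<le> (norm (projector v - projector w))\<^sup>2" using eq by simp
  then have "norm (v - c *s w) \<le> norm (projector v - projector w)"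
    by (rule power2_le_imp_le) (rule norm_ge_zero)
  then show ?thesis using c by blast
qed

section \<open>Projective space as a compact metric space\<close>

lift_definition proj_matrix :: "'n::finite cproj \<Rightarrow> complex ^ 'n ^ 'n" is projector
  unfolding proportional_def by (elim conjE exE) (simp add: projector_smult)

lemma proportional_self: "proportional v v \<longleftrightarrow> v \<noteq> 0"
  unfolding proportional_def by (auto intro: exI[of _ 1])

lemma cproj_cases:
  obtains v where "v \<noteq> 0" "p = abs_cproj v"
  using Quotient3_abs_rep[OF Quotient3_cproj, of p] Quotient3_rep_reflp[OF Quotient3_cproj, of p]
    proportional_self by metis

lemma cproj_cases_unit:
  obtains v where "norm v = 1" "p = abs_cproj v"
proof -
  obtain v where v: "v \<noteq> 0" "p = abs_cproj v" by (rule cproj_cases)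
  define c where "c = complex_of_real (inverse (norm v))"
  have c: "c \<noteq> 0" "norm (c *s v) = 1" using v by (auto simp: c_def norm_vec_smult norm_inverse)
  then have "proportional v (c *s v)" using v by (auto simp: proportional_def)
  then have "abs_cproj v = abs_cproj (c *s v)"
    using Quotient3_rel[OF Quotient3_cproj, of v "c *s v"] by blast
  then show ?thesis using that c(2) v by metis
qed

lemma abs_cproj_smult: "v \<noteq> 0 \<Longrightarrow> c \<noteq> 0 \<Longrightarrow> abs_cproj (c *s v) = abs_cproj v"
proof -
  assume v: "v \<noteq> 0" and c: "c \<noteq> 0"
  have "c *s v \<noteq> 0" using v c by (metis mult_eq_0_iff norm_eq_zero norm_vec_smult)
  then have "proportional v (c *s v)" using v c by (auto simp: proportional_def)
  then show ?thesis using Quotient3_rel[OF Quotient3_cproj, of v "c *s v"] by metis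
qed

lemma proj_matrix_abs: "v \<noteq> 0 \<Longrightarrow> proj_matrix (abs_cproj v) = projector v"
  by (rule proj_matrix.abs_eq) (simp add: proportional_self)

lemma in_chart_abs: "v \<noteq> 0 \<Longrightarrow> in_chart j (abs_cproj v) \<longleftrightarrow> v $ j \<noteq> 0"
  by (rule in_chart.abs_eq) (simp add: proportional_self)

lemma affine_coords_abs: "v \<noteq> 0 \<Longrightarrow> affine_coords j (abs_cproj v) = inverse (v $ j) *s v"
  by (simp add: affine_coords_def vec_eq_iff coord_ratio.abs_eq proportional_self divide_inverse mult.commute)

text \<open>Points near the class of \<open>v\<close> lift to vectors near \<open>v\<close>. This is
  how neighbourhoods in the quotient topology are seen to contain metric balls, and at distance 0 it
  gives injectivity.\<close>

lemma proj_matrix_eq_near: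
  "norm v = 1 \<Longrightarrow> \<exists>w. norm (v - w) \<le> norm (proj_matrix (abs_cproj v) - proj_matrix q) \<and> w \<noteq> 0 \<and> abs_cproj w = q"
proof -
  assume v: "norm v = 1"
  obtain w where w: "norm w = 1" "q = abs_cproj w" by (rule cproj_cases_unit)
  obtain c where c: "cmod c = 1" "norm (v - c *s w) \<le> norm (projector v - projector w)"
    using exists_phase[OF v w(1)] by blast
  have nz: "v \<noteq> 0" "w \<noteq> 0" "c \<noteq> 0" using v w c by auto
  then have "abs_cproj (c *s w) = q" "norm (c *s w) = 1"
    using abs_cproj_smult w c by (auto simp: norm_vec_smult)
  then show ?thesis using c(2) nz w by (intro exI[of _ "c *s w"]) (auto simp: proj_matrix_abs)
qed

lemma proj_matrix_inject: "proj_matrix p = proj_matrix q \<longleftrightarrow> p = q"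
proof
  assume eq: "proj_matrix p = proj_matrix q"
  obtain v where v: "norm v = 1" "p = abs_cproj v" by (rule cproj_cases_unit)
  then show "p = q" using proj_matrix_eq_near[OF v(1), of q] eq by auto
qed simp

text \<open>The topology is already fixed as a quotient, so the instance has to prove that the
  projector distance induces it. One inclusion lifts nearby points to nearby vectors, the other is
  continuity of \<open>projector\<close> away from 0.\<close>

instantiation cproj :: (finite) metric_space
begin

definition dist_cproj :: "'a cproj \<Rightarrow> 'a cproj \<Rightarrow> real" where
  "dist_cproj p q = norm (proj_matrix p - proj_matrix q)"

definition uniformity_cproj :: "('a cproj \<times> 'a cproj) filter" where
  "uniformity_cproj = (INF e\<in>{0<..}. principal {(p, q). dist p q < e})"

instance
proof
  show "uniformity = (INF e\<in>{0<..}. principal {(p, q::'a cproj). dist p q < e})"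
    by (rule uniformity_cproj_def)
  show "open U = (\<forall>p\<in>U. \<forall>\<^sub>F (p', q) in uniformity. p' = p \<longrightarrow> q \<in> U)" for U :: "'a cproj set"
  proof -
    have ev: "(\<forall>\<^sub>F (p', q) in uniformity. p' = p \<longrightarrow> q \<in> U) \<longleftrightarrow> (\<exists>e>0. \<forall>q. dist p q < e \<longrightarrow> q \<in> U)" for p
    proof -
      have base: "\<exists>x\<in>{0<..}. principal {(p, q::'a cproj). dist p q < x} \<le>
          inf (principal {(p, q). dist p q < a}) (principal {(p, q). dist p q < b})"
        if "a \<in> {0<..}" "b \<in> {0<..}" for a b :: real
        by (rule bexI[of _ "min a b"]) (use that in auto)
      show ?thesis
        unfolding uniformity_cproj_def
        by (subst eventually_INF_base[OF _ base]) (auto simp: eventually_principal)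
    qed
    have "open U \<longleftrightarrow> (\<forall>p\<in>U. \<exists>e>0. \<forall>q. dist p q < e \<longrightarrow> q \<in> U)"
    proof
      assume "open U"
      then have op: "open {v. v \<noteq> 0 \<and> abs_cproj v \<in> U}" by (simp add: open_cproj_def)
      show "\<forall>p\<in>U. \<exists>e>0. \<forall>q. dist p q < e \<longrightarrow> q \<in> U"
      proof
        fix p assume "p \<in> U"
        obtain v where v: "norm v = 1" "p = abs_cproj v" by (rule cproj_cases_unit)
        then have "v \<in> {v. v \<noteq> 0 \<and> abs_cproj v \<in> U}" using \<open>p \<in> U\<close> by auto
        then obtain e where e: "e > 0" "ball v e \<subseteq> {v. v \<noteq> 0 \<and> abs_cproj v \<in> U}"
          using op unfolding open_contains_ball by blast
        have "q \<in> U" if "dist p q < e" for q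
        proof -
          obtain w where w: "norm (v - w) \<le> norm (proj_matrix p - proj_matrix q)" "abs_cproj w = q"
            using proj_matrix_eq_near[OF v(1), of q] v(2) by auto
          then have "w \<in> ball v e" using that by (simp add: dist_cproj_def dist_norm)
          then show ?thesis using e(2) w(2) by auto
        qed
        then show "\<exists>e>0. \<forall>q. dist p q < e \<longrightarrow> q \<in> U" using e(1) by blast
      qed
    next
      assume h: "\<forall>p\<in>U. \<exists>e>0. \<forall>q. dist p q < e \<longrightarrow> q \<in> U"
      show "open U"
        unfolding open_cproj_def open_contains_ball
      proof
        fix v assume "v \<in> {v. v \<noteq> 0 \<and> abs_cproj v \<in> U}"
        then have v: "v \<noteq> 0" "abs_cproj v \<in> U" by auto
        obtain e where e: "e > 0" "\<And>q. dist (abs_cproj v) q < e \<Longrightarrow> q \<in> U" using h v(2) by blast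
        have "(projector \<longlongrightarrow> projector v) (at v within - {0})"
          using continuous_on_projector v(1) by (auto simp: continuous_on_def)
        then have "\<forall>\<^sub>F w in at v within - {0}. dist (projector w) (projector v) < e" using e(1) by (rule tendstoD)
        then obtain \<delta> where \<delta>: "\<delta> > 0" "\<And>w. \<lbrakk>w \<noteq> 0; w \<noteq> v; dist w v < \<delta>\<rbrakk> \<Longrightarrow> dist (projector w) (projector v) < e"
          unfolding eventually_at by auto
        have "ball v (min \<delta> (norm v)) \<subseteq> {v. v \<noteq> 0 \<and> abs_cproj v \<in> U}"
        proof
          fix w assume w: "w \<in> ball v (min \<delta> (norm v))"
          then have w0: "w \<noteq> 0" by auto
          have "dist (projector w) (projector v) < e"
            using \<delta>(2)[OF w0] w e(1) by (cases "w = v") (auto simp: dist_commute)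
          then have "dist (abs_cproj v) (abs_cproj w) < e"
            using v w0 by (simp add: dist_cproj_def proj_matrix_abs dist_norm norm_minus_commute)
          then show "w \<in> {v. v \<noteq> 0 \<and> abs_cproj v \<in> U}" using e(2) w0 by simp
        qed
        then show "\<exists>e>0. ball v e \<subseteq> {v. v \<noteq> 0 \<and> abs_cproj v \<in> U}"
          using \<delta>(1) v(1) by (intro exI[of _ "min \<delta> (norm v)"]) auto
      qed
    qed
    then show ?thesis by (simp only: ev)
  qed
  show "dist p q = 0 \<longleftrightarrow> p = q" for p q :: "'a cproj"
    by (simp add: dist_cproj_def proj_matrix_inject)
  show "dist p q \<le> dist p r + dist q r" for p q r :: "'a cproj"
    unfolding dist_cproj_def by (metis dist_norm dist_triangle2)
qed

end

lemma dist_cproj_le_2: "dist p q \<le> 2" for p q :: "'n::finite cproj"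
proof -
  obtain v w where "v \<noteq> 0" "p = abs_cproj v" "w \<noteq> 0" "q = abs_cproj w" using cproj_cases by metis
  then show ?thesis
    using norm_triangle_ineq4[of "projector v" "projector w"] by (simp add: dist_cproj_def proj_matrix_abs norm_projector)
qed

lemma isometry_proj_matrix: "dist (proj_matrix p) (proj_matrix q) = dist p q"
  by (simp add: dist_cproj_def dist_norm)

lemma continuous_on_proj_matrix: "continuous_on A proj_matrix"
  unfolding continuous_on_iff isometry_proj_matrix by blast

lemma compact_cproj: "compact (UNIV :: 'n::finite cproj set)"
proof -
  have "continuous_on (sphere 0 1) (abs_cproj :: complex ^ 'n \<Rightarrow> _)"
  proof -
    have "continuous_on (sphere 0 1) (projector :: complex ^ 'n \<Rightarrow> _)"
      by (rule continuous_on_subset[OF continuous_on_projector]) auto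
    then show ?thesis
      unfolding continuous_on_iff dist_cproj_def dist_norm
      by (metis (no_types, lifting) mem_sphere_0 norm_zero proj_matrix_abs zero_neq_one)
  qed
  then have "compact (abs_cproj ` sphere (0 :: complex ^ 'n) 1)"
    by (rule compact_continuous_image) simp
  moreover have "abs_cproj ` sphere (0 :: complex ^ 'n) 1 = UNIV"
    using cproj_cases_unit by (metis (no_types, lifting) UNIV_eq_I image_eqI mem_sphere_0)
  ultimately show ?thesis by simp
qed

lemma chart_exists: "\<exists>j. in_chart j p"
proof -
  obtain v where v: "v \<noteq> 0" "p = abs_cproj v" by (rule cproj_cases)
  then obtain j where "v $ j \<noteq> 0" by (auto simp: vec_eq_iff)
  then show ?thesis using v in_chart_abs by blast
qed

lemma affine_coords_props:
  assumes "in_chart j p"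
  shows "affine_coords j p $ j = 1" "affine_coords j p \<noteq> 0" "abs_cproj (affine_coords j p) = p"
proof -
  obtain v where v: "v \<noteq> 0" "p = abs_cproj v" by (rule cproj_cases)
  then have vj: "v $ j \<noteq> 0" using assms in_chart_abs by blast
  then show 1: "affine_coords j p $ j = 1" using v by (simp add: affine_coords_abs)
  then show "affine_coords j p \<noteq> 0" by auto
  show "abs_cproj (affine_coords j p) = p"
    using v vj abs_cproj_smult[of v "inverse (v $ j)"] by (simp add: affine_coords_abs)
qed

lemma proj_matrix_chart:
  shows "in_chart j p \<longleftrightarrow> proj_matrix p $ j $ j \<noteq> 0"
    "in_chart j p \<Longrightarrow> affine_coords j p $ i = proj_matrix p $ i $ j / proj_matrix p $ j $ j"
proof -
  obtain v where v: "v \<noteq> 0" "p = abs_cproj v" by (rule cproj_cases)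
  show "in_chart j p \<longleftrightarrow> proj_matrix p $ j $ j \<noteq> 0"
    using v by (simp add: in_chart_abs proj_matrix_abs projector_def)
  show "affine_coords j p $ i = proj_matrix p $ i $ j / proj_matrix p $ j $ j" if "in_chart j p"
    using v that by (simp add: in_chart_abs affine_coords_abs proj_matrix_abs projector_def field_simps)
qed

lemma dist_cproj_chart:
  assumes "in_chart j p" "in_chart j q"
  shows "(dist p q)\<^sup>2 = minors (affine_coords j p) (affine_coords j q) /
    ((norm (affine_coords j p))\<^sup>2 * (norm (affine_coords j q))\<^sup>2)"
  using norm_projector_diff[OF affine_coords_props(2)[OF assms(1)] affine_coords_props(2)[OF assms(2)]]
  unfolding dist_cproj_def
  by (metis affine_coords_props(2,3) assms proj_matrix_abs)

lemma open_chart: "open {p. in_chart j p}"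
proof -
  have "{p. in_chart j p} = (\<lambda>p. proj_matrix p $ j $ j) -` (- {0})"
    by (auto simp: proj_matrix_chart(1))
  moreover have "open \<dots>"
    by (rule open_vimage) (auto intro!: continuous_intros continuous_on_proj_matrix)
  ultimately show ?thesis by simp
qed

section \<open>The Fubini-Study form in a chart\<close>

abbreviation chart_norm_sq :: "'n::finite \<Rightarrow> complex ^ 'n \<Rightarrow> real" where
  "chart_norm_sq j w \<equiv> 1 + (\<Sum>i\<in>UNIV - {j}. (cmod (w $ i))\<^sup>2)"

abbreviation potential :: "'n::finite \<Rightarrow> complex ^ 'n \<Rightarrow> complex" where
  "potential j \<equiv> \<lambda>w. of_real (ln (chart_norm_sq j w))"

abbreviation chart_slope :: "'n::finite \<Rightarrow> complex ^ 'n \<Rightarrow> complex ^ 'n \<Rightarrow> real" where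
  "chart_slope j w v \<equiv> 2 * Re (\<Sum>i\<in>UNIV - {j}. w $ i * cnj (v $ i))"

lemma chart_norm_sq_pos: "0 < chart_norm_sq j w"
  by (intro add_pos_nonneg sum_nonneg) auto

lemma chart_norm_sq_deriv:
  "((\<lambda>t. chart_norm_sq j (w + t *\<^sub>R v)) has_real_derivative
     chart_slope j w v) (at 0)"
proof -
  have eq: "(cmod ((w + t *\<^sub>R v) $ i))\<^sup>2 = (cmod (w $ i))\<^sup>2 + t * (2 * Re (w $ i * cnj (v $ i))) + t\<^sup>2 * (cmod (v $ i))\<^sup>2" for t i
    unfolding cmod_power2 by (simp add: power2_eq_square algebra_simps)
  have "((\<lambda>t. 1 + (\<Sum>i\<in>UNIV - {j}. (cmod (w $ i))\<^sup>2 + t * (2 * Re (w $ i * cnj (v $ i))) + t\<^sup>2 * (cmod (v $ i))\<^sup>2))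
     has_real_derivative 0 + (\<Sum>i\<in>UNIV - {j}. 2 * Re (w $ i * cnj (v $ i)))) (at 0)"
    by (intro DERIV_add DERIV_const DERIV_sum) (auto intro!: derivative_eq_intros)
  moreover have "0 + (\<Sum>i\<in>UNIV - {j}. 2 * Re (w $ i * cnj (v $ i))) = chart_slope j w v"
    by (simp only: Re_sum sum_distrib_left add_0)
  ultimately show ?thesis by (simp only: eq)
qed

lemma dir_deriv_potential:
  "dir_deriv v (potential j) w =
     of_real (chart_slope j w v / chart_norm_sq j w)"
proof -
  have "((\<lambda>t. ln (chart_norm_sq j (w + t *\<^sub>R v))) has_real_derivative
     1 / chart_norm_sq j (w + 0 *\<^sub>R v) * (chart_slope j w v)) (at 0)"
    by (rule DERIV_chain2[OF DERIV_ln_divide chart_norm_sq_deriv]) (rule chart_norm_sq_pos)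
  moreover have "1 / chart_norm_sq j (w + 0 *\<^sub>R v) * (chart_slope j w v)
     = chart_slope j w v / chart_norm_sq j w" by simp
  ultimately have "((\<lambda>t. complex_of_real (ln (chart_norm_sq j (w + t *\<^sub>R v)))) has_vector_derivative
     of_real (chart_slope j w v / chart_norm_sq j w)) (at 0)"
    using has_vector_derivative_of_real by (simp only:)
  then show ?thesis unfolding dir_deriv_def by (rule vector_derivative_at)
qed

lemma sum_axis: "(\<Sum>i\<in>UNIV - {j}. w $ i * cnj (axis k c $ i)) = (if k = j then 0 else w $ k * cnj c)"
  for w :: "complex ^ 'n"
proof -
  have "(\<Sum>i\<in>UNIV - {j}. w $ i * cnj (axis k c $ i)) = (\<Sum>i\<in>UNIV - {j}. if k = i then w $ k * cnj c else 0)"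
    by (intro sum.cong refl) (auto simp: axis_def)
  then show ?thesis by auto
qed

lemma d_zbar_potential:
  "d_zbar l (potential j) w = (if l = j then 0 else w $ l / of_real (chart_norm_sq j w))"
proof -
  define A where "A = chart_norm_sq j w"
  show ?thesis
    unfolding d_zbar_def dir_deriv_potential sum_axis A_def[symmetric]
    by (simp add: complex_eq_iff Re_divide_of_real Im_divide_of_real)
qed

lemma has_vector_derivative_divide_complex:
  fixes f g :: "real \<Rightarrow> complex"
  assumes "(f has_vector_derivative f') (at t)" "(g has_vector_derivative g') (at t)" "g t \<noteq> 0"
  shows "((\<lambda>t. f t / g t) has_vector_derivative (f' * g t - f t * g') / (g t)\<^sup>2) (at t)"
  unfolding has_vector_derivative_def
proof (rule has_derivative_eq_rhs)
  show "((\<lambda>t. f t / g t) has_derivative (\<lambda>h. - f t * (inverse (g t) * (h *\<^sub>R g') * inverse (g t)) + h *\<^sub>R f' / g t)) (at t)"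
    using has_derivative_divide[OF assms(1)[unfolded has_vector_derivative_def] assms(2)[unfolded has_vector_derivative_def] assms(3)]
    by simp
  show "(\<lambda>h. - f t * (inverse (g t) * (h *\<^sub>R g') * inverse (g t)) + h *\<^sub>R f' / g t) = (\<lambda>h. h *\<^sub>R ((f' * g t - f t * g') / (g t)\<^sup>2))"
    using assms(3) by (auto simp: fun_eq_iff field_simps power2_eq_square scaleR_conv_of_real)
qed

lemma dir_deriv_chart_quotient:
  "dir_deriv v (\<lambda>w. w $ l / of_real (chart_norm_sq j w)) w =
     (v $ l * of_real (chart_norm_sq j w) - w $ l * of_real (chart_slope j w v)) /
       (of_real (chart_norm_sq j w))\<^sup>2"
proof -
  have 1: "((\<lambda>t::real. (w + t *\<^sub>R v) $ l) has_vector_derivative v $ l) (at 0)"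
    by (auto intro!: derivative_eq_intros)
  have 2: "((\<lambda>t. complex_of_real (chart_norm_sq j (w + t *\<^sub>R v))) has_vector_derivative
     of_real (chart_slope j w v)) (at 0)"
    by (rule has_vector_derivative_of_real[OF chart_norm_sq_deriv])
  have nz: "complex_of_real (chart_norm_sq j (w + 0 *\<^sub>R v)) \<noteq> 0"
    using chart_norm_sq_pos[where j = j and w = "w + 0 *\<^sub>R v"] by (simp only: of_real_eq_0_iff)
  have zero: "w + 0 *\<^sub>R v = w" by simp
  have "((\<lambda>t::real. (w + t *\<^sub>R v) $ l / of_real (chart_norm_sq j (w + t *\<^sub>R v))) has_vector_derivative
     (v $ l * of_real (chart_norm_sq j w) - w $ l * of_real (chart_slope j w v)) /
       (of_real (chart_norm_sq j w))\<^sup>2) (at 0)"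
    using has_vector_derivative_divide_complex[OF 1 2 nz] unfolding zero .
  then show ?thesis unfolding dir_deriv_def by (rule vector_derivative_at)
qed

lemma d_z_d_zbar_potential:
  "d_z k (d_zbar l (potential j)) w =
     (if k = j \<or> l = j then 0
      else ((if k = l then of_real (chart_norm_sq j w) else 0) - w $ l * cnj (w $ k)) / (of_real (chart_norm_sq j w))\<^sup>2)"
proof (cases "l = j")
  case True
  then have "d_zbar l (potential j) = (\<lambda>w. 0)"
    by (simp add: d_zbar_potential fun_eq_iff)
  then show ?thesis using True by (simp add: d_z_def dir_deriv_def)
next
  case False
  then have eq: "d_zbar l (potential j) = (\<lambda>w. w $ l / of_real (chart_norm_sq j w))"
    by (simp add: d_zbar_potential fun_eq_iff)
  \<comment> \<open>The slopes along \<open>axis k 1\<close> and \<open>axis k \<i>\<close> are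
    twice the real and twice the imaginary part of \<open>w $ k\<close>, and \<open>d_z\<close>
    combines them into the conjugate.\<close>
  have conj: "cnj (w $ k) = of_real (Re (w $ k)) - \<i> * of_real (Im (w $ k))" by (simp add: complex_eq_iff)
  show ?thesis
    using False unfolding eq d_z_def dir_deriv_chart_quotient sum_axis conj
    by (auto simp: axis_def algebra_simps add_divide_distrib diff_divide_distrib)
qed

lemma sum_diag_minus_product:
  fixes C :: "'b::comm_ring_1"
  shows "(\<Sum>k\<in>UNIV. \<Sum>l\<in>UNIV. C * ((if k = l then B k else 0) - x k * y l)) =
    C * ((\<Sum>k\<in>UNIV. B k) - (\<Sum>k\<in>UNIV. x k) * (\<Sum>l\<in>(UNIV :: 'a::finite set). y l))"
proof -
  have "(\<Sum>l\<in>UNIV. C * ((if k = l then B k else 0) - x k * y l)) = C * (B k - x k * (\<Sum>l\<in>UNIV. y l))" for k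
    unfolding sum_distrib_left[symmetric] sum_subtractf by simp
  then show ?thesis
    by (simp only: sum_distrib_left[symmetric] sum_subtractf sum_distrib_right[symmetric])
qed

text \<open>As \<open>w $ j = 1\<close>, the chart potential is the logarithm of the full squared
  norm. The double sum then becomes the Gram determinant of \<open>w\<close> and \<open>a\<close>,
  which is half of \<open>minors w a\<close> by Lagrange's identity.\<close>

lemma fubini_study_eval:
  assumes "w $ j = 1" "a $ j = 0"
  shows "fubini_study j w a (\<i> *s a) = of_real (minors w a / (2 * pi * (norm w)^4))"
proof -
  define A where "A = chart_norm_sq j w"
  have A: "A > 0" unfolding A_def by (rule chart_norm_sq_pos)
  have normw: "(norm w)\<^sup>2 = A"
    unfolding norm_vec_sq A_def by (subst sum.remove[of _ j]) (simp_all add: assms)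
  have summand: "d_z k (d_zbar l (potential j)) w * (a $ k * cnj ((\<i> *s a) $ l) - (\<i> *s a) $ k * cnj (a $ l))
    = - 2 * \<i> / (of_real A)\<^sup>2 * ((if k = l then of_real A * (a $ k * cnj (a $ k)) else 0) - (a $ k * cnj (w $ k)) * (w $ l * cnj (a $ l)))" for k l
  proof (cases "k = j \<or> l = j")
    case True
    then have "a $ k = 0 \<or> a $ l = 0" using assms(2) by auto
    then show ?thesis unfolding d_z_d_zbar_potential using True by auto
  next
    case False
    then show ?thesis
      unfolding d_z_d_zbar_potential A_def[symmetric] using A
      by (auto simp: field_simps)
  qed
  have "ddbar (potential j) w a (\<i> *s a)
    = - 2 * \<i> / (of_real A)\<^sup>2 * (of_real A * hermitian a a - hermitian a w * hermitian w a)"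
    unfolding ddbar_def summand sum_diag_minus_product by (simp only: hermitian_def sum_distrib_left)
  also have "hermitian w a = cnj (hermitian a w)"
    by (simp add: hermitian_def mult.commute)
  also have "hermitian a w * cnj (hermitian a w) = of_real ((cmod (hermitian a w))\<^sup>2)"
    by (rule complex_norm_square[symmetric])
  also have "cmod (hermitian a w) = cmod (hermitian w a)"
  proof -
    have "hermitian a w = cnj (hermitian w a)" by (simp add: hermitian_def mult.commute)
    then show ?thesis by simp
  qed
  finally have dd: "ddbar (potential j) w a (\<i> *s a)
    = - 2 * \<i> / (of_real A)\<^sup>2 * of_real (A * (norm a)\<^sup>2 - (cmod (hermitian w a))\<^sup>2)"
    unfolding hermitian_self by (simp only: of_real_diff of_real_mult)
  have lagrange: "A * (norm a)\<^sup>2 - (cmod (hermitian w a))\<^sup>2 = minors w a / 2"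
    unfolding minors_lagrange normw by simp
  have dd': "ddbar (potential j) w a (\<i> *s a)
    = - \<i> / (of_real A)\<^sup>2 * of_real (minors w a)"
    unfolding dd lagrange by simp
  have A2: "(norm w)^4 = A\<^sup>2" unfolding normw[symmetric] by simp
  show ?thesis
    unfolding fubini_study_def dd' A2 using A by (simp add: field_simps power2_eq_square)
qed

section \<open>Energy density as squared infinitesimal speed\<close>

definition velocity :: "'n::finite \<Rightarrow> (complex \<Rightarrow> 'n cproj) \<Rightarrow> complex \<Rightarrow> complex ^ 'n" where
  "velocity j f z = (\<chi> i. deriv (\<lambda>w. affine_coords j (f w) $ i) z)"

lemma open_chart_domain: "holomorphic_curve f \<Longrightarrow> open {z. in_chart j (f z)}"
  using open_vimage[OF open_chart, of f j] unfolding holomorphic_curve_def vimage_def by simp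

lemma affine_coords_deriv:
  assumes "holomorphic_curve f" "in_chart j (f z)"
  shows "((\<lambda>w. affine_coords j (f w) $ i) has_field_derivative velocity j f z $ i) (at z)"
  unfolding velocity_def vec_lambda_beta
  by (rule holomorphic_derivI[OF _ open_chart_domain[OF assms(1)]])
    (use assms in \<open>auto simp: holomorphic_curve_def\<close>)

lemma eventually_in_chart:
  assumes "holomorphic_curve f" "in_chart j (f z)"
  shows "\<forall>\<^sub>F w in nhds z. in_chart j (f w)"
  using eventually_nhds_in_open[OF open_chart_domain[OF assms(1)], of z j] assms(2) by simp

lemma velocity_chart:
  assumes "holomorphic_curve f" "in_chart j (f z)"
  shows "velocity j f z $ j = 0"
proof -
  have "\<forall>\<^sub>F w in nhds z. affine_coords j (f w) $ j = 1"
    using eventually_in_chart[OF assms] by eventually_elim (rule affine_coords_props)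
  then have "((\<lambda>w. affine_coords j (f w) $ j) has_field_derivative 0) (at z)"
    by (subst DERIV_cong_ev[OF refl _ refl, of _ "\<lambda>_. 1"]) auto
  then show ?thesis using DERIV_unique affine_coords_deriv[OF assms] by blast
qed

text \<open>The left-hand side does not mention \<open>j\<close>, so the energy density can be computed in every chart.\<close>

lemma speed_limit:
  assumes f: "holomorphic_curve f" and j: "in_chart j (f z)"
  shows "((\<lambda>w. (dist (f z) (f w))\<^sup>2 / (cmod (w - z))\<^sup>2) \<longlongrightarrow>
    minors (affine_coords j (f z)) (velocity j f z) / (norm (affine_coords j (f z)))^4) (at z)"
proof -
  define F where "F w = affine_coords j (f w)" for w
  define Q where "Q w = (\<chi> i. (F w $ i - F z $ i) / (w - z))" for w
  have Q: "(Q \<longlongrightarrow> velocity j f z) (at z)"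
    unfolding Q_def
  proof (rule vec_tendstoI)
    fix i
    show "((\<lambda>w. (\<chi> i. (F w $ i - F z $ i) / (w - z)) $ i) \<longlongrightarrow> velocity j f z $ i) (at z)"
      using affine_coords_deriv[OF f j, of i] by (simp add: has_field_derivative_iff F_def)
  qed
  have F: "(F \<longlongrightarrow> F z) (at z)"
  proof (rule vec_tendstoI)
    fix i
    show "((\<lambda>w. F w $ i) \<longlongrightarrow> F z $ i) (at z)"
      using DERIV_isCont[OF affine_coords_deriv[OF f j, of i]] by (simp add: isCont_def F_def)
  qed
  have nz: "F z \<noteq> 0" unfolding F_def by (rule affine_coords_props(2)[OF j])
  have "((\<lambda>w. minors (F z) (Q w) / ((norm (F z))\<^sup>2 * (norm (F w))\<^sup>2)) \<longlongrightarrow>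
     minors (F z) (velocity j f z) / ((norm (F z))\<^sup>2 * (norm (F z))\<^sup>2)) (at z)"
    unfolding minors_def using nz by (intro tendsto_intros Q F) auto
  moreover have "\<forall>\<^sub>F w in at z. minors (F z) (Q w) / ((norm (F z))\<^sup>2 * (norm (F w))\<^sup>2) = (dist (f z) (f w))\<^sup>2 / (cmod (w - z))\<^sup>2"
  proof -
    have "\<forall>\<^sub>F w in at z. in_chart j (f w)"
      unfolding eventually_at_filter using eventually_in_chart[OF f j] by (rule eventually_mono) simp
    moreover have "\<forall>\<^sub>F w in at z. w \<noteq> z" by (rule eventually_neq_at_within)
    ultimately show ?thesis
    proof eventually_elim
      case (elim w)
      have Qw: "Q w = inverse (w - z) *s (F w - F z)"
        by (simp add: Q_def vec_eq_iff divide_inverse algebra_simps)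
      have "minors (F z) (Q w) = minors (F z) (F w) / (cmod (w - z))\<^sup>2"
        unfolding Qw minors_smult minors_diff by (simp add: norm_inverse divide_inverse power_inverse mult.commute)
      then show ?case
        using dist_cproj_chart[OF j elim(1)] by (simp add: F_def)
    qed
  qed
  ultimately show ?thesis
    by (auto simp: F_def power2_eq_square power4_eq_xxxx mult.assoc intro: Lim_transform_eventually)
qed

lemma energy_density_chart:
  assumes f: "holomorphic_curve f" and j: "in_chart j (f z)"
  shows "energy_density f z = minors (affine_coords j (f z)) (velocity j f z) / (2 * pi * (norm (affine_coords j (f z)))^4)"
proof -
  define k where "k = (SOME j. in_chart j (f z))"
  have k: "in_chart k (f z)" unfolding k_def using chart_exists by (rule someI_ex)
  have "energy_density f z = Re (fubini_study k (affine_coords k (f z)) (velocity k f z) (\<i> *s velocity k f z))"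
    by (simp add: energy_density_def k_def velocity_def Let_def)
  also have "\<dots> = minors (affine_coords k (f z)) (velocity k f z) / (2 * pi * (norm (affine_coords k (f z)))^4)"
    using fubini_study_eval[OF affine_coords_props(1)[OF k] velocity_chart[OF f k]] by simp
  also have "\<dots> = minors (affine_coords k (f z)) (velocity k f z) / (norm (affine_coords k (f z)))^4 / (2 * pi)"
    by simp
  also have "minors (affine_coords k (f z)) (velocity k f z) / (norm (affine_coords k (f z)))^4
    = minors (affine_coords j (f z)) (velocity j f z) / (norm (affine_coords j (f z)))^4"
    by (rule tendsto_unique[OF _ speed_limit[OF f k] speed_limit[OF f j]]) simp
  finally show ?thesis by simp
qed

lemma energy_density_limit:
  assumes "holomorphic_curve f"
  shows "((\<lambda>w. (dist (f z) (f w))\<^sup>2 / (cmod (w - z))\<^sup>2) \<longlongrightarrow> 2 * pi * energy_density f z) (at z)"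
proof -
  obtain j where "in_chart j (f z)" using chart_exists by blast
  then show ?thesis using speed_limit energy_density_chart assms by fastforce
qed

lemma energy_density_nonneg: "holomorphic_curve f \<Longrightarrow> 0 \<le> energy_density f z"
  using chart_exists[of "f z"] by (auto simp: energy_density_chart minors_nonneg)

lemma fs_norm_sq: "holomorphic_curve f \<Longrightarrow> (fs_norm f z)\<^sup>2 = energy_density f z"
  by (simp add: fs_norm_def energy_density_nonneg)

text \<open>Bisection of the segment from \<open>a\<close> to \<open>b\<close>: the estimate adds up
  over adjacent intervals and holds on every short interval around each parameter.\<close>

lemma locally_lipschitz_imp_lipschitz:
  fixes f :: "'a::real_normed_vector \<Rightarrow> 'b::metric_space"
  assumes "\<And>z. \<forall>\<^sub>F w in nhds z. dist (f z) (f w) \<le> L * norm (w - z)"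
  shows "dist (f a) (f b) \<le> L * norm (b - a)"
proof -
  define g where "g t = f (a + t *\<^sub>R (b - a))" for t :: real
  define C where "C = L * norm (b - a)"
  have loc: "\<exists>\<delta>>0. \<forall>s. \<bar>s - t\<bar> < \<delta> \<longrightarrow> dist (g t) (g s) \<le> C * \<bar>s - t\<bar>" for t
  proof -
    obtain e where e: "e > 0" "\<And>w. dist w (a + t *\<^sub>R (b - a)) < e \<Longrightarrow>
        dist (f (a + t *\<^sub>R (b - a))) (f w) \<le> L * norm (w - (a + t *\<^sub>R (b - a)))"
      using assms[of "a + t *\<^sub>R (b - a)"] unfolding eventually_nhds_metric by blast
    have den: "norm (b - a) + 1 > 0" by (intro add_nonneg_pos) auto
    have "dist (g t) (g s) \<le> C * \<bar>s - t\<bar>" if "\<bar>s - t\<bar> < e / (norm (b - a) + 1)" for s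
    proof -
      have eq: "a + s *\<^sub>R (b - a) - (a + t *\<^sub>R (b - a)) = (s - t) *\<^sub>R (b - a)" by (simp add: algebra_simps)
      have "\<bar>s - t\<bar> * norm (b - a) \<le> \<bar>s - t\<bar> * (norm (b - a) + 1)" by (intro mult_left_mono) auto
      also have "\<dots> < e" using that den by (simp add: pos_less_divide_eq)
      finally have "dist (a + s *\<^sub>R (b - a)) (a + t *\<^sub>R (b - a)) < e" unfolding dist_norm eq by simp
      from e(2)[OF this] show ?thesis unfolding g_def eq by (simp add: C_def mult_ac)
    qed
    then show ?thesis using e(1) den by (intro exI[of _ "e / (norm (b - a) + 1)"]) auto
  qed
  have "dist (g 0) (g 1) \<le> C * (1 - 0)"
  proof (rule Bolzano[where P = "\<lambda>s t. dist (g s) (g t) \<le> C * (t - s)"])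
    fix r s t assume "dist (g r) (g s) \<le> C * (s - r)" "dist (g s) (g t) \<le> C * (t - s)"
    then show "dist (g r) (g t) \<le> C * (t - r)"
      using dist_triangle[of "g r" "g t" "g s"] by (simp add: algebra_simps)
  next
    fix t :: real
    obtain \<delta> where \<delta>: "\<delta> > 0" "\<And>s. \<bar>s - t\<bar> < \<delta> \<Longrightarrow> dist (g t) (g s) \<le> C * \<bar>s - t\<bar>" using loc by blast
    have "dist (g r) (g s) \<le> C * (s - r)" if "r \<le> t" "t \<le> s" "s - r < \<delta>" for r s
      using \<delta>(2)[of r] \<delta>(2)[of s] that dist_triangle[of "g r" "g s" "g t"]
      by (simp add: dist_commute algebra_simps)
    then show "\<exists>d>0. \<forall>r s. r \<le> t \<and> t \<le> s \<and> s - r < d \<longrightarrow> dist (g r) (g s) \<le> C * (s - r)"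
      using \<delta>(1) by blast
  qed simp
  then show ?thesis by (simp add: g_def C_def)
qed

text \<open>Strictness of the bound lets the limit of the squared difference quotients give an
  inequality on a neighbourhood of each point.\<close>

lemma energy_bound_imp_lipschitz:
  assumes f: "holomorphic_curve f" and L: "L > 0" "\<And>z. 2 * pi * energy_density f z < L\<^sup>2"
  shows "dist (f a) (f b) \<le> L * cmod (b - a)"
proof (rule locally_lipschitz_imp_lipschitz)
  fix z
  have "\<forall>\<^sub>F w in at z. (dist (f z) (f w))\<^sup>2 / (cmod (w - z))\<^sup>2 < L\<^sup>2"
    using order_tendstoD(2)[OF energy_density_limit[OF f] L(2)] .
  then show "\<forall>\<^sub>F w in nhds z. dist (f z) (f w) \<le> L * cmod (w - z)"
    unfolding eventually_at_filter
  proof eventually_elim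
    case (elim w)
    show ?case
    proof (cases "w = z")
      case False
      then have "(dist (f z) (f w))\<^sup>2 < (L * cmod (w - z))\<^sup>2"
        using elim by (simp add: pos_divide_less_eq power_mult_distrib)
      moreover have "0 \<le> L * cmod (w - z)" using L(1) by simp
      ultimately show ?thesis by (rule power2_le_imp_le[OF less_imp_le])
    qed simp
  qed
qed

text \<open>Such a curve is Lipschitz with every positive constant.\<close>

lemma zero_energy_imp_constant:
  assumes f: "holomorphic_curve f" and "\<And>z. energy_density f z = 0"
  shows "f a = f b"
proof -
  have "dist (f a) (f b) \<le> 0"
  proof (rule field_le_epsilon)
    fix e :: real assume e: "e > 0"
    define L where "L = e / (cmod (b - a) + 1)"
    have den: "cmod (b - a) + 1 > 0" by (intro add_nonneg_pos) auto
    then have L: "L > 0" using e by (simp add: L_def)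
    have "dist (f a) (f b) \<le> L * cmod (b - a)"
      by (rule energy_bound_imp_lipschitz[OF f L]) (use L assms(2) in simp)
    also have "\<dots> \<le> L * (cmod (b - a) + 1)" using L by simp
    also have "\<dots> = e" using den by (simp add: L_def)
    finally show "dist (f a) (f b) \<le> 0 + e" by simp
  qed
  then show ?thesis by simp
qed

lemma translate_compose: "translate a (translate b f) = translate (a + b) f"
  by (simp add: translate_def add_ac)

lemma holomorphic_curve_translate:
  assumes "holomorphic_curve f"
  shows "holomorphic_curve (translate a f)"
  unfolding holomorphic_curve_def translate_def
proof (intro conjI allI)
  have cont: "continuous_on UNIV f" and hol: "\<And>i j. (\<lambda>z. affine_coords j (f z) $ i) holomorphic_on {z. in_chart j (f z)}"
    using assms by (auto simp: holomorphic_curve_def)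
  show "continuous_on UNIV (\<lambda>z. f (z + a))"
    by (rule continuous_on_compose2[OF cont]) (auto intro: continuous_intros)
  show "(\<lambda>z. affine_coords j (f (z + a)) $ i) holomorphic_on {z. in_chart j (f (z + a))}" for i j
  proof -
    have "(\<lambda>z. z + a) holomorphic_on {z. in_chart j (f (z + a))}" by (intro holomorphic_intros)
    moreover have "(\<lambda>z. z + a) ` {z. in_chart j (f (z + a))} \<subseteq> {z. in_chart j (f z)}" by auto
    ultimately show ?thesis
      using holomorphic_on_compose_gen[OF _ hol[of j i]] by (simp add: o_def)
  qed
qed

text \<open>The description of the density as a limit of distances is intrinsic, so no comparison of
  the charts chosen at the two points is needed.\<close>

lemma energy_density_translate:
  assumes "holomorphic_curve f"
  shows "energy_density (translate a f) z = energy_density f (z + a)"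
proof -
  have "((\<lambda>w. (dist (translate a f z) (translate a f w))\<^sup>2 / (cmod (w - z))\<^sup>2) \<longlongrightarrow> 2 * pi * energy_density f (z + a)) (at z)"
    using LIM_offset[OF energy_density_limit[OF assms, of "z + a"], of a] by (simp add: translate_def)
  then have "2 * pi * energy_density (translate a f) z = 2 * pi * energy_density f (z + a)"
    by (rule tendsto_unique[rotated, OF energy_density_limit[OF holomorphic_curve_translate[OF assms]]]) simp
  then show ?thesis by simp
qed

section \<open>The space of Brody curves\<close>

definition brody_curves :: "(complex \<Rightarrow> 'n::finite cproj) set" where
  "brody_curves = {f. holomorphic_curve f \<and> (\<forall>z. fs_norm f z \<le> 1)}"

text \<open>With the weight \<open>1 / (1 + \<bar>z\<bar>)\<close> this metric induces the compact-open topology on Brody curves, and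
  translation by \<open>a\<close> is Lipschitz with constant \<open>1 + \<bar>a\<bar>\<close>.\<close>

definition curve_dist :: "(complex \<Rightarrow> 'n::finite cproj) \<Rightarrow> (complex \<Rightarrow> 'n cproj) \<Rightarrow> real" where
  "curve_dist f g = (SUP z. dist (f z) (g z) / (1 + cmod z))"

lemma brody_curves_iff:
  "f \<in> brody_curves \<longleftrightarrow> holomorphic_curve f \<and> (\<forall>z. energy_density f z \<le> 1)"
  using energy_density_nonneg unfolding brody_curves_def fs_norm_def by auto

lemma one_plus_norm_pos: "0 < 1 + norm (z::'a::real_normed_vector)"
  by (intro add_pos_nonneg) auto

lemma curve_dist_le_iff: "curve_dist f g \<le> e \<longleftrightarrow> (\<forall>z. dist (f z) (g z) \<le> e * (1 + cmod z))"
proof -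
  have "dist (f z) (g z) / (1 + cmod z) \<le> 2" for z
  proof -
    have "dist (f z) (g z) / (1 + cmod z) \<le> dist (f z) (g z) / 1"
      by (intro divide_left_mono) (auto simp: one_plus_norm_pos)
    then show ?thesis using dist_cproj_le_2[of "f z" "g z"] by simp
  qed
  then have "bdd_above (range (\<lambda>z. dist (f z) (g z) / (1 + cmod z)))" by (intro bdd_aboveI2)
  then show ?thesis
    unfolding curve_dist_def by (subst cSUP_le_iff) (auto simp: pos_divide_le_eq one_plus_norm_pos)
qed

lemma dist_le_curve_dist: "dist (f z) (g z) \<le> curve_dist f g * (1 + cmod z)"
  using curve_dist_le_iff[of f g "curve_dist f g"] by blast

lemma curve_dist_nonneg: "0 \<le> curve_dist f g"
  using order_trans[OF zero_le_dist dist_le_curve_dist[of f 0 g]] by simp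

lemma Metric_space_curve_dist: "Metric_space M curve_dist"
proof
  show "0 \<le> curve_dist f g" for f g :: "complex \<Rightarrow> 'a cproj" by (rule curve_dist_nonneg)
  show "curve_dist f g = curve_dist g f" for f g :: "complex \<Rightarrow> 'a cproj"
    by (simp add: curve_dist_def dist_commute)
  show "(curve_dist f g = 0) = (f = g)" for f g :: "complex \<Rightarrow> 'a cproj"
  proof
    assume "curve_dist f g = 0"
    then have "dist (f z) (g z) \<le> 0" for z using dist_le_curve_dist[of f z g] by simp
    then show "f = g" by auto
  next
    assume "f = g"
    then have "curve_dist f g \<le> 0" by (simp add: curve_dist_le_iff)
    then show "curve_dist f g = 0" using curve_dist_nonneg[of f g] by simp
  qed
  show "curve_dist f h \<le> curve_dist f g + curve_dist g h" for f g h :: "complex \<Rightarrow> 'a cproj"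
    unfolding curve_dist_le_iff
  proof
    fix z
    show "dist (f z) (h z) \<le> (curve_dist f g + curve_dist g h) * (1 + cmod z)"
      using dist_triangle[of "f z" "h z" "g z"] dist_le_curve_dist[of f z g] dist_le_curve_dist[of g z h]
      unfolding distrib_right by linarith
  qed
qed

text \<open>The constant 3 is admissible because \<open>2 * pi\<close> is less than
  \<open>3^2\<close>.\<close>

lemma brody_lipschitz:
  assumes "f \<in> brody_curves"
  shows "dist (f a) (f b) \<le> 3 * cmod (b - a)"
proof (rule energy_bound_imp_lipschitz)
  show "2 * pi * energy_density f z < 3\<^sup>2" for z
  proof -
    have "2 * pi * energy_density f z \<le> 2 * pi * 1"
      using assms by (intro mult_left_mono) (auto simp: brody_curves_iff)
    also have "\<dots> < 3\<^sup>2" using pi_less_4 by simp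
    finally show ?thesis .
  qed
qed (use assms in \<open>auto simp: brody_curves_iff\<close>)

lemma brody_translate: "f \<in> brody_curves \<Longrightarrow> translate a f \<in> brody_curves"
  by (simp add: brody_curves_iff holomorphic_curve_translate energy_density_translate)

text \<open>The weight is submultiplicative: \<open>1 + cmod (z + a)\<close> is at most
  \<open>(1 + cmod a) * (1 + cmod z)\<close>. With \<open>a = b\<close> the bound gives
  equicontinuity of the action, with \<open>f = g\<close> continuity along an orbit.\<close>

lemma curve_dist_translate:
  assumes "g \<in> brody_curves"
  shows "curve_dist (translate a f) (translate b g) \<le> (1 + cmod a) * curve_dist f g + 3 * cmod (b - a)"
  unfolding curve_dist_le_iff
proof
  fix z
  have "1 + cmod (z + a) \<le> (1 + cmod a) * (1 + cmod z)"
  proof -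
    have "0 \<le> cmod a * cmod z" by simp
    moreover have "(1 + cmod a) * (1 + cmod z) = 1 + cmod a + cmod z + cmod a * cmod z"
      by (simp add: algebra_simps)
    ultimately show ?thesis using norm_triangle_ineq[of z a] by linarith
  qed
  then have "dist (f (z + a)) (g (z + a)) \<le> curve_dist f g * ((1 + cmod a) * (1 + cmod z))"
    by (rule order_trans[OF dist_le_curve_dist mult_left_mono]) (rule curve_dist_nonneg)
  moreover have "dist (g (z + a)) (g (z + b)) \<le> 3 * cmod (b - a)"
    using brody_lipschitz[OF assms, of "z + a" "z + b"] by simp
  moreover have "3 * cmod (b - a) \<le> 3 * cmod (b - a) * (1 + cmod z)"
    by (simp add: distrib_left)
  moreover have "dist (f (z + a)) (g (z + b)) \<le> dist (f (z + a)) (g (z + a)) + dist (g (z + a)) (g (z + b))"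
    by (rule dist_triangle)
  ultimately have "dist (f (z + a)) (g (z + b)) \<le> curve_dist f g * ((1 + cmod a) * (1 + cmod z)) + 3 * cmod (b - a) * (1 + cmod z)"
    by linarith
  then show "dist (translate a f z) (translate b g z) \<le> ((1 + cmod a) * curve_dist f g + 3 * cmod (b - a)) * (1 + cmod z)"
    by (simp add: translate_def algebra_simps)
qed

section \<open>Limits and compactness of families of curves\<close>

lemma uniform_limit_proj_matrix:
  assumes lim: "(\<lambda>n. curve_dist (fs n) f) \<longlonglongrightarrow> 0"
  shows "uniform_limit (cball z r) (\<lambda>n w. proj_matrix (fs n w) $ i $ k) (\<lambda>w. proj_matrix (f w) $ i $ k) sequentially"
proof (rule uniform_limitI)
  fix e :: real assume e: "e > 0"
  define B where "B = 1 + (cmod z + \<bar>r\<bar>)"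
  have B: "B > 0" by (auto simp: B_def intro!: add_pos_nonneg)
  have "\<forall>\<^sub>F n in sequentially. curve_dist (fs n) f < e / B"
    using lim by (rule order_tendstoD) (use e B in simp)
  then show "\<forall>\<^sub>F n in sequentially. \<forall>w\<in>cball z r. dist (proj_matrix (fs n w) $ i $ k) (proj_matrix (f w) $ i $ k) < e"
  proof eventually_elim
    case (elim n)
    show ?case
    proof
      fix w assume "w \<in> cball z r"
      then have "1 + cmod w \<le> B"
        using norm_triangle_ineq2[of w z] by (simp add: B_def dist_norm norm_minus_commute)
      have "dist (proj_matrix (fs n w) $ i $ k) (proj_matrix (f w) $ i $ k) \<le> dist (proj_matrix (fs n w) $ i) (proj_matrix (f w) $ i)"
        by (rule dist_vec_nth_le)
      also have "\<dots> \<le> dist (proj_matrix (fs n w)) (proj_matrix (f w))" by (rule dist_vec_nth_le)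
      also have "\<dots> = dist (fs n w) (f w)" by (rule isometry_proj_matrix)
      also have "\<dots> \<le> curve_dist (fs n) f * (1 + cmod w)" by (rule dist_le_curve_dist)
      also have "\<dots> \<le> curve_dist (fs n) f * B" by (intro mult_left_mono curve_dist_nonneg) fact
      also have "\<dots> < e" using elim B by (simp add: pos_less_divide_eq)
      finally show "dist (proj_matrix (fs n w) $ i $ k) (proj_matrix (f w) $ i $ k) < e" .
    qed
  qed
qed

text \<open>Weierstrass's theorem in a chart. On a small disc where the limit stays in chart
  \<open>j\<close>, the diagonal matrix entry is bounded away from 0; the affine coordinates, being
  quotients of matrix entries, converge uniformly there, and so their derivatives converge.\<close>

lemma curve_limit:
  assumes hol: "\<And>n. holomorphic_curve (fs n)" and cont: "continuous_on UNIV f"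
    and lim: "(\<lambda>n. curve_dist (fs n) f) \<longlonglongrightarrow> 0"
  shows "holomorphic_curve f" "(\<lambda>n. energy_density (fs n) z) \<longlonglongrightarrow> energy_density f z"
proof -
  have local: "\<exists>g'. \<forall>i. ((\<lambda>w. affine_coords j (f w) $ i) has_field_derivative g' $ i) (at z) \<and>
      (\<lambda>n. affine_coords j (fs n z) $ i) \<longlonglongrightarrow> affine_coords j (f z) $ i \<and>
      (\<lambda>n. velocity j (fs n) z $ i) \<longlonglongrightarrow> g' $ i \<and> (\<forall>\<^sub>F n in sequentially. in_chart j (fs n z))"
    if j: "in_chart j (f z)" for j z
  proof -
    have "open {z. in_chart j (f z)}"
      using open_vimage[OF open_chart cont, of j] by (simp add: vimage_def)
    then obtain r where r: "r > 0" "cball z r \<subseteq> {z. in_chart j (f z)}"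
      using j open_contains_cball by (metis mem_Collect_eq)
    define m where "m w = proj_matrix (f w) $ j $ j" for w
    have contm: "continuous_on A (\<lambda>w. proj_matrix (f w) $ i $ k)" for A i k
      by (intro continuous_intros continuous_on_compose2[OF continuous_on_proj_matrix continuous_on_subset[OF cont]]) auto
    have "\<exists>b>0. \<forall>w\<in>cball z r. b \<le> cmod (m w)"
    proof -
      obtain w0 where w0: "w0 \<in> cball z r" "\<And>w. w \<in> cball z r \<Longrightarrow> cmod (m w0) \<le> cmod (m w)"
        using continuous_attains_inf[of "cball z r" "\<lambda>w. cmod (m w)"] r(1) contm[of _ j j]
        unfolding m_def by (metis cball_eq_empty compact_cball continuous_on_norm not_less_iff_gr_or_eq)
      have "m w0 \<noteq> 0" using w0(1) r(2) proj_matrix_chart(1) unfolding m_def by blast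
      then show ?thesis using w0(2) by (intro exI[of _ "cmod (m w0)"]) auto
    qed
    then obtain b where b: "b > 0" "\<And>w. w \<in> cball z r \<Longrightarrow> b \<le> cmod (m w)" by blast
    have ev: "\<forall>\<^sub>F n in sequentially. \<forall>w\<in>cball z r. in_chart j (fs n w)"
      using uniform_limitD[OF uniform_limit_proj_matrix[OF lim, where z = z and r = r and i = j and k = j] b(1)]
    proof eventually_elim
      case (elim n)
      show ?case
      proof
        fix w assume w: "w \<in> cball z r"
        show "in_chart j (fs n w)"
        proof (rule ccontr)
          assume "\<not> in_chart j (fs n w)"
          then have "proj_matrix (fs n w) $ j $ j = 0" by (simp add: proj_matrix_chart(1))
          then have "cmod (m w) < b" using elim w by (force simp: m_def)
          then show False using b(2)[OF w] by simp
        qed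
      qed
    qed
    have ul: "uniform_limit (cball z r) (\<lambda>n w. affine_coords j (fs n w) $ i) (\<lambda>w. affine_coords j (f w) $ i) sequentially" for i
    proof -
      have "bounded ((\<lambda>w. proj_matrix (f w) $ i $ j) ` cball z r)"
        by (intro compact_imp_bounded compact_continuous_image contm compact_cball)
      then have u: "uniform_limit (cball z r) (\<lambda>n w. proj_matrix (fs n w) $ i $ j / proj_matrix (fs n w) $ j $ j)
          (\<lambda>w. proj_matrix (f w) $ i $ j / m w) sequentially"
        unfolding m_def using b unfolding m_def
        by (intro uniform_lim_divide uniform_limit_proj_matrix lim)
      have ev2: "\<forall>\<^sub>F n in sequentially. \<forall>w\<in>cball z r.
          proj_matrix (fs n w) $ i $ j / proj_matrix (fs n w) $ j $ j = affine_coords j (fs n w) $ i"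
        using ev by eventually_elim (simp add: proj_matrix_chart(2))
      have eq: "proj_matrix (f w) $ i $ j / m w = affine_coords j (f w) $ i" if "w \<in> cball z r" for w
        using r(2) that proj_matrix_chart(2)[of j "f w" i] by (auto simp: m_def)
      show ?thesis by (rule iffD1[OF uniform_limit_cong[OF ev2 eq] u])
    qed
    have "\<exists>d. ((\<lambda>w. affine_coords j (f w) $ i) has_field_derivative d) (at z) \<and>
      (\<lambda>n. velocity j (fs n) z $ i) \<longlonglongrightarrow> d" for i
    proof -
      have "\<forall>\<^sub>F n in sequentially. continuous_on (cball z r) (\<lambda>w. affine_coords j (fs n w) $ i) \<and>
         (\<forall>w\<in>ball z r. ((\<lambda>w. affine_coords j (fs n w) $ i) has_field_derivative velocity j (fs n) w $ i) (at w))"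
        using ev
      proof eventually_elim
        case (elim n)
        have d: "((\<lambda>w. affine_coords j (fs n w) $ i) has_field_derivative velocity j (fs n) w $ i) (at w)"
          if "w \<in> cball z r" for w
          by (rule affine_coords_deriv[OF hol]) (use elim that in blast)
        have "continuous_on (cball z r) (\<lambda>w. affine_coords j (fs n w) $ i)"
          by (intro continuous_at_imp_continuous_on ballI DERIV_isCont[OF d])
        then show ?case using d by simp
      qed
      then obtain g' where "\<And>w. w \<in> ball z r \<Longrightarrow> ((\<lambda>w. affine_coords j (f w) $ i) has_field_derivative (g' w)) (at w) \<and>
          ((\<lambda>n. velocity j (fs n) w $ i) \<longlonglongrightarrow> g' w)"
        by (rule has_complex_derivative_uniform_limit[OF _ ul trivial_limit_sequentially r(1)]) blast
      then show ?thesis using r(1) by (intro exI[of _ "g' z"]) simp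
    qed
    then obtain D where D: "\<And>i. ((\<lambda>w. affine_coords j (f w) $ i) has_field_derivative D i) (at z) \<and>
      (\<lambda>n. velocity j (fs n) z $ i) \<longlonglongrightarrow> D i" by metis
    have "(\<lambda>n. affine_coords j (fs n z) $ i) \<longlonglongrightarrow> affine_coords j (f z) $ i" for i
      using tendsto_uniform_limitI[OF ul, of z] r(1) by simp
    moreover have "\<forall>\<^sub>F n in sequentially. in_chart j (fs n z)"
      using ev by eventually_elim (use r(1) in simp)
    ultimately show ?thesis using D by (intro exI[of _ "\<chi> i. D i"]) simp
  qed
  show holf: "holomorphic_curve f"
    unfolding holomorphic_curve_def
  proof (intro conjI allI cont)
    fix j i
    show "(\<lambda>z. affine_coords j (f z) $ i) holomorphic_on {z. in_chart j (f z)}"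
      unfolding holomorphic_on_def field_differentiable_def
      using local has_field_derivative_at_within by blast
  qed
  obtain j where j: "in_chart j (f z)" using chart_exists by blast
  obtain g' where g': "\<And>i. ((\<lambda>w. affine_coords j (f w) $ i) has_field_derivative g' $ i) (at z)"
      "\<And>i. (\<lambda>n. affine_coords j (fs n z) $ i) \<longlonglongrightarrow> affine_coords j (f z) $ i"
      "\<And>i. (\<lambda>n. velocity j (fs n) z $ i) \<longlonglongrightarrow> g' $ i" "\<forall>\<^sub>F n in sequentially. in_chart j (fs n z)"
    using local[OF j] by blast
  have "g' = velocity j f z"
    using DERIV_unique[OF g'(1) affine_coords_deriv[OF holf j]] by (simp add: vec_eq_iff)
  then have V: "(\<lambda>n. velocity j (fs n) z) \<longlonglongrightarrow> velocity j f z" using g'(3) by (simp add: vec_tendstoI)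
  have F: "(\<lambda>n. affine_coords j (fs n z)) \<longlonglongrightarrow> affine_coords j (f z)" using g'(2) by (rule vec_tendstoI)
  have "(\<lambda>n. minors (affine_coords j (fs n z)) (velocity j (fs n) z) / (2 * pi * (norm (affine_coords j (fs n z)))^4))
     \<longlonglongrightarrow> minors (affine_coords j (f z)) (velocity j f z) / (2 * pi * (norm (affine_coords j (f z)))^4)"
    unfolding minors_def using affine_coords_props(2)[OF j] by (intro tendsto_intros V F) auto
  moreover have "\<forall>\<^sub>F n in sequentially. minors (affine_coords j (fs n z)) (velocity j (fs n) z) / (2 * pi * (norm (affine_coords j (fs n z)))^4)
      = energy_density (fs n) z"
    using g'(4) by eventually_elim (simp add: energy_density_chart hol)
  ultimately show "(\<lambda>n. energy_density (fs n) z) \<longlonglongrightarrow> energy_density f z"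
    unfolding energy_density_chart[OF holf j] by (rule Lim_transform_eventually)
qed

text \<open>Far out the weight alone suffices, as distances never exceed 2. On the remaining disc
  the common Lipschitz constant 3 transports control from a net of mesh \<open>e / 9\<close>, adding
  \<open>e / 3\<close> for each curve. It yields compactness for a dense set \<open>S\<close> and
  the comparison of topologies for \<open>S = UNIV\<close>.\<close>

lemma curve_dist_net:
  assumes e: "e > 0" and S: "\<forall>X :: complex set. open X \<longrightarrow> X \<noteq> {} \<longrightarrow> (\<exists>d\<in>S. d \<in> X)"
  shows "\<exists>T\<subseteq>S. finite T \<and> (\<forall>f\<in>brody_curves. \<forall>g\<in>brody_curves :: (complex \<Rightarrow> 'n::finite cproj) set.
    (\<forall>q\<in>T. dist (f q) (g q) < e / 3) \<longrightarrow> curve_dist f g \<le> e)"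
proof -
  obtain R where R: "R \<ge> 0" "2 \<le> e * (1 + R)"
  proof
    show "2 / e \<ge> 0" "2 \<le> e * (1 + 2 / e)" using e by (auto simp: field_simps)
  qed
  have "cball 0 R \<subseteq> (\<Union>q\<in>S. ball q (e / 9))"
  proof
    fix z :: complex
    obtain q where "q \<in> S" "q \<in> ball z (e / 9)" using S[rule_format, of "ball z (e / 9)"] e by auto
    then show "z \<in> (\<Union>q\<in>S. ball q (e / 9))" by (auto simp: dist_commute)
  qed
  then obtain T where T: "T \<subseteq> S" "finite T" "cball 0 R \<subseteq> (\<Union>q\<in>T. ball q (e / 9))"
    using compactE_image[OF compact_cball, of S "\<lambda>q. ball q (e / 9)"] by (metis open_ball)
  have "curve_dist f g \<le> e" if "f \<in> brody_curves" "g \<in> brody_curves" "\<forall>q\<in>T. dist (f q) (g q) < e / 3" for f g :: "complex \<Rightarrow> 'n cproj"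
    unfolding curve_dist_le_iff
  proof
    fix z
    show "dist (f z) (g z) \<le> e * (1 + cmod z)"
    proof (cases "z \<in> cball 0 R")
      case True
      then obtain q where q: "q \<in> T" "cmod (q - z) < e / 9" using T(3) by (auto simp: dist_norm)
      have "dist (f z) (f q) \<le> 3 * cmod (q - z)" "dist (g z) (g q) \<le> 3 * cmod (q - z)"
        using brody_lipschitz that(1,2) by blast+
      moreover have "dist (f q) (g q) < e / 3" using that(3) q(1) by blast
      moreover have "dist (f z) (g z) \<le> dist (f z) (f q) + dist (f q) (g q) + dist (g z) (g q)"
        using dist_triangle[of "f z" "g z" "f q"] dist_triangle[of "f q" "g z" "g q"]
        by (simp add: dist_commute)
      ultimately have "dist (f z) (g z) \<le> e" using q(2) by linarith
      also have "\<dots> \<le> e * (1 + cmod z)" using e by (simp add: distrib_left)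
      finally show ?thesis .
    next
      case False
      have "dist (f z) (g z) \<le> e * (1 + R)" using dist_cproj_le_2 R(2) order_trans by blast
      also have "\<dots> \<le> e * (1 + cmod z)" using False e by (intro mult_left_mono) auto
      finally show ?thesis .
    qed
  qed
  then show ?thesis using T(1,2) by blast
qed

lemma brody_uniformly_Cauchy:
  fixes g :: "nat \<Rightarrow> complex \<Rightarrow> 'n::finite cproj"
  assumes g: "\<And>n. g n \<in> brody_curves" and S: "\<forall>X :: complex set. open X \<longrightarrow> X \<noteq> {} \<longrightarrow> (\<exists>d\<in>S. d \<in> X)"
    and C: "\<And>q. q \<in> S \<Longrightarrow> Cauchy (\<lambda>n. g n q)" and e: "e > 0"
  shows "\<exists>N. \<forall>m\<ge>N. \<forall>n\<ge>N. curve_dist (g m) (g n) \<le> e"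
proof -
  from curve_dist_net[OF e S] obtain T where T: "finite T" "T \<subseteq> S"
    and close: "\<forall>f\<in>brody_curves. \<forall>h\<in>brody_curves :: (complex \<Rightarrow> 'n cproj) set. (\<forall>q\<in>T. dist (f q) (h q) < e / 3) \<longrightarrow> curve_dist f h \<le> e"
    by blast
  have "\<exists>N. \<forall>m\<ge>N. \<forall>n\<ge>N. dist (g m q) (g n q) < e / 3" if "q \<in> T" for q
    using metric_CauchyD[OF C, of q "e / 3"] T(2) e that by auto
  then obtain N where N: "\<And>q m n. \<lbrakk>q \<in> T; m \<ge> N q; n \<ge> N q\<rbrakk> \<Longrightarrow> dist (g m q) (g n q) < e / 3" by metis
  obtain N0 where N0: "\<And>q. q \<in> T \<Longrightarrow> N q \<le> N0"
    using finite_nat_set_iff_bounded_le[of "N ` T"] T(1) by auto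
  have "curve_dist (g m) (g n) \<le> e" if mn: "m \<ge> N0" "n \<ge> N0" for m n
  proof (rule close[rule_format, OF g g])
    fix q assume "q \<in> T"
    then show "dist (g m q) (g n q) < e / 3" using N[of q m n] N0[of q] mn by simp
  qed
  then show ?thesis by blast
qed

text \<open>The Arzela-Ascoli argument: a diagonal subsequence converges on a countable dense set,
  equicontinuity makes it Cauchy in \<open>curve_dist\<close>, and the energy bound passes to the
  limit by \<open>curve_limit\<close>.\<close>

lemma brody_sequentially_compact:
  fixes \<sigma> :: "nat \<Rightarrow> complex \<Rightarrow> 'n::finite cproj"
  assumes \<sigma>: "\<And>n. \<sigma> n \<in> brody_curves"
  obtains f r where "f \<in> brody_curves" "strict_mono r" "(\<lambda>n. curve_dist (\<sigma> (r n)) f) \<longlonglongrightarrow> 0"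
proof -
  obtain S :: "complex set" where S: "countable S" "\<forall>X. open X \<longrightarrow> X \<noteq> {} \<longrightarrow> (\<exists>d\<in>S. d \<in> X)"
    using countable_dense_exists by blast
  have "norm (proj_matrix p) \<le> 1" for p :: "'n cproj"
    using cproj_cases[of p] by (metis norm_projector order_refl proj_matrix_abs)
  then obtain r where r: "strict_mono r" "\<And>x. x \<in> S \<Longrightarrow> \<exists>l. (\<lambda>n. proj_matrix (\<sigma> (r n) x)) \<longlonglongrightarrow> l"
    using function_convergent_subsequence[OF S(1), of "\<lambda>n x. proj_matrix (\<sigma> n x)" 1] by metis
  define g where "g n = \<sigma> (r n)" for n
  have g: "g n \<in> brody_curves" for n by (simp add: g_def \<sigma>)
  have Cauchy_S: "Cauchy (\<lambda>n. g n q)" if q: "q \<in> S" for q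
  proof -
    have "Cauchy (\<lambda>n. proj_matrix (g n q))"
      using r(2)[OF q] unfolding g_def by (auto intro: LIMSEQ_imp_Cauchy)
    then show ?thesis unfolding Cauchy_def isometry_proj_matrix .
  qed
  have uc: "\<exists>N. \<forall>m\<ge>N. \<forall>n\<ge>N. curve_dist (g m) (g n) \<le> e" if e: "e > 0" for e
  proof (rule brody_uniformly_Cauchy[of g S])
    show "g n \<in> brody_curves" for n by (rule g)
    show "\<forall>X. open X \<longrightarrow> X \<noteq> {} \<longrightarrow> (\<exists>d\<in>S. d \<in> X)" by (rule S(2))
    show "Cauchy (\<lambda>n. g n q)" if "q \<in> S" for q by (rule Cauchy_S[OF that])
    show "0 < e" by (rule e)
  qed
  have "\<exists>l. (\<lambda>n. g n z) \<longlonglongrightarrow> l" for z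
  proof -
    have "Cauchy (\<lambda>n. g n z)"
    proof (rule metric_CauchyI)
      fix e :: real assume e: "e > 0"
      define A where "A = 1 + cmod z"
      define e' where "e' = e / (2 * A)"
      have "A > 0" unfolding A_def by (rule one_plus_norm_pos)
      then have "e' > 0" "e' * A < e" using e by (simp_all add: e'_def)
      then have e': "e' > 0" "e' * (1 + cmod z) < e" unfolding A_def .
      obtain N where "\<forall>m\<ge>N. \<forall>n\<ge>N. curve_dist (g m) (g n) \<le> e'" using uc[OF e'(1)] by blast
      then show "\<exists>N. \<forall>m\<ge>N. \<forall>n\<ge>N. dist (g m z) (g n z) < e"
        unfolding curve_dist_le_iff using e'(2) le_less_trans by blast
    qed
    then show ?thesis
      using compact_imp_complete[OF compact_cproj] unfolding complete_def by blast
  qed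
  then obtain f where f: "\<And>z. (\<lambda>n. g n z) \<longlonglongrightarrow> f z" by metis
  have lim: "(\<lambda>n. curve_dist (g n) f) \<longlonglongrightarrow> 0"
  proof (rule LIMSEQ_I)
    fix e :: real assume e: "e > 0"
    obtain N where N: "\<And>m n. \<lbrakk>m \<ge> N; n \<ge> N\<rbrakk> \<Longrightarrow> curve_dist (g m) (g n) \<le> e / 2" using uc[of "e / 2"] e by auto
    have le: "curve_dist (g n) f \<le> e / 2" if n: "n \<ge> N" for n
      unfolding curve_dist_le_iff
    proof
      fix z
      show "dist (g n z) (f z) \<le> e / 2 * (1 + cmod z)"
      proof (rule LIMSEQ_le_const2[OF tendsto_dist[OF tendsto_const f]], intro exI allI impI)
        fix m assume "N \<le> m"
        then show "dist (g n z) (g m z) \<le> e / 2 * (1 + cmod z)" using N[OF n] curve_dist_le_iff by blast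
      qed
    qed
    show "\<exists>N. \<forall>n\<ge>N. norm (curve_dist (g n) f - 0) < e"
    proof (intro exI allI impI)
      fix n assume "N \<le> n"
      from le[OF this] show "norm (curve_dist (g n) f - 0) < e"
        using e curve_dist_nonneg[of "g n" f] by simp
    qed
  qed
  have lip: "dist (f a) (f b) \<le> 3 * cmod (b - a)" for a b
    by (rule LIMSEQ_le_const2[OF tendsto_dist[OF f f]]) (use brody_lipschitz g in blast)
  have "continuous_on UNIV f"
    unfolding continuous_on_iff
  proof (intro ballI allI impI)
    fix x :: complex and e :: real assume "0 < e"
    have "dist (f y) (f x) < e" if "dist y x < e / 3" for y
      using lip[of y x] that by (simp add: dist_norm norm_minus_commute)
    then show "\<exists>d>0. \<forall>y\<in>UNIV. dist y x < d \<longrightarrow> dist (f y) (f x) < e"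
      using \<open>0 < e\<close> by (intro exI[of _ "e / 3"]) auto
  qed
  note limit = curve_limit[OF _ this lim]
  have "f \<in> brody_curves"
    unfolding brody_curves_iff
  proof (intro conjI allI)
    show "holomorphic_curve f" by (rule limit(1)) (use g brody_curves_iff in blast)
    show "energy_density f z \<le> 1" for z
      by (rule LIMSEQ_le_const2[OF limit(2)]) (use g brody_curves_iff in blast)+
  qed
  then show ?thesis using that r(1) lim unfolding g_def by blast
qed

interpretation brody: Metric_space brody_curves curve_dist
  by (rule Metric_space_curve_dist)

lemma compact_brody: "compact_space (brody.mtopology :: (complex \<Rightarrow> 'n::finite cproj) topology)"
  unfolding compact_space_def brody.compactin_sequentially brody.topspace_mtopology
proof (intro conjI allI impI)
  fix \<sigma> :: "nat \<Rightarrow> complex \<Rightarrow> 'n::finite cproj" assume "range \<sigma> \<subseteq> brody_curves"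
  then have \<sigma>: "\<And>n. \<sigma> n \<in> brody_curves" by auto
  obtain f r where "f \<in> brody_curves" "strict_mono r" "(\<lambda>n. curve_dist (\<sigma> (r n)) f) \<longlonglongrightarrow> 0"
    by (rule brody_sequentially_compact[OF \<sigma>])
  then show "\<exists>l r. l \<in> brody_curves \<and> strict_mono r \<and> limitin brody.mtopology (\<sigma> \<circ> r) l sequentially"
    using \<sigma> by (intro exI[of _ f] exI[of _ r]) (auto simp: brody.limitin_metric_dist_null o_def)
qed auto

lemma continuous_brody: "f \<in> brody_curves \<Longrightarrow> continuous_on UNIV f"
  by (simp add: brody_curves_def holomorphic_curve_def)

text \<open>A compact set has bounded weight and its image keeps a distance from the complement of
  \<open>U\<close>, so subbasic sets are open for the metric. Conversely, by equicontinuity a metric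
  ball contains a neighbourhood given by conditions at finitely many single points.\<close>

lemma brody_space_eq: "(brody_space :: (complex \<Rightarrow> 'n::finite cproj) topology) = brody.mtopology"
proof -
  define \<S> :: "(complex \<Rightarrow> 'n::finite cproj) set set" where
    "\<S> = {{f. continuous_on UNIV f \<and> f ` K \<subseteq> U} | K U. compact K \<and> open U}"
  have brody: "brody_space = subtopology (topology_generated_by \<S>) brody_curves"
    by (simp add: brody_space_def compact_open_topology_def \<S>_def brody_curves_def)
  have sub: "brody_curves \<subseteq> \<Union>\<S>"
  proof
    fix f :: "complex \<Rightarrow> 'n cproj" assume "f \<in> brody_curves"
    then have "f \<in> {f. continuous_on UNIV f \<and> f ` {} \<subseteq> UNIV}" using continuous_brody by simp
    moreover have "{f. continuous_on UNIV f \<and> f ` {} \<subseteq> UNIV} \<in> \<S>"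
      unfolding \<S>_def by (rule CollectI, rule exI[of _ "{}"], rule exI[of _ UNIV]) simp
    ultimately show "f \<in> \<Union>\<S>" by blast
  qed
  have "continuous_map brody.mtopology brody_space (\<lambda>f :: complex \<Rightarrow> 'n cproj. f)"
    unfolding brody continuous_map_in_subtopology
  proof
    show "continuous_map brody.mtopology (topology_generated_by \<S>) (\<lambda>f. f)"
    proof (rule continuous_on_generated_topo)
      fix V assume "V \<in> \<S>"
      then obtain K U where V: "V = {f. continuous_on UNIV f \<and> f ` K \<subseteq> U}" "compact K" "open U"
        by (auto simp: \<S>_def)
      show "openin brody.mtopology ((\<lambda>f. f) -` V \<inter> topspace brody.mtopology)"
        unfolding brody.openin_mtopology
      proof (intro conjI allI impI)
        fix f assume "f \<in> (\<lambda>f. f) -` V \<inter> topspace brody.mtopology"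
        then have f: "f \<in> brody_curves" "continuous_on UNIV f" "f ` K \<subseteq> U" using V by auto
        have "compact (f ` K)"
          using V(2) f(2) compact_continuous_image continuous_on_subset by blast
        then obtain e where e: "e > 0" "(\<Union>x\<in>f ` K. ball x e) \<subseteq> U"
          using compact_subset_open_imp_ball_epsilon_subset[OF _ V(3) f(3)] by metis
        obtain R where R: "\<And>z. z \<in> K \<Longrightarrow> cmod z \<le> R" "R \<ge> 0"
          using compact_imp_bounded[OF V(2)] unfolding bounded_iff
          by (metis max.cobounded1 max.cobounded2 order_trans)
        have "brody.mball f (e / (1 + R)) \<subseteq> (\<lambda>f. f) -` V \<inter> topspace brody.mtopology"
        proof
          fix g assume g: "g \<in> brody.mball f (e / (1 + R))"
          have "g z \<in> U" if z: "z \<in> K" for z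
          proof -
            have "dist (f z) (g z) \<le> curve_dist f g * (1 + cmod z)" by (rule dist_le_curve_dist)
            also have "\<dots> \<le> curve_dist f g * (1 + R)" using R(1)[OF z] curve_dist_nonneg by (intro mult_left_mono) auto
            also have "\<dots> < e" using g R(2) by (simp add: pos_less_divide_eq)
            finally have "g z \<in> ball (f z) e" by simp
            then show ?thesis using e(2) z by blast
          qed
          then show "g \<in> (\<lambda>f. f) -` V \<inter> topspace brody.mtopology"
            using g V(1) continuous_brody by auto
        qed
        then show "\<exists>r>0. brody.mball f r \<subseteq> (\<lambda>f. f) -` V \<inter> topspace brody.mtopology"
          using e(1) R(2) by (intro exI[of _ "e / (1 + R)"]) auto
      qed auto
    qed (use sub in simp)
  qed simp
  then have 1: "openin brody.mtopology U" if "openin brody_space U" for U :: "(complex \<Rightarrow> 'n cproj) set"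
    using that openin_continuous_map_preimage[of brody.mtopology brody_space "\<lambda>f :: complex \<Rightarrow> 'n cproj. f" U]
      openin_subset[OF that] by (simp add: brody Collect_conj_eq Int_absorb1 inf.absorb2)
  have 2: "openin brody_space U" if U: "openin brody.mtopology U" for U :: "(complex \<Rightarrow> 'n cproj) set"
  proof (subst openin_subopen, intro ballI)
    fix f assume "f \<in> U"
    then obtain e where e: "e > 0" "brody.mball f e \<subseteq> U" and f: "f \<in> brody_curves"
      using U unfolding brody.openin_mtopology by blast
    have "\<exists>T\<subseteq>UNIV :: complex set. finite T \<and> (\<forall>f\<in>brody_curves. \<forall>g\<in>brody_curves :: (complex \<Rightarrow> 'n cproj) set.
        (\<forall>q\<in>T. dist (f q) (g q) < e / 2 / 3) \<longrightarrow> curve_dist f g \<le> e / 2)"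
      using e(1) by (intro curve_dist_net) auto
    then obtain T :: "complex set" where T: "finite T"
        "\<And>g. \<lbrakk>g \<in> brody_curves; \<forall>q\<in>T. dist (f q) (g q) < e / 2 / 3\<rbrakk> \<Longrightarrow> curve_dist f g \<le> e / 2"
      using f by blast
    define W where "W q = {g. continuous_on UNIV g \<and> g ` {q} \<subseteq> ball (f q) (e / 2 / 3)}" for q
    have W: "openin (topology_generated_by \<S>) (W q)" for q
      unfolding W_def \<S>_def
      by (rule topology_generated_by_Basis, rule CollectI, rule exI[of _ "{q}"], rule exI[of _ "ball (f q) (e / 2 / 3)"]) simp
    have "openin (topology_generated_by \<S>) (topspace (topology_generated_by \<S>) \<inter> (\<Inter>q\<in>T. W q))"
      using W T(1) by (cases "T = {}") (auto intro: openin_INT simp del: topology_generated_by_topspace)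
    then have "openin brody_space (brody_curves \<inter> (topspace (topology_generated_by \<S>) \<inter> (\<Inter>q\<in>T. W q)))"
      unfolding brody by (metis inf_commute openin_subtopology_Int)
    moreover have "f \<in> brody_curves \<inter> (topspace (topology_generated_by \<S>) \<inter> (\<Inter>q\<in>T. W q))"
      using f sub continuous_brody[OF f] e(1) by (auto simp: W_def)
    moreover have "brody_curves \<inter> (topspace (topology_generated_by \<S>) \<inter> (\<Inter>q\<in>T. W q)) \<subseteq> brody.mball f e"
    proof
      fix g assume g: "g \<in> brody_curves \<inter> (topspace (topology_generated_by \<S>) \<inter> (\<Inter>q\<in>T. W q))"
      then have gB: "g \<in> brody_curves" by blast
      have "curve_dist f g \<le> e / 2"
        by (rule T(2)[OF gB]) (use g in \<open>auto simp: W_def\<close>)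
      then show "g \<in> brody.mball f e" using f gB e(1) by simp
    qed
    ultimately show "\<exists>T. openin brody_space T \<and> f \<in> T \<and> T \<subseteq> U" using e(2) by blast
  qed
  show ?thesis unfolding topology_eq using 1 2 by blast
qed

interpretation brody: compact_action brody_curves curve_dist translate
proof
  show "compact_space brody.mtopology" by (rule compact_brody)
  show "translate a f \<in> brody_curves" if "f \<in> brody_curves" for a and f :: "complex \<Rightarrow> 'a cproj"
    by (rule brody_translate[OF that])
  show "translate 0 f = f" for f :: "complex \<Rightarrow> 'a cproj"
    by (simp add: translate_def)
  show "translate a (translate b f) = translate (a + b) f" for a b and f :: "complex \<Rightarrow> 'a cproj"
    by (rule translate_compose)
  show "\<exists>\<delta>>0. \<forall>f\<in>brody_curves. \<forall>g\<in>brody_curves. \<forall>a. cmod a \<le> R \<and> curve_dist f g < \<delta> \<longrightarrow>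
      curve_dist (translate a f) (translate a (g :: complex \<Rightarrow> 'a cproj)) < e" if "e > 0" for e R
  proof (intro exI conjI ballI allI impI)
    have pos: "0 < 1 + \<bar>R\<bar>" by linarith
    then show "0 < e / (1 + \<bar>R\<bar>)" using that by simp
    fix f g :: "complex \<Rightarrow> 'a cproj" and a assume "f \<in> brody_curves" "g \<in> brody_curves"
      and h: "cmod a \<le> R \<and> curve_dist f g < e / (1 + \<bar>R\<bar>)"
    have "curve_dist (translate a f) (translate a g) \<le> (1 + cmod a) * curve_dist f g"
      using curve_dist_translate[OF \<open>g \<in> brody_curves\<close>, of a f a] by simp
    also have "\<dots> \<le> (1 + \<bar>R\<bar>) * curve_dist f g" using h curve_dist_nonneg by (intro mult_right_mono) auto
    also have "\<dots> < e" using h pos by (simp add: pos_less_divide_eq mult.commute)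
    finally show "curve_dist (translate a f) (translate a g) < e" .
  qed
qed

text \<open>Derivatives are controlled by the metric only through holomorphy, which enters via
  \<open>curve_limit\<close> along a sequence of supposed counterexamples.\<close>

lemma energy_density_continuous:
  assumes f: "f \<in> brody_curves" and e: "e > 0"
  shows "\<exists>\<delta>>0. \<forall>g\<in>brody_curves. curve_dist f g < \<delta> \<longrightarrow> \<bar>energy_density f 0 - energy_density g 0\<bar> < e"
proof (rule ccontr)
  assume "\<not> ?thesis"
  then have "\<exists>g\<in>brody_curves. curve_dist f g < inverse (real (Suc n)) \<and> e \<le> \<bar>energy_density f 0 - energy_density g 0\<bar>" for n
    by (metis inverse_Suc not_le)
  then obtain g where g: "\<And>n. g n \<in> brody_curves" "\<And>n. curve_dist f (g n) < inverse (real (Suc n))"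
      "\<And>n. e \<le> \<bar>energy_density f 0 - energy_density (g n) 0\<bar>"
    by metis
  have "(\<lambda>n. curve_dist (g n) f) \<longlonglongrightarrow> 0"
    by (rule tendsto_sandwich[OF _ _ tendsto_const LIMSEQ_inverse_real_of_nat])
      (use g(2) curve_dist_nonneg brody.commute[of f] in \<open>auto intro!: always_eventually less_imp_le\<close>)
  then have "(\<lambda>n. energy_density (g n) 0) \<longlonglongrightarrow> energy_density f 0"
    using g(1) by (intro curve_limit(2) continuous_brody[OF f]) (auto simp: brody_curves_iff)
  then have "(\<lambda>n. \<bar>energy_density f 0 - energy_density (g n) 0\<bar>) \<longlonglongrightarrow> \<bar>energy_density f 0 - energy_density f 0\<bar>"
    by (intro tendsto_intros)
  then have "e \<le> \<bar>energy_density f 0 - energy_density f 0\<bar>"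
    by (rule LIMSEQ_le_const) (use g(3) in blast)
  then show False using e by simp
qed

lemma energy_action_brody:
  assumes "closedin brody_space M" "\<And>a f. f \<in> M \<Longrightarrow> translate a f \<in> M"
  shows "energy_action M curve_dist translate (\<lambda>f. energy_density f 0)"
proof -
  have closed: "closedin brody.mtopology M" using assms(1) by (simp add: brody_space_eq)
  interpret M: compact_action M curve_dist translate
    by (rule brody.compact_action_subset[OF closed assms(2)])
  have sub: "M \<subseteq> brody_curves" using closedin_subset[OF closed] by simp
  show ?thesis
  proof
    have "continuous_map M.mtopology (mtopology_of euclidean_metric) (\<lambda>f. energy_density f 0)"
      unfolding mtopology_of_def mspace_euclidean_metric mdist_euclidean_metric
        M.metric_continuous_map[OF Met_TC.Metric_space_axioms]
    proof (intro conjI ballI allI impI)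
      fix f and e :: real assume "f \<in> M" "0 < e"
      then show "\<exists>\<delta>>0. \<forall>g. g \<in> M \<and> curve_dist f g < \<delta> \<longrightarrow> dist (energy_density f 0) (energy_density g 0) < e"
        using energy_density_continuous[of f e] sub unfolding dist_real_def by blast
    qed simp
    then show "continuous_map M.mtopology euclideanreal (\<lambda>f. energy_density f 0)" by simp
    show "0 \<le> energy_density f 0" "energy_density f 0 \<le> 1" if "f \<in> M" for f
    proof -
      have f: "holomorphic_curve f" "energy_density f 0 \<le> 1" using that sub by (auto simp: brody_curves_iff)
      show "0 \<le> energy_density f 0" by (rule energy_density_nonneg[OF f(1)])
      show "energy_density f 0 \<le> 1" by (rule f(2))
    qed
    show "continuous_on UNIV (\<lambda>a. energy_density (translate a f) 0)" if "f \<in> M" for f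
      unfolding continuous_on_iff
    proof (intro ballI allI impI)
      fix a and e :: real assume "0 < e"
      have f: "f \<in> brody_curves" using that sub by blast
      obtain \<delta> where \<delta>: "\<delta> > 0" "\<And>g. \<lbrakk>g \<in> brody_curves; curve_dist (translate a f) g < \<delta>\<rbrakk> \<Longrightarrow>
          \<bar>energy_density (translate a f) 0 - energy_density g 0\<bar> < e"
        using energy_density_continuous[OF brody_translate[OF f] \<open>0 < e\<close>] by blast
      have "curve_dist f f = 0" using brody.mdist_zero[OF f] .
      then have near: "curve_dist (translate a f) (translate b f) \<le> 3 * cmod (b - a)" for b
        using curve_dist_translate[OF f, of a f b] by simp
      have "dist (energy_density (translate b f) 0) (energy_density (translate a f) 0) < e" if "dist b a < \<delta> / 3" for b
      proof -
        have "curve_dist (translate a f) (translate b f) < \<delta>" using near[of b] that by (simp add: dist_norm)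
        from \<delta>(2)[OF brody_translate[OF f] this] show ?thesis by (simp add: dist_real_def abs_minus_commute)
      qed
      then show "\<exists>d>0. \<forall>b\<in>UNIV. dist b a < d \<longrightarrow> dist (energy_density (translate b f) 0) (energy_density (translate a f) 0) < e"
        using \<delta>(1) by (intro exI[of _ "\<delta> / 3"]) auto
    qed
  qed
qed

theorem theorem1p8:
  fixes M :: "(complex \<Rightarrow> 'n::finite cproj) set"
  assumes "closedin brody_space M"
    and "\<forall>a. \<forall>f\<in>M. translate a f \<in> M"
  shows "mean_dim (subtopology brody_space M) translate =
    mean_dim (subtopology brody_space (positive_part M)) translate"
proof -
  interpret M: energy_action M curve_dist translate "\<lambda>f. energy_density f 0"
    by (rule energy_action_brody) (use assms in auto)
  have closed: "closedin brody.mtopology M" using assms(1) by (simp add: brody_space_eq)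
  have sub: "M \<subseteq> brody_curves" using closedin_subset[OF closed] by simp
  have top: "M.mtopology = subtopology brody_space M"
    unfolding brody_space_eq by (rule brody.mtopology_subset(2)[OF sub])
  have hol: "holomorphic_curve f" if "f \<in> M" for f using that sub by (auto simp: brody_curves_iff)
  have energy: "M.orbit_mean_energy f = mean_energy f" if "f \<in> M" for f
    unfolding M.orbit_mean_energy_def mean_energy_def M.disc_energy_def characteristic_def
    by (simp add: energy_density_translate[OF hol[OF that]] fs_norm_sq[OF hol[OF that]])
  define P where "P = {f \<in> M. mean_energy f > 0}"
  have P: "{f \<in> M. M.orbit_mean_energy f > 0} = P" using energy by (auto simp: P_def)
  have pos: "positive_part M = brody_space closure_of P"
    by (simp add: positive_part_def P_def)
  have posM: "positive_part M \<subseteq> M"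
    unfolding pos by (rule closure_of_minimal[OF _ assms(1)]) (auto simp: P_def)
  \<comment> \<open>The closure is defined in the space of all Brody curves, while the abstract
    theorem takes it inside \<open>M\<close>; they agree because \<open>M\<close> is closed.\<close>
  have "subtopology brody_space M closure_of P = positive_part M"
    using posM by (auto simp: closure_of_subtopology pos P_def Int_absorb1 inf.absorb2)
  \<comment> \<open>Vanishing at the origin for every translate means vanishing everywhere, so the
    curve is constant.\<close>
  moreover have "translate a f = f" if "f \<in> M" "\<And>b. energy_density (translate b f) 0 = 0" for a f
  proof
    fix z
    have "energy_density f z = 0" for z
      using that(2)[of z] energy_density_translate[OF hol[OF that(1)], of z 0] by simp
    then show "translate a f z = f z"
      using zero_energy_imp_constant[OF hol[OF that(1)]] by (simp add: translate_def)
  qed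
  ultimately have "mean_dim (subtopology brody_space M) translate =
      mean_dim (subtopology (subtopology brody_space M) (positive_part M)) translate"
    using M.mean_dim_positive_energy unfolding P top by simp
  also have "subtopology (subtopology brody_space M) (positive_part M) = subtopology brody_space (positive_part M)"
    using posM by (simp add: subtopology_subtopology inf.absorb2)
  finally show ?thesis .
qed

end
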